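(* Let $n\ge1$, $\alpha=\pi/(2n+1)$, and let $\Gamma$ be the exchange graph of the initial seed $(\mathbf v_0,B_0)$, with initial triangle $\Delta_0$, initial acyclic belt $I$, belt line $b$ and translation lattice $L$. Then $\Gamma$ has the following structure. 1. The acyclic belt $I+w$ is a full subgraph of $\Gamma$ for every $w\in L$. 2. Suppose that $n_1,n_2,n_3\in[0,2n+1]$ are natural numbers with $n_1+n_2+n_3=2n+1$ and $\gcd(n_1,n_2,n_3)=1$, so that there exists a Euclidean triangle $\Delta$ with angles $n_1\alpha,n_2\alpha,n_3\alpha$, scaled so that $T(\Delta)=T(\Delta_0)$. Furthermore, let $Q$ be a quiver corresponding to $\Delta$ (its vertices are the sides of $\Delta$), which is acyclic if $\Delta$ is acute-angled and cyclic if $\Delta$ is obtuse-angled. Then there exist exactly two seeds in $\Gamma$ whose triangle is congruent to $\Delta$ and whose quiver is $Q$. Furthermore, two such seeds are related to each other by a translation by a vector in $L$ or a reflection across the belt line $b$.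
   Context: **Exchange matrices.** An exchange matrix is a real skew-symmetric $3\times3$ matrix $B=(b_{ij})$, identified with the quiver on $\{1,2,3\}$ having an arrow $i\to j$ of weight $b_{ij}$ whenever $b_{ij}>0$; it is acyclic if this quiver has no oriented cycle, cyclic otherwise. The mutation $\mu_k(B)=(b'_{ij})$ is given by $b'_{ij}=-b_{ij}$ if $k\in\{i,j\}$ and $b'_{ij}=b_{ij}+(b_{ik}|b_{kj}|+|b_{ik}|b_{kj})/2$ otherwise. **Seeds in $\mathbb E^2$.** Let $V$ be the space of affine functions $f(x)=\langle a,x\rangle+c$ on the Euclidean plane $\mathbb E^2$ with the form $(f,g)=\langle a,a'\rangle$ for $g(x)=\langle a',x\rangle+c'$; for non-constant $f$ put $\Pi_f=\{f<0\}$, $l_f=\{f=0\}$. A geometric realisation of $B$ is a basis $\mathbf v=(v_1,v_2,v_3)$ of $V$ with $(v_i,v_i)=2$, $|(v_i,v_j)|=|b_{ij}|$ for $i\neq j$, and such that, if all $(v_i,v_j)\ne0$, the number of pairs $i<j$ with $(v_i,v_j)>0$ is even if $B$ is acyclic and odd otherwise. A seed is a pair $(\mathbf v,B)$ up to simultaneous permutation of indices. It is represented by the domain $\Pi_{v_1}\cap\Pi_{v_2}\cap\Pi_{v_3}$, a triangle or an infinite region bounded by two parallel half-lines and a segment, together with the quiver of $B$, whose vertices are the sides (weights are $2\cos$ of the angle between the corresponding lines). Triangles of acyclic (cyclic) seeds are acute-angled (obtuse-angled). **Mutation.** Given a notion of positive/negative vectors ($v$ negative iff $-v$ positive), $\mu_k(\mathbf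 v,B)=(\mathbf v',\mu_k(B))$ with $v_k'=-v_k$ and, for $i\ne k$: if $v_k$ is positive, $v_i'=v_i$ when $b_{ik}>0$ and $v_i'=v_i-(v_i,v_k)v_k$ when $b_{ik}<0$; otherwise, $v_i'=v_i$ when $b_{ik}<0$ and $v_i'=v_i-(v_i,v_k)v_k$ when $b_{ik}>0$. (If $b_{ik}=0$, both formulas give $v_i'=v_i$.) The exchange graph of a seed has as vertices all seeds obtained from it by sequences of mutations; edges join seeds related by a single mutation. **Initial seed.** $\Delta_0$ is an isosceles triangle $XYZ$ with angle $n\alpha$ at $X$ and at $Y$ and angle $\alpha$ at $Z$. The initial seed is given by $\Delta_0$ with the acyclic quiver having arrows $XY\to XZ$, $XY\to YZ$, $XZ\to YZ$ (source $XY$, sink $YZ$). The belt line $b$ is the line through the feet of the altitudes of $\Delta_0$ on the sides $XY$ and $YZ$. The reference point $u$ lies infinitely far away on $b$, in the direction from the source to the sink; $v$ is positive iff $u$ belongs to $\Pi_v$, that is, iff all points of $b$ sufficiently far in this direction lie in $\Pi_v$. **Belts, translations, $L$, $T$.** The initial acyclic belt $I$ is the bi-infinite path of seeds $I_m$, $m\in\mathbb Z$, with $I_0=(\mathbf v_0,B_0)$ and $I_{m+1}$ obtained from $I_m$ by mutation at a source. For a vector $w$, $w+(\mathbf v,B)$ is the seed with domain translated by $w$ and the same quiver, and $I+w$ is the infinite path graph with vertices $w+I_m$. $L$ is the $\mathbb Z$-module spanned by the Euclidean lengths of all vectors $w\in\mathbb E^2$ such that $\Gamma$ contains two seeds that differ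 by the translation by $w$; all such vectors $w$ are parallel to $b$, and elements of $L$ are regarded as vectors parallel to $b$ (multiples of a fixed unit vector along $b$). For a triangle with vertices $A_1,A_2,A_3$ and opposite side lengths $a_1,a_2,a_3$, $T(\Delta)=a_1\sin(A_2)\sin(A_3)$ (independent of the numbering); for an infinite region bounded by two parallel lines and a finite side $a_3$ meeting them at angles $\beta$ and $\pi-\beta$, $T(\Delta)=a_3\sin^2(\beta)$.
   Formalization: "Exactly two seeds" is counted up to translations by vectors in L; "reflection across b" is allowed to be followed by a translation w along b with 2w in L; "whose quiver is Q" means up to isomorphism, which matters only for infinite regions. *)

theory Defs
  imports "HOL-Analysis.Analysis"
begin

section \<open>Affine functions on the Euclidean plane\<close>

text \<open>The pair \<open>(a, c)\<close> stands for the affine function \<open>x \<mapsto> \<langle>a,x\<rangle> + c\<close>.\<close>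

type_synonym aff = "(real^2) \<times> real"

definition eval :: "aff \<Rightarrow> real^2 \<Rightarrow> real" where
  "eval f x = fst f \<bullet> x + snd f"

definition form :: "aff \<Rightarrow> aff \<Rightarrow> real" where
  "form f g = fst f \<bullet> fst g"

definition halfplane :: "aff \<Rightarrow> (real^2) set" where
  "halfplane f = {x. eval f x < 0}"

definition line :: "aff \<Rightarrow> (real^2) set" where
  "line f = {x. eval f x = 0}"

definition isometry :: "(real^2 \<Rightarrow> real^2) \<Rightarrow> bool" where
  "isometry \<phi> \<longleftrightarrow> (\<forall>x y. dist (\<phi> x) (\<phi> y) = dist x y)"

text \<open>For an isometry \<open>\<phi> x = R x + t\<close> the function \<open>f \<circ> \<phi>\<^sup>-\<^sup>1\<close> has gradient \<open>R a\<close>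
  and constant term \<open>c - \<langle>R a, t\<rangle>\<close>; note \<open>R a = \<phi> a - \<phi> 0\<close> and \<open>t = \<phi> 0\<close>.\<close>

definition push :: "(real^2 \<Rightarrow> real^2) \<Rightarrow> aff \<Rightarrow> aff" where
  "push \<phi> f = (let a' = \<phi> (fst f) - \<phi> 0 in (a', snd f - a' \<bullet> \<phi> 0))"

lemma eval_push:
  assumes "isometry \<phi>"
  shows "eval (push \<phi> f) (\<phi> x) = eval f x"
proof -
  define R where "R = (\<lambda>x. \<phi> x - \<phi> 0)"
  have "orthogonal_transformation R"
    using assms unfolding orthogonal_transformation_isometry isometry_def R_def
    by (simp add: dist_norm)
  then have "R (fst f) \<bullet> R x = fst f \<bullet> x"
    by (simp add: orthogonal_transformation_def)
  moreover have "\<phi> x = R x + \<phi> 0" "push \<phi> f = (R (fst f), snd f - R (fst f) \<bullet> \<phi> 0)"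
    by (simp_all add: R_def push_def Let_def)
  ultimately show ?thesis
    by (simp add: eval_def inner_add_right)
qed


section \<open>Exchange matrices, geometric realisations and seeds\<close>

text \<open>Indices range over the three-element type \<open>3\<close>, on which addition is modulo 3, so that
  \<open>i, i + 1, i + 2\<close> are always the three distinct indices (and \<open>(3::3) = 0\<close>).\<close>

definition exchange_matrix :: "real^3^3 \<Rightarrow> bool" where
  "exchange_matrix B \<longleftrightarrow> transpose B = - B"

definition acyclic_quiver :: "real^3^3 \<Rightarrow> bool" where
  "acyclic_quiver B \<longleftrightarrow> acyclic {(i, j). B $ i $ j > 0}"

definition is_basis :: "(3 \<Rightarrow> aff) \<Rightarrow> bool" where
  "is_basis v \<longleftrightarrow> inj v \<and> independent (range v) \<and> span (range v) = UNIV"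

definition geometric_realisation :: "(3 \<Rightarrow> aff) \<Rightarrow> real^3^3 \<Rightarrow> bool" where
  "geometric_realisation v B \<longleftrightarrow>
     exchange_matrix B \<and> is_basis v \<and> (\<forall>i. form (v i) (v i) = 2) \<and>
     (\<forall>i j. i \<noteq> j \<longrightarrow> \<bar>form (v i) (v j)\<bar> = \<bar>B $ i $ j\<bar>) \<and>
     ((\<forall>i j. form (v i) (v j) \<noteq> 0) \<longrightarrow>
       (even (card {(i, j). i < j \<and> form (v i) (v j) > 0}) \<longleftrightarrow> acyclic_quiver B))"

type_synonym labelled_seed = "(3 \<Rightarrow> aff) \<times> (real^3^3)"

text \<open>A seed is a pair \<open>(v, B)\<close> up to simultaneous permutation of indices, here the set of all
  its relabellings.\<close>

type_synonym seed = "labelled_seed set"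

definition seed_of :: "labelled_seed \<Rightarrow> seed" where
  "seed_of s = {(fst s \<circ> \<sigma>, \<chi> i j. snd s $ \<sigma> i $ \<sigma> j) | \<sigma>. bij \<sigma>}"

definition move :: "(real^2 \<Rightarrow> real^2) \<Rightarrow> seed \<Rightarrow> seed" where
  "move \<phi> S = (\<lambda>(v, B). (push \<phi> \<circ> v, B)) ` S"

abbreviation translate :: "real^2 \<Rightarrow> seed \<Rightarrow> seed" where
  "translate w \<equiv> move (\<lambda>x. x + w)"


section \<open>Domains\<close>

definition domain :: "(3 \<Rightarrow> aff) \<Rightarrow> (real^2) set" where
  "domain v = (\<Inter>i. halfplane (v i))"

definition side :: "(3 \<Rightarrow> aff) \<Rightarrow> 3 \<Rightarrow> (real^2) set" where
  "side v i = {x \<in> line (v i). \<forall>j. eval (v j) x \<le> 0}"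

text \<open>The gradients are the outward normals of the domain, so the interior angle between two of
  its sides is \<open>\<pi>\<close> minus the angle between the gradients. It is \<open>0\<close> for two parallel half-lines
  bounding the domain.\<close>

definition interior_angle :: "aff \<Rightarrow> aff \<Rightarrow> real" where
  "interior_angle f g = pi - arccos (form f g / (sqrt (form f f) * sqrt (form g g)))"

text \<open>The angle \<open>A\<^sub>i\<close> of the domain opposite to its \<open>i\<close>-th side.\<close>

definition ang :: "(3 \<Rightarrow> aff) \<Rightarrow> 3 \<Rightarrow> real" where
  "ang v i = interior_angle (v (i + 1)) (v (i + 2))"

definition acute_angled :: "(3 \<Rightarrow> aff) \<Rightarrow> bool" where
  "acute_angled v \<longleftrightarrow> (\<forall>i. ang v i < pi / 2)"

definition obtuse_angled :: "(3 \<Rightarrow> aff) \<Rightarrow> bool" where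
  "obtuse_angled v \<longleftrightarrow> (\<exists>i. ang v i > pi / 2)"

text \<open>The length of a bounded side is its diameter. In the unbounded case \<open>i\<close> is the finite side,
  whose two end angles are \<open>ang v (i + 1)\<close> and \<open>ang v (i + 2)\<close>.\<close>

definition T :: "(3 \<Rightarrow> aff) \<Rightarrow> real" where
  "T v = (if bounded (domain v)
          then diameter (side v 1) * sin (ang v 2) * sin (ang v 3)
          else let i = (THE i. bounded (side v i)) in diameter (side v i) * (sin (ang v (i + 1)))\<^sup>2)"

text \<open>Normalised triples whose domain is a triangle, or (if one of the angles is \<open>0\<close>) an infinite
  region bounded by two parallel half-lines and a segment. The angles do not force the domain to be
  non-empty: negating the constant terms of all three functions turns a triangle into the empty set.\<close>

definition region_with_angles :: "(3 \<Rightarrow> aff) \<Rightarrow> real \<Rightarrow> real \<Rightarrow> real \<Rightarrow> bool" where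
  "region_with_angles v \<alpha>1 \<alpha>2 \<alpha>3 \<longleftrightarrow>
     is_basis v \<and> (\<forall>i. form (v i) (v i) = 2) \<and> domain v \<noteq> {} \<and>
     ang v 1 = \<alpha>1 \<and> ang v 2 = \<alpha>2 \<and> ang v 3 = \<alpha>3"

text \<open>Quivers whose vertices are the sides of the domain: the weight is twice the cosine of the
  (non-obtuse) angle between the lines, hence the absolute value.\<close>

definition corresponding_quiver :: "(3 \<Rightarrow> aff) \<Rightarrow> real^3^3 \<Rightarrow> bool" where
  "corresponding_quiver v Q \<longleftrightarrow>
     exchange_matrix Q \<and>
     (\<forall>i j. i \<noteq> j \<longrightarrow> \<bar>Q $ i $ j\<bar> = 2 * \<bar>cos (interior_angle (v i) (v j))\<bar>) \<and>
     (acute_angled v \<longrightarrow> acyclic_quiver Q) \<and>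
     (obtuse_angled v \<longrightarrow> \<not> acyclic_quiver Q)"

definition congruent_sets :: "(real^2) set \<Rightarrow> (real^2) set \<Rightarrow> bool" where
  "congruent_sets D D' \<longleftrightarrow> (\<exists>\<phi>. isometry \<phi> \<and> \<phi> ` D = D')"

definition has_domain_congruent_to :: "seed \<Rightarrow> (3 \<Rightarrow> aff) \<Rightarrow> bool" where
  "has_domain_congruent_to S v \<longleftrightarrow> (\<exists>s\<in>S. congruent_sets (domain v) (domain (fst s)))"

text \<open>Seeds being considered up to relabelling, their quivers are quivers up to isomorphism. For a
  seed whose domain is a triangle congruent to \<open>domain v\<close> and \<open>corresponding_quiver v Q\<close>, an
  isomorphism from \<open>Q\<close> to the quiver of the seed is always induced by a congruence, since the
  weights \<open>2 \<bar>cos A\<bar>\<close> determine the angles \<open>A\<close> of a triangle. Infinite regions have equal weights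
  for their angles \<open>\<beta>\<close> and \<open>\<pi> - \<beta>\<close>, and there the isomorphism may exchange the parallel sides.\<close>

definition has_quiver :: "seed \<Rightarrow> real^3^3 \<Rightarrow> bool" where
  "has_quiver S Q \<longleftrightarrow> (\<exists>s\<in>S. snd s = Q)"


section \<open>Mutation and exchange graphs\<close>

definition mutate_matrix :: "3 \<Rightarrow> real^3^3 \<Rightarrow> real^3^3" where
  "mutate_matrix k B = (\<chi> i j. if k = i \<or> k = j then - B $ i $ j
     else B $ i $ j + (B $ i $ k * \<bar>B $ k $ j\<bar> + \<bar>B $ i $ k\<bar> * B $ k $ j) / 2)"

definition mutate_vectors :: "(aff \<Rightarrow> bool) \<Rightarrow> 3 \<Rightarrow> labelled_seed \<Rightarrow> 3 \<Rightarrow> aff" where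
  "mutate_vectors pos k = (\<lambda>(v, B) i.
     if i = k then - v k
     else if (if pos (v k) then B $ i $ k < 0 else B $ i $ k > 0)
       then v i - form (v i) (v k) *\<^sub>R v k
     else v i)"

definition mutate :: "(aff \<Rightarrow> bool) \<Rightarrow> 3 \<Rightarrow> labelled_seed \<Rightarrow> labelled_seed" where
  "mutate pos k s = (mutate_vectors pos k s, mutate_matrix k (snd s))"

definition mutation_equivalent :: "(aff \<Rightarrow> bool) \<Rightarrow> labelled_seed \<Rightarrow> labelled_seed \<Rightarrow> bool" where
  "mutation_equivalent pos = (\<lambda>s t. \<exists>k. t = mutate pos k s)\<^sup>*\<^sup>*"

text \<open>Undirected graphs are pairs of a vertex set and a set of edges \<open>{x, y}\<close>.\<close>

type_synonym 'a ugraph = "'a set \<times> 'a set set"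

definition exchange_graph :: "(aff \<Rightarrow> bool) \<Rightarrow> labelled_seed \<Rightarrow> seed ugraph" where
  "exchange_graph pos s0 =
     ({seed_of s | s. mutation_equivalent pos s0 s},
      {{seed_of s, seed_of (mutate pos k s)} | s k. mutation_equivalent pos s0 s})"

definition full_subgraph :: "'a ugraph \<Rightarrow> 'a ugraph \<Rightarrow> bool" where
  "full_subgraph H G \<longleftrightarrow> fst H \<subseteq> fst G \<and> snd H = {e \<in> snd G. e \<subseteq> fst H}"

definition path_graph :: "(int \<Rightarrow> 'a) \<Rightarrow> 'a ugraph" where
  "path_graph p = (range p, {{p m, p (m + 1)} | m. True})"

definition is_source :: "real^3^3 \<Rightarrow> 3 \<Rightarrow> bool" where
  "is_source B k \<longleftrightarrow> (\<forall>i. B $ i $ k \<le> 0)"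

definition acyclic_belt :: "(aff \<Rightarrow> bool) \<Rightarrow> labelled_seed \<Rightarrow> (int \<Rightarrow> seed) \<Rightarrow> bool" where
  "acyclic_belt pos s0 I \<longleftrightarrow>
     I 0 = seed_of s0 \<and>
     (\<forall>m. \<exists>v B k. geometric_realisation v B \<and> is_source B k \<and>
            I m = seed_of (v, B) \<and> I (m + 1) = seed_of (mutate pos k (v, B)))"


section \<open>The initial seed, the belt line and the reference point\<close>

definition angle_at :: "real^2 \<Rightarrow> real^2 \<Rightarrow> real^2 \<Rightarrow> real" where
  "angle_at P Q R = arccos (((P - Q) \<bullet> (R - Q)) / (norm (P - Q) * norm (R - Q)))"

definition isosceles :: "real^2 \<Rightarrow> real^2 \<Rightarrow> real^2 \<Rightarrow> real \<Rightarrow> real \<Rightarrow> bool" where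
  "isosceles X Y Z \<beta> \<gamma> \<longleftrightarrow>
     \<not> collinear {X, Y, Z} \<and>
     angle_at Y X Z = \<beta> \<and> angle_at X Y Z = \<beta> \<and> angle_at X Z Y = \<gamma>"

text \<open>The sides \<open>XY\<close>, \<open>XZ\<close>, \<open>YZ\<close> carry the indices 1, 2, 3.\<close>

definition initial_seed :: "real^2 \<Rightarrow> real^2 \<Rightarrow> real^2 \<Rightarrow> labelled_seed \<Rightarrow> bool" where
  "initial_seed X Y Z = (\<lambda>(v, B).
     geometric_realisation v B \<and>
     domain v = interior (convex hull {X, Y, Z}) \<and>
     {X, Y} \<subseteq> line (v 1) \<and> {X, Z} \<subseteq> line (v 2) \<and> {Y, Z} \<subseteq> line (v 3) \<and>
     B $ 1 $ 2 > 0 \<and> B $ 1 $ 3 > 0 \<and> B $ 2 $ 3 > 0)"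

definition altitude_foot :: "real^2 \<Rightarrow> real^2 \<Rightarrow> real^2 \<Rightarrow> real^2" where
  "altitude_foot P Q R = closest_point (affine hull {Q, R}) P"

definition belt_line :: "real^2 \<Rightarrow> real^2 \<Rightarrow> real^2 \<Rightarrow> (real^2) set" where
  "belt_line X Y Z = affine hull {altitude_foot Z X Y, altitude_foot X Y Z}"

definition belt_direction :: "real^2 \<Rightarrow> real^2 \<Rightarrow> real^2 \<Rightarrow> real^2" where
  "belt_direction X Y Z = sgn (altitude_foot X Y Z - altitude_foot Z X Y)"

definition is_positive :: "real^2 \<Rightarrow> real^2 \<Rightarrow> real^2 \<Rightarrow> aff \<Rightarrow> bool" where
  "is_positive X Y Z v \<longleftrightarrow>
     (\<forall>\<^sub>F t in at_top. altitude_foot Z X Y + t *\<^sub>R belt_direction X Y Z \<in> halfplane v)"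

definition reflect_across :: "(real^2) set \<Rightarrow> real^2 \<Rightarrow> real^2" where
  "reflect_across l x = 2 *\<^sub>R closest_point l x - x"


section \<open>The translation lattice\<close>

definition translation_lengths :: "seed ugraph \<Rightarrow> real set" where
  "translation_lengths \<Gamma> =
     module.span (\<lambda>k :: int. (*) (of_int k))
       (norm ` {w. \<exists>S\<in>fst \<Gamma>. \<exists>S'\<in>fst \<Gamma>. S' = translate w S})"

text \<open>The same module, with a number \<open>l\<close> regarded as the multiple \<open>l e\<close> of the unit vector \<open>e\<close>.\<close>

definition translation_lattice :: "real^2 \<Rightarrow> seed ugraph \<Rightarrow> (real^2) set" where
  "translation_lattice e \<Gamma> = (\<lambda>l. l *\<^sub>R e) ` translation_lengths \<Gamma>"

text \<open>As the graph is invariant under an infinite group of translations, seeds are counted modulo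
  translations by elements of \<open>L\<close>.\<close>

definition translation_rel :: "(real^2) set \<Rightarrow> (seed \<times> seed) set" where
  "translation_rel L = {(S, S'). \<exists>w\<in>L. S' = translate w S}"

end

theory Submission
  imports Defs
begin

text \<open>
  The proof determines all seeds of the exchange graph explicitly. The normals of all sides that occur
  make angles with the belt line that are multiples of \<open>\<alpha>\<close>, and two linear combinations of the
  three vectors of a seed survive mutation: the constant function \<open>\<Sum>i. sin A\<^sub>i * v\<^sub>i\<close>, which is the
  invariant \<open>T\<close> up to a factor, and the combination with coefficients in the kernel of the exchange
  matrix, which vanishes exactly on the belt line. Together they leave only translations along
  the belt line undetermined. This leads to a normal form (\<open>state\<close>): up to such a translation, a seed is
  given by a pair \<open>(p, q)\<close> of multiples of \<open>\<alpha>\<close> and a sign \<open>\<eta>\<close> that is changed by the reflection across the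
  belt line (\<open>state_glide\<close>). Its quiver contains a path \<open>i \<rightarrow> m \<rightarrow> j\<close>; the sides \<open>i\<close> and \<open>j\<close> are opposite to
  the angles \<open>p \<alpha>\<close> and \<open>q \<alpha>\<close>.

  In these terms, mutation at the middle vertex \<open>m\<close> is a step of the subtractive Euclidean algorithm on
  \<open>(p, q)\<close>. Mutation at \<open>i\<close> or \<open>j\<close> is the inverse of such a step as long as the seed is cyclic, that is
  \<open>p + q \<le> n\<close>. For an acyclic seed it reflects the whole triangle and permutes the angles
  cyclically. Hence all pairs for which the three angles have no common factor are connected with each
  other (\<open>state_connected\<close>): one run of the Euclidean algorithm reaches \<open>(g, 0)\<close> with
  \<open>g = gcd p q\<close>, and if \<open>g > 1\<close>, a detour over an acyclic seed brings in the third angle and a second run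
  reaches \<open>(1, 0)\<close>. From there the inverse steps lead to \<open>(1, n)\<close>, the initial seed.

  The mutation rule depends only on inner products and on the position relative to the point at infinity
  of the belt line, so it commutes with all glides along this line (\<open>act_mutate\<close>). Therefore a translation
  between two seeds of the graph is a symmetry of the whole graph; these translations form a group, which is
  the lattice \<open>L\<close> (\<open>translation_lengths_eq\<close>). Three source mutations give a glide reflection
  that is also a symmetry (\<open>state_reflected\<close>).

  The first claim follows because along a belt the source of each seed becomes the sink of the next, so
  that the seeds advance strictly along the belt line, and because the third neighbour of an acyclic seed is
  cyclic (\<open>source_path_inj\<close>, \<open>source_path_full\<close>). For the second claim, a region with the prescribed
  angles and value of \<open>T\<close> can be moved into normal form (\<open>place_region\<close>, \<open>realise_region\<close>) and then,
  by connectedness, along the belt line into the graph (\<open>state_glides_into_component\<close>). As the quiver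
  determines \<open>(p, q)\<close> (\<open>state_quiver_determines\<close>), all seeds with this quiver are glides of a single one,
  and the symmetries of the graph leave the two classes \<open>\<eta> = 1\<close> and \<open>\<eta> = -1\<close>
  (\<open>congruence_classes\<close>).
\<close>

section \<open>Labelled seeds up to relabelling\<close>

lemma eval_aff_diff: "eval (g - h) x = eval g x - eval h x"
  by (simp add: eval_def inner_diff_left)

lemma eval_aff_scaleR: "eval (r *\<^sub>R g) x = r * eval g x"
  by (simp add: eval_def algebra_simps)

lemma eval_aff_uminus: "eval (- g) x = - eval g x"
  by (simp add: eval_def)

lemma exchange_matrix_iff: "exchange_matrix B \<longleftrightarrow> (\<forall>x y. B $ y $ x = - B $ x $ y)"
  by (simp add: exchange_matrix_def vec_eq_iff transpose_def)

text \<open>Both terms added by a mutation are odd under exchanging the two indices, because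
  transposing a skew-symmetric matrix turns \<open>B $ y $ k * \<bar>B $ k $ x\<bar>\<close> into
  \<open>- \<bar>B $ x $ k\<bar> * B $ k $ y\<close>.\<close>

lemma exchange_matrix_mutate:
  assumes "exchange_matrix B"
  shows "exchange_matrix (mutate_matrix k B)"
proof -
  have skew: "B $ y $ x = - B $ x $ y" for x y
    by (rule assms[unfolded exchange_matrix_iff, rule_format])
  have entry: "b' + (c' * \<bar>d'\<bar> + \<bar>c'\<bar> * d') / 2 = - (b + (d * \<bar>c\<bar> + \<bar>d\<bar> * c) / 2)"
    if "b' = - b" "c' = - c" "d' = - d" for b b' c c' d d' :: real
    by (simp add: that field_simps)
  have "mutate_matrix k B $ y $ x = - mutate_matrix k B $ x $ y" for x y
  proof (cases "k = y \<or> k = x")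
    case True
    then have e: "mutate_matrix k B $ y $ x = - B $ y $ x" "mutate_matrix k B $ x $ y = - B $ x $ y"
      by (auto simp: mutate_matrix_def)
    show ?thesis
      unfolding e by (rule arg_cong[OF skew])
  next
    case False
    then have e1: "mutate_matrix k B $ y $ x
        = B $ y $ x + (B $ y $ k * \<bar>B $ k $ x\<bar> + \<bar>B $ y $ k\<bar> * B $ k $ x) / 2"
     and e2: "mutate_matrix k B $ x $ y
        = B $ x $ y + (B $ x $ k * \<bar>B $ k $ y\<bar> + \<bar>B $ x $ k\<bar> * B $ k $ y) / 2"
      by (simp_all add: mutate_matrix_def)
    show ?thesis
      unfolding e1 e2 by (rule entry) (rule skew)+
  qed
  then show ?thesis
    unfolding exchange_matrix_iff by (intro allI)
qed

lemma mutate_fst: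
  "fst (mutate pos k s) x =
    (if x = k then - fst s k
     else if (if pos (fst s k) then snd s $ x $ k < 0 else snd s $ x $ k > 0)
       then fst s x - form (fst s x) (fst s k) *\<^sub>R fst s k
     else fst s x)"
  by (cases s) (simp add: mutate_def mutate_vectors_def)

lemma mutate_snd: "snd (mutate pos k s) = mutate_matrix k (snd s)"
  by (simp add: mutate_def)

text \<open>For bijections these are the relabellings that a seed identifies; keeping the labels explicit
  makes it possible to compute with labelled seeds.\<close>

definition relabel :: "(3 \<Rightarrow> 3) \<Rightarrow> labelled_seed \<Rightarrow> labelled_seed" where
  "relabel \<sigma> s = (fst s \<circ> \<sigma>, \<chi> x y. snd s $ \<sigma> x $ \<sigma> y)"

lemma relabel_fst: "fst (relabel \<sigma> s) x = fst s (\<sigma> x)"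
  and relabel_snd: "snd (relabel \<sigma> s) $ x $ y = snd s $ \<sigma> x $ \<sigma> y"
  by (simp_all add: relabel_def)

lemma relabel_relabel: "relabel \<sigma> (relabel \<tau> s) = relabel (\<tau> \<circ> \<sigma>) s"
  by (simp add: relabel_def o_assoc)

lemma relabel_id: "relabel id s = s"
  by (simp add: relabel_def)

lemma seed_of_relabel_eq: "seed_of s = {relabel \<sigma> s | \<sigma>. bij \<sigma>}"
  by (simp add: seed_of_def relabel_def)

lemma self_in_seed_of: "s \<in> seed_of s"
  unfolding seed_of_relabel_eq using relabel_id[of s] bij_id by (metis (mono_tags, lifting) mem_Collect_eq)

lemma relabel_bij_inverse:
  assumes "bij \<sigma>"
  shows "relabel (inv \<sigma>) (relabel \<sigma> s) = s" "relabel \<sigma> (relabel (inv \<sigma>) s) = s"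
proof -
  have "\<sigma> \<circ> inv \<sigma> = id" "inv \<sigma> \<circ> \<sigma> = id"
    using assms by (simp_all add: bij_is_surj bij_is_inj surj_iff[symmetric])
  then show "relabel (inv \<sigma>) (relabel \<sigma> s) = s" "relabel \<sigma> (relabel (inv \<sigma>) s) = s"
    by (simp_all only: relabel_relabel relabel_id)
qed

lemma seed_of_relabel:
  assumes "bij \<sigma>"
  shows "seed_of (relabel \<sigma> s) = seed_of s"
proof -
  have "relabel \<tau> (relabel \<sigma> s) \<in> seed_of s" if "bij \<tau>" for \<tau>
    unfolding seed_of_relabel_eq relabel_relabel using that assms bij_comp by blast
  moreover have "relabel \<tau> s \<in> seed_of (relabel \<sigma> s)" if "bij \<tau>" for \<tau>
  proof -
    have "relabel \<tau> s = relabel (inv \<sigma> \<circ> \<tau>) (relabel \<sigma> s)"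
      using relabel_bij_inverse(1)[OF assms, of s] relabel_relabel by metis
    then show ?thesis
      unfolding seed_of_relabel_eq using that assms bij_comp bij_imp_bij_inv by blast
  qed
  ultimately show ?thesis
    by (auto simp: seed_of_relabel_eq)
qed

lemma seed_of_eqD:
  assumes "seed_of s = seed_of t"
  obtains \<sigma> where "bij \<sigma>" "t = relabel \<sigma> s"
  using assms self_in_seed_of[of t] unfolding seed_of_relabel_eq by blast

lemma mutate_relabel:
  assumes "bij \<sigma>"
  shows "mutate pos k (relabel \<sigma> s) = relabel \<sigma> (mutate pos (\<sigma> k) s)"
proof -
  have inj: "\<sigma> x = \<sigma> y \<longleftrightarrow> x = y" for x y
    using assms by (meson bij_is_inj injD)
  show ?thesis
    by (auto intro!: prod_eqI ext simp: vec_eq_iff mutate_fst mutate_snd mutate_matrix_def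
        relabel_fst relabel_snd inj)
qed

text \<open>A mutation is undone by the mutation at the same index: the column \<open>k\<close> of the matrix and the
  vector \<open>v k\<close> change sign together, so the same vectors are reflected again. This needs that
  exactly one of \<open>v k\<close> and \<open>- v k\<close> is positive.\<close>

lemma mutate_mutate:
  assumes "form (fst s k) (fst s k) = 2" and "pos (- fst s k) \<longleftrightarrow> \<not> pos (fst s k)"
  shows "mutate pos k (mutate pos k s) = s"
proof -
  have "form (x - form x z *\<^sub>R z) (- z) = form x z" if "form z z = 2" for x z
    using that by (simp add: form_def inner_diff_left)
  moreover have "fst (mutate pos k (mutate pos k s)) x = fst s x" for x
    using assms calculation
    by (auto simp: mutate_fst mutate_snd mutate_matrix_def form_def inner_diff_left)
  moreover have "mutate_matrix k (mutate_matrix k (snd s)) = snd s"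
    by (simp add: mutate_matrix_def vec_eq_iff flip: add_divide_distrib)
  ultimately show ?thesis
    by (intro prod_eqI ext) (simp_all add: mutate_snd)
qed

section \<open>Preliminaries on the plane and on trigonometric products\<close>

lemma index_cases:
  assumes "i \<noteq> j" "i \<noteq> m" "j \<noteq> (m::3)"
  shows "x = i \<or> x = j \<or> x = m"
  using assms exhaust_3[of i] exhaust_3[of j] exhaust_3[of m] exhaust_3[of x] by (elim disjE) simp_all

text \<open>Two orthonormal vectors span the plane: a vector orthogonal to both is annihilated by their
  determinant, which squares to \<open>1\<close> by Lagrange's identity.\<close>

lemma orthonormal_expand:
  fixes e f x :: "real^2"
  assumes "e \<bullet> e = 1" "f \<bullet> f = 1" "e \<bullet> f = 0"
  shows "x = (x \<bullet> e) *\<^sub>R e + (x \<bullet> f) *\<^sub>R f"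
proof -
  define y where "y = x - ((x \<bullet> e) *\<^sub>R e + (x \<bullet> f) *\<^sub>R f)"
  define D where "D = e$1 * f$2 - e$2 * f$1"
  have "y \<bullet> e = 0" "y \<bullet> f = 0"
    by (simp_all add: y_def inner_diff_left inner_add_left assms inner_commute[of f e])
  then have y: "y$1 * e$1 + y$2 * e$2 = 0" "y$1 * f$1 + y$2 * f$2 = 0"
    by (simp_all add: inner_vec_def sum_2)
  have s: "e$1 * e$1 + e$2 * e$2 = 1" "f$1 * f$1 + f$2 * f$2 = 1" "e$1 * f$1 + e$2 * f$2 = 0"
    using assms by (simp_all add: inner_vec_def sum_2)
  have "D * D = (e$1 * e$1 + e$2 * e$2) * (f$1 * f$1 + f$2 * f$2)
      - (e$1 * f$1 + e$2 * f$2) * (e$1 * f$1 + e$2 * f$2)"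
    by (simp add: D_def algebra_simps)
  then have "D * D = 1"
    by (simp add: s)
  moreover have "y$1 * D = f$2 * (y$1 * e$1 + y$2 * e$2) - e$2 * (y$1 * f$1 + y$2 * f$2)"
    "y$2 * D = e$1 * (y$1 * f$1 + y$2 * f$2) - f$1 * (y$1 * e$1 + y$2 * e$2)"
    by (simp_all add: D_def algebra_simps)
  then have "y$1 * D = 0" "y$2 * D = 0"
    by (simp_all add: y)
  ultimately have "y$1 = 0" "y$2 = 0" by auto
  then have "y = 0" by (simp add: vec_eq_iff forall_2)
  then show ?thesis by (simp add: y_def)
qed

lemma sin_add_eq: "sin (x + y) = sin (x - y) + 2 * cos x * sin (y::real)"
  by (simp add: sin_add sin_diff)

lemma cos_add_eq: "cos (x + y) = 2 * cos x * cos y - cos (x - (y::real))"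
  by (simp add: cos_add cos_diff)

text \<open>These identities make the two linear equations on the constant terms of a seed compatible with
  translations along the belt line.\<close>

lemma sum_difference_products:
  fixes a b :: real
  shows "sin (a + b) * sin (a - b) = sin a * sin a - sin b * sin b"
    and "cos (a + b) * sin (a - b) = cos a * sin a - cos b * sin b"
    and "sin (a + b) * cos (a - b) = sin a * cos a + sin b * cos b"
    and "cos (a + b) * cos (a - b) = cos a * cos a - sin b * sin b"
proof -
  have expand:
    "(sa * cb + ca * sb) * (sa * cb - ca * sb) = sa * sa * (cb * cb + sb * sb) - sb * sb * (ca * ca + sa * sa)"
    "(ca * cb - sa * sb) * (sa * cb - ca * sb) = ca * sa * (cb * cb + sb * sb) - cb * sb * (ca * ca + sa * sa)"
    "(sa * cb + ca * sb) * (ca * cb + sa * sb) = sa * ca * (cb * cb + sb * sb) + sb * cb * (ca * ca + sa * sa)"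
    "(ca * cb - sa * sb) * (ca * cb + sa * sb) = ca * ca * (cb * cb + sb * sb) - sb * sb * (ca * ca + sa * sa)"
    for ca cb sa sb :: real
    by (simp_all add: algebra_simps)
  show "sin (a + b) * sin (a - b) = sin a * sin a - sin b * sin b"
    "cos (a + b) * sin (a - b) = cos a * sin a - cos b * sin b"
    "sin (a + b) * cos (a - b) = sin a * cos a + sin b * cos b"
    "cos (a + b) * cos (a - b) = cos a * cos a - sin b * sin b"
    unfolding sin_add cos_add sin_diff cos_diff expand
    by (simp_all only: sin_cos_squared_add3 mult_1_right)
qed

section \<open>Seeds in normal form\<close>

text \<open>Coordinates adapted to the belt line, which passes through \<open>ori\<close> in the unit direction \<open>e\<close>
  and has unit normal \<open>f\<close>. The condition \<open>pos\<close> is positivity with respect to the point at infinity in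
  direction \<open>e\<close>. The constant \<open>K\<close> is the value of the invariant \<open>T\<close>.\<close>

locale belt_frame =
  fixes n :: nat and \<alpha> K :: real and ori e f :: "real^2" and pos :: "aff \<Rightarrow> bool"
  assumes ee: "e \<bullet> e = 1" and ff: "f \<bullet> f = 1" and ef: "e \<bullet> f = 0"
    and n1: "1 \<le> n" and \<alpha>: "\<alpha> = pi / (2 * real n + 1)" and K: "0 < K"
    and pos: "pos g \<longleftrightarrow> fst g \<bullet> e < 0 \<or> fst g \<bullet> e = 0 \<and> eval g ori < 0"
begin

lemma expand: "x = (x \<bullet> e) *\<^sub>R e + (x \<bullet> f) *\<^sub>R f"
  by (rule orthonormal_expand[OF ee ff ef])

text \<open>The vectors of a seed have norm \<open>sqrt 2\<close>; dividing by it turns their gradients into unit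
  vectors, with sines and cosines as coordinates.\<close>

definition cx :: "aff \<Rightarrow> real" where "cx g = (fst g \<bullet> e) / sqrt 2"
definition cy :: "aff \<Rightarrow> real" where "cy g = (fst g \<bullet> f) / sqrt 2"
definition cd :: "aff \<Rightarrow> real" where "cd g = eval g ori / sqrt 2"

lemma coords_linear [simp]:
  "cx (g - r *\<^sub>R h) = cx g - r * cx h" "cx (- g) = - cx g"
  "cy (g - r *\<^sub>R h) = cy g - r * cy h" "cy (- g) = - cy g"
  "cd (g - r *\<^sub>R h) = cd g - r * cd h" "cd (- g) = - cd g"
  by (simp_all add: cx_def cy_def cd_def eval_aff_diff eval_aff_scaleR eval_aff_uminus inner_diff_left diff_divide_distrib)

lemma aff_eqI:
  assumes "cx g = cx h" "cy g = cy h" "cd g = cd h"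
  shows "g = h"
proof -
  have "fst g = fst h"
    using assms(1,2) by (subst expand, subst (3) expand) (simp add: cx_def cy_def)
  then show ?thesis
    using assms(3) by (intro prod_eqI) (simp_all add: cd_def eval_def)
qed

lemma form_coords: "form g h = 2 * (cx g * cx h + cy g * cy h)"
proof -
  have "fst g \<bullet> fst h = (fst g \<bullet> e) * (e \<bullet> fst h) + (fst g \<bullet> f) * (f \<bullet> fst h)"
    by (metis expand inner_add_left inner_scaleR_left)
  then show ?thesis
    by (simp add: form_def cx_def cy_def inner_commute)
qed

lemma pos_coords: "pos g \<longleftrightarrow> cx g < 0 \<or> cx g = 0 \<and> cd g < 0"
  by (simp add: pos cx_def cd_def divide_less_0_iff)

lemma \<alpha>_pos: "0 < \<alpha>" by (simp add: \<alpha>)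

lemma angle_less_half_pi: "p \<le> n \<Longrightarrow> real p * \<alpha> < pi / 2"
proof -
  assume "p \<le> n"
  then have "2 * real p < 2 * real n + 1" by linarith
  then have "pi * (2 * real p) < pi * (2 * real n + 1)" by simp
  then show ?thesis by (simp add: \<alpha> field_simps)
qed

lemma angle_greater_half_pi: "n < p \<Longrightarrow> pi / 2 < real p * \<alpha>"
proof -
  assume "n < p"
  then have "2 * real n + 1 < 2 * real p" by linarith
  then have "pi * (2 * real n + 1) < pi * (2 * real p)" by simp
  then show ?thesis by (simp add: \<alpha> field_simps)
qed

lemma angle_less_pi: "p \<le> 2 * n \<Longrightarrow> real p * \<alpha> < pi"
proof -
  assume "p \<le> 2 * n"
  then have "real p < 2 * real n + 1" by linarith
  then have "pi * real p < pi * (2 * real n + 1)" by simp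
  then show ?thesis by (simp add: \<alpha> field_simps)
qed

lemma full_angle: "(2 * real n + 1) * \<alpha> = pi"
  by (simp add: \<alpha>)

lemma cos_pos: "p \<le> n \<Longrightarrow> 0 < cos (real p * \<alpha>)"
  using angle_less_half_pi[of p] \<alpha>_pos by (intro cos_gt_zero_pi) (auto intro: less_le_trans[of _ 0])

lemma sin_pos: "1 \<le> p \<Longrightarrow> p \<le> 2 * n \<Longrightarrow> 0 < sin (real p * \<alpha>)"
  using angle_less_pi[of p] \<alpha>_pos by (intro sin_gt_zero) auto

lemma cos_neg: "n < p \<Longrightarrow> p \<le> 2 * n \<Longrightarrow> cos (real p * \<alpha>) < 0"
  using angle_less_pi[of p] angle_greater_half_pi[of p] cos_gt_zero_pi[of "pi - real p * \<alpha>"] by simp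

text \<open>The normal form of the seeds in the exchange graph. The sides \<open>i\<close>, \<open>j\<close>, \<open>m\<close> are opposite to the
  angles \<open>p \<alpha>\<close>, \<open>q \<alpha>\<close> and \<open>\<pi> - (p + q) \<alpha>\<close>, of which only the last one can be obtuse, and
  the quiver contains the path \<open>i \<rightarrow> m \<rightarrow> j\<close>. The sign of \<open>- cos ((p + q) \<alpha>)\<close> decides about the third
  arrow: the quiver is acyclic with source \<open>i\<close> and sink \<open>j\<close> if \<open>n < p + q\<close>, and cyclic otherwise. The
  sign \<open>\<eta>\<close> distinguishes a triangle from its reflection across the belt line.

  The gradients are determined by \<open>p\<close>, \<open>q\<close>, \<open>\<eta>\<close>; two equations restrict the constant terms. The
  combination of the vectors with coefficients the sines of the opposite angles is a constant function,
  and its value \<open>- K\<close> fixes the size of the triangle. The combination of the vectors of \<open>i\<close>,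
  \<open>m\<close>, \<open>j\<close> with coefficients \<open>B $ m $ j\<close>, \<open>B $ j $ i\<close>, \<open>B $ i $ m\<close>, which form a vector spanning the
  kernel of \<open>B\<close>, is a multiple of the coordinate along \<open>f\<close>, which places the triangle relative to the belt line.

  The asymmetry between \<open>p \<ge> 1\<close> and \<open>q \<ge> 0\<close> is forced: if the domain is an infinite region, its
  finite side is parallel to the belt line, and the vector of this side is negative.\<close>

definition state :: "3 \<Rightarrow> 3 \<Rightarrow> 3 \<Rightarrow> real \<Rightarrow> nat \<Rightarrow> nat \<Rightarrow> labelled_seed \<Rightarrow> bool" where
  "state i j m \<eta> p q s \<longleftrightarrow>
     i \<noteq> j \<and> i \<noteq> m \<and> j \<noteq> m \<and> (\<eta> = 1 \<or> \<eta> = -1) \<and> 1 \<le> p \<and> p \<le> n \<and> q \<le> n \<and>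
     exchange_matrix (snd s) \<and>
     (let a = real p * \<alpha>; b = real q * \<alpha>; v = fst s; B = snd s in
      cx (v i) = - sin a \<and> cy (v i) = \<eta> * cos a \<and>
      cx (v j) = sin b \<and> cy (v j) = \<eta> * cos b \<and>
      cx (v m) = sin (a - b) \<and> cy (v m) = - \<eta> * cos (a - b) \<and>
      sin a * cd (v i) + sin b * cd (v j) + sin (a + b) * cd (v m) = - K \<and>
      cos a * cd (v i) + cos b * cd (v j) + cos (a + b) * cd (v m) = 0 \<and>
      B $ i $ m = 2 * cos b \<and> B $ m $ j = 2 * cos a \<and> B $ i $ j = - 2 * cos (a + b))"

lemma stateD:
  assumes "state i j m \<eta> p q s"
  defines "a \<equiv> real p * \<alpha>" and "b \<equiv> real q * \<alpha>"
  shows "i \<noteq> j" "i \<noteq> m" "j \<noteq> m" "\<eta> = 1 \<or> \<eta> = -1" "1 \<le> p" "p \<le> n" "q \<le> n"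
    "exchange_matrix (snd s)"
    "cx (fst s i) = - sin a" "cy (fst s i) = \<eta> * cos a"
    "cx (fst s j) = sin b" "cy (fst s j) = \<eta> * cos b"
    "cx (fst s m) = sin (a - b)" "cy (fst s m) = - \<eta> * cos (a - b)"
    "sin a * cd (fst s i) + sin b * cd (fst s j) + sin (a + b) * cd (fst s m) = - K"
    "cos a * cd (fst s i) + cos b * cd (fst s j) + cos (a + b) * cd (fst s m) = 0"
    "snd s $ i $ m = 2 * cos b" "snd s $ m $ j = 2 * cos a" "snd s $ i $ j = - 2 * cos (a + b)"
  using assms unfolding state_def Let_def by auto

lemma state_forms:
  assumes "state i j m \<eta> p q s"
  shows "form (fst s i) (fst s j) = 2 * cos (real p * \<alpha> + real q * \<alpha>)"
    "form (fst s i) (fst s m) = - 2 * cos (real q * \<alpha>)"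
    "form (fst s j) (fst s m) = - 2 * cos (real p * \<alpha>)"
    "form (fst s x) (fst s x) = 2"
    "form (fst s x) (fst s y) = form (fst s y) (fst s x)"
proof -
  note d = stateD[OF assms]
  have eta: "\<eta> * x * (\<eta> * y) = x * y" "\<eta> * x * (- \<eta> * y) = - (x * y)"
    "- \<eta> * x * (- \<eta> * y) = x * y" for x y
    using d(4) by (elim disjE; simp)+
  have unit: "2 * (sin t * sin t + cos t * cos t) = (2::real)" for t
    using sin_cos_squared_add[of t] by (simp add: power2_eq_square)
  show "form (fst s i) (fst s j) = 2 * cos (real p * \<alpha> + real q * \<alpha>)"
    unfolding form_coords d eta by (simp add: cos_add)
  show "form (fst s i) (fst s m) = - 2 * cos (real q * \<alpha>)"
    unfolding form_coords d eta using cos_diff[of "real p * \<alpha>" "real p * \<alpha> - real q * \<alpha>"] by simp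
  show "form (fst s j) (fst s m) = - 2 * cos (real p * \<alpha>)"
    unfolding form_coords d eta using cos_add[of "real q * \<alpha>" "real p * \<alpha> - real q * \<alpha>"] by simp
  have "form (fst s i) (fst s i) = 2"
    unfolding form_coords d eta using unit by simp
  moreover have "form (fst s j) (fst s j) = 2"
    unfolding form_coords d eta using unit by simp
  moreover have "form (fst s m) (fst s m) = 2"
    unfolding form_coords d eta using unit by simp
  ultimately show "form (fst s x) (fst s x) = 2"
    using index_cases[OF d(1-3), of x] by (elim disjE) simp_all
  show "form (fst s x) (fst s y) = form (fst s y) (fst s x)"
    by (simp add: form_def inner_commute)
qed

lemma angle_diff_nonzero:
  assumes "p \<le> n" "q \<le> n"
  shows "sin (real p * \<alpha> - real q * \<alpha>) > 0 \<longleftrightarrow> q < p" "sin (real p * \<alpha> - real q * \<alpha>) < 0 \<longleftrightarrow> p < q"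
proof -
  have A: "0 < sin (real p * \<alpha> - real q * \<alpha>)" if "q < p" "p \<le> n" for p q
  proof -
    have "real (p - q) * \<alpha> = real p * \<alpha> - real q * \<alpha>"
      using that by (simp add: of_nat_diff left_diff_distrib)
    moreover have "0 < sin (real (p - q) * \<alpha>)"
      using that by (intro sin_pos) auto
    ultimately show ?thesis
      by simp
  qed
  have B: "sin (real p * \<alpha> - real q * \<alpha>) = - sin (real q * \<alpha> - real p * \<alpha>)"
    by (simp add: sin_diff)
  show "sin (real p * \<alpha> - real q * \<alpha>) > 0 \<longleftrightarrow> q < p" "sin (real p * \<alpha> - real q * \<alpha>) < 0 \<longleftrightarrow> p < q"
    using A[of q p] A[of p q] B assms by (cases p q rule: linorder_cases; simp)+
qed

text \<open>The sign of a vector whose gradient is not orthogonal to \<open>e\<close> can be read off its first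
  coordinate. The sides parallel to the belt line are \<open>j\<close> if \<open>q = 0\<close> and \<open>m\<close> if \<open>p = q\<close>; then the two
  equations on the constant terms yield the constant term of this side, which is never \<open>0\<close>.\<close>

lemma state_pos:
  assumes "state i j m \<eta> p q s"
  shows "pos (fst s i)" "\<not> pos (- fst s i)" "\<not> pos (fst s j)" "pos (- fst s j)"
    "pos (fst s m) \<longleftrightarrow> p \<le> q" "pos (- fst s m) \<longleftrightarrow> q < p"
proof -
  note d = stateD[OF assms]
  show "pos (fst s i)" "\<not> pos (- fst s i)"
    using sin_pos[of p] d(5,6,9) by (simp_all add: pos_coords)
  have elim_j: "sin a * y = K * cos a"
    if "sin a * x + sin a * z = - K" "cos a * x + y + cos a * z = 0" for a x y z :: real
  proof -
    have "y = - (cos a * (x + z))"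
      using that(2) by (simp add: algebra_simps)
    then have "sin a * y = - cos a * (sin a * x + sin a * z)"
      by (simp only:) (simp add: algebra_simps)
    then show ?thesis
      using that(1) by simp
  qed
  have elim_m: "sin a * z = - (K * cos a)"
    if "sin a * x + sin a * y + sin (a + a) * z = - K" "cos a * x + cos a * y + cos (a + a) * z = 0" for a x y z :: real
  proof -
    have "sin a * z = (sin (a + a) * cos a - cos (a + a) * sin a) * z"
      using sin_diff[of "a + a" a] by simp
    also have "\<dots> = (sin a * x + sin a * y + sin (a + a) * z) * cos a
        - (cos a * x + cos a * y + cos (a + a) * z) * sin a"
      by (simp add: algebra_simps)
    finally show ?thesis
      using that by simp
  qed
  have "0 < cd (fst s j)" if "q = 0"
  proof -
    have "sin (real p * \<alpha>) * cd (fst s j) = K * cos (real p * \<alpha>)"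
      using d(15,16) by (intro elim_j) (simp_all add: that)
    moreover have "0 < K * cos (real p * \<alpha>)"
      using cos_pos[OF d(6)] K by simp
    ultimately have "0 < sin (real p * \<alpha>) * cd (fst s j)"
      by simp
    then show ?thesis
      by (rule zero_less_mult_pos) (use sin_pos[of p] d(5,6) in simp)
  qed
  moreover have "0 < sin (real q * \<alpha>)" if "q \<noteq> 0"
    using sin_pos[of q] d(7) that by simp
  ultimately show "\<not> pos (fst s j)" "pos (- fst s j)"
    using d(11) by (cases "q = 0"; simp add: pos_coords)+
  have "cd (fst s m) < 0" if "p = q"
  proof -
    have "sin (real p * \<alpha>) * cd (fst s m) = - (K * cos (real p * \<alpha>))"
      using d(15,16) by (intro elim_m) (simp_all flip: that add: distrib_right)
    moreover have "0 < K * cos (real p * \<alpha>)"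
      using cos_pos[OF d(6)] K by simp
    ultimately have "sin (real p * \<alpha>) * cd (fst s m) < 0"
      by linarith
    then show ?thesis
      using sin_pos[of p] d(5,6) by (simp add: mult_less_0_iff)
  qed
  then show "pos (fst s m) \<longleftrightarrow> p \<le> q" "pos (- fst s m) \<longleftrightarrow> q < p"
    using d(13) angle_diff_nonzero[OF d(6,7)] by (cases p q rule: linorder_cases; simp add: pos_coords)+
qed

text \<open>No side of a seed lies on the belt line, hence exactly one of two opposite vectors is
  positive, and mutations are invertible.\<close>

lemma pos_uminus_state:
  assumes "state i j m \<eta> p q s"
  shows "pos (- fst s x) \<longleftrightarrow> \<not> pos (fst s x)"
  using state_pos[OF assms] index_cases[OF stateD(1-3)[OF assms], of x] by auto

section \<open>Mutations of seeds in normal form\<close>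

lemma stateI:
  assumes "i \<noteq> j" "i \<noteq> m" "j \<noteq> m" "\<eta> = 1 \<or> \<eta> = -1" "1 \<le> p" "p \<le> n" "q \<le> n"
    "exchange_matrix (snd s)" "real p * \<alpha> = a" "real q * \<alpha> = b"
    "cx (fst s i) = - sin a" "cy (fst s i) = \<eta> * cos a"
    "cx (fst s j) = sin b" "cy (fst s j) = \<eta> * cos b"
    "cx (fst s m) = sin (a - b)" "cy (fst s m) = - \<eta> * cos (a - b)"
    "sin a * cd (fst s i) + sin b * cd (fst s j) + sin (a + b) * cd (fst s m) = - K"
    "cos a * cd (fst s i) + cos b * cd (fst s j) + cos (a + b) * cd (fst s m) = 0"
    "snd s $ i $ m = 2 * cos b" "snd s $ m $ j = 2 * cos a" "snd s $ i $ j = - 2 * cos (a + b)"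
  shows "state i j m \<eta> p q s"
  using assms(1-8) assms(11-) unfolding state_def Let_def assms(9,10) by blast

lemma skew:
  assumes "state i j m \<eta> p q s"
  shows "snd s $ m $ i = - snd s $ i $ m" "snd s $ j $ m = - snd s $ m $ j" "snd s $ j $ i = - snd s $ i $ j"
  by (rule stateD(8)[OF assms, unfolded exchange_matrix_iff, rule_format])+

lemma state_weights:
  assumes "state i j m \<eta> p q s"
  shows "0 < snd s $ i $ m" "0 < snd s $ m $ j"
    "p + q \<le> n \<Longrightarrow> snd s $ i $ j < 0" "n < p + q \<Longrightarrow> 0 < snd s $ i $ j"
proof -
  note d = stateD[OF assms]
  show "0 < snd s $ i $ m" "0 < snd s $ m $ j"
    using cos_pos d by simp_all
  show "snd s $ i $ j < 0" if "p + q \<le> n"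
    using cos_pos[OF that] d(19) by (simp add: distrib_right)
  show "0 < snd s $ i $ j" if "n < p + q"
    using cos_neg[OF that] d(6,7,19) by (simp add: distrib_right)
qed

text \<open>Since \<open>v m\<close> is positive, only \<open>j\<close> is reflected. The sides \<open>m\<close> and \<open>j\<close> exchange their roles and
  one step of the subtractive Euclidean algorithm is carried out on the pair of angles.\<close>

lemma mutate_middle_le:
  assumes "state i j m \<eta> p q s" and "p \<le> q"
  shows "state i m j \<eta> p (q - p) (mutate pos m s)"
proof -
  let ?t = "mutate pos m s"
  define a b where "a = real p * \<alpha>" and "b = real q * \<alpha>"
  note d = stateD[OF assms(1), folded a_def b_def] and f = state_forms[OF assms(1), folded a_def b_def]
    and k = skew[OF assms(1)] and w = state_weights[OF assms(1)]
  have P: "pos (fst s m)"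
    using state_pos(5)[OF assms(1)] assms(2) by simp
  have v: "fst ?t i = fst s i" "fst ?t m = - fst s m"
    "fst ?t j = fst s j - (- 2 * cos a) *\<^sub>R fst s m"
    using P d(1-3) k w f by (simp_all add: mutate_fst)
  have B: "snd ?t $ i $ j = snd s $ i $ j + snd s $ i $ m * snd s $ m $ j"
    "snd ?t $ j $ m = snd s $ m $ j" "snd ?t $ i $ m = - snd s $ i $ m"
    using d(1-3) k w by (simp_all add: mutate_snd mutate_matrix_def)
  have ang: "real (q - p) * \<alpha> = b - a"
    using assms(2) by (simp add: a_def b_def of_nat_diff left_diff_distrib)
  have arg: "a - (b - a) = a + (a - b)" "a + (b - a) = b"
    by simp_all
  have two: "sin (a + (a - b)) = sin b + 2 * cos a * sin (a - b)"
    "cos (a + (a - b)) = 2 * cos a * cos (a - b) - cos b"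
    using sin_add_eq[of a "a - b"] cos_add_eq[of a "a - b"] by simp_all
  have neg: "sin (b - a) = - sin (a - b)" "cos (b - a) = cos (a - b)"
    by (simp_all add: sin_diff cos_diff)
  have ex: "exchange_matrix (snd ?t)"
    using d(8) by (simp add: mutate_snd exchange_matrix_mutate)
  have bounds: "q - p \<le> n"
    using d(5-7) assms(2) by linarith+
  show ?thesis
  proof (rule stateI[where a = a and b = "b - a"])
    show "cx (fst ?t j) = sin (a - (b - a))"
      "cy (fst ?t j) = - \<eta> * cos (a - (b - a))"
      unfolding v coords_linear d arg two by (simp_all add: algebra_simps)
    show "sin a * cd (fst ?t i) + sin (b - a) * cd (fst ?t m)
        + sin (a + (b - a)) * cd (fst ?t j) = - K"
      "cos a * cd (fst ?t i) + cos (b - a) * cd (fst ?t m)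
        + cos (a + (b - a)) * cd (fst ?t j) = 0"
      unfolding v coords_linear arg using d(15,16)
      by (simp_all add: sin_add cos_add sin_diff cos_diff algebra_simps)
    show "snd ?t $ i $ j = 2 * cos (b - a)"
      unfolding B d neg by (simp add: cos_add cos_diff)
  qed (simp_all only: v B coords_linear d(1-3)[symmetric] d not_False_eq_True ang arg neg bounds ex a_def[symmetric] b_def[symmetric])
qed

text \<open>The Euclidean step in the other case, where \<open>v m\<close> is negative and \<open>i\<close> is reflected.\<close>

lemma mutate_middle_gt:
  assumes "state i j m \<eta> p q s" and "q < p"
  shows "state m j i \<eta> (p - q) q (mutate pos m s)"
proof -
  let ?t = "mutate pos m s"
  define a b where "a = real p * \<alpha>" and "b = real q * \<alpha>"
  note d = stateD[OF assms(1), folded a_def b_def] and f = state_forms[OF assms(1), folded a_def b_def]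
    and k = skew[OF assms(1)] and w = state_weights[OF assms(1)]
  have P: "\<not> pos (fst s m)"
    using state_pos(5)[OF assms(1)] assms(2) by simp
  have v: "fst ?t j = fst s j" "fst ?t m = - fst s m"
    "fst ?t i = fst s i - (- 2 * cos b) *\<^sub>R fst s m"
    using P d(1-3) k w f by (simp_all add: mutate_fst)
  have B: "snd ?t $ i $ j = snd s $ i $ j + snd s $ i $ m * snd s $ m $ j"
    "snd ?t $ m $ i = snd s $ i $ m" "snd ?t $ m $ j = - snd s $ m $ j"
    using d(1-3) k w by (simp_all add: mutate_snd mutate_matrix_def)
  have ang: "real (p - q) * \<alpha> = a - b"
    using assms(2) by (simp add: a_def b_def of_nat_diff left_diff_distrib)
  have arg: "a - b + b = a"
    by simp_all
  have two: "sin (a - b - b) = 2 * cos b * sin (a - b) - sin a" "cos (a - b - b) = 2 * cos b * cos (a - b) - cos a"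
    using sin_add[of "a - b" b] cos_add[of "a - b" b] sin_diff[of "a - b" b] cos_diff[of "a - b" b]
    by simp_all
  have ex: "exchange_matrix (snd ?t)"
    using d(8) by (simp add: mutate_snd exchange_matrix_mutate)
  have bounds: "1 \<le> p - q" "p - q \<le> n"
    using d(5-7) assms(2) by linarith+
  show ?thesis
  proof (rule stateI[where a = "a - b" and b = b])
    show "cx (fst ?t i) = sin (a - b - b)"
      "cy (fst ?t i) = - \<eta> * cos (a - b - b)"
      unfolding v coords_linear d two by (simp_all add: algebra_simps)
    show "sin (a - b) * cd (fst ?t m) + sin b * cd (fst ?t j)
        + sin (a - b + b) * cd (fst ?t i) = - K"
      "cos (a - b) * cd (fst ?t m) + cos b * cd (fst ?t j)
        + cos (a - b + b) * cd (fst ?t i) = 0"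
      unfolding v coords_linear arg using d(15,16)
      by (simp_all add: sin_add cos_add sin_diff cos_diff algebra_simps)
    show "snd ?t $ i $ j = 2 * cos (a - b)"
      unfolding B d by (simp add: cos_add cos_diff)
  qed (simp_all only: v B coords_linear d(1-3)[symmetric] d not_False_eq_True ang arg bounds ex a_def[symmetric] b_def[symmetric])
qed

text \<open>In a cyclic seed, the mutations at \<open>i\<close> and \<open>j\<close> reflect \<open>m\<close> only. They are the inverses of
  the two Euclidean steps.\<close>

lemma mutate_source_cyclic:
  assumes "state i j m \<eta> p q s" and "p + q \<le> n"
  shows "state m j i \<eta> (p + q) q (mutate pos i s)"
proof -
  let ?t = "mutate pos i s"
  define a b where "a = real p * \<alpha>" and "b = real q * \<alpha>"
  note d = stateD[OF assms(1), folded a_def b_def] and f = state_forms[OF assms(1), folded a_def b_def]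
    and k = skew[OF assms(1)] and w = state_weights(1,2)[OF assms(1)] state_weights(3)[OF assms]
  have v: "fst ?t j = fst s j" "fst ?t i = - fst s i"
    "fst ?t m = fst s m - (- 2 * cos b) *\<^sub>R fst s i"
    using state_pos(1)[OF assms(1)] d(1-3) k w f(1-3) f(5)[of m i] f(5)[of m j] by (simp_all add: mutate_fst)
  have B: "snd ?t $ m $ j = snd s $ m $ j + snd s $ i $ m * snd s $ i $ j"
    "snd ?t $ m $ i = snd s $ i $ m" "snd ?t $ i $ j = - snd s $ i $ j"
    using d(1-3) k w by (simp_all add: mutate_snd mutate_matrix_def)
  have ang: "real (p + q) * \<alpha> = a + b"
    by (simp add: a_def b_def distrib_right)
  have arg: "a + b - b = a" by simp
  have ex: "exchange_matrix (snd ?t)"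
    using d(8) by (simp add: mutate_snd exchange_matrix_mutate)
  have bounds: "1 \<le> p + q"
    using d(5-7) assms(2) by linarith+
  show ?thesis
  proof (rule stateI[where a = "a + b" and b = b])
    show "cx (fst ?t m) = - sin (a + b)"
      "cy (fst ?t m) = \<eta> * cos (a + b)"
      unfolding v coords_linear d by (simp_all add: sin_add cos_add sin_diff cos_diff algebra_simps)
    show "sin (a + b) * cd (fst ?t m) + sin b * cd (fst ?t j)
        + sin (a + b + b) * cd (fst ?t i) = - K"
      "cos (a + b) * cd (fst ?t m) + cos b * cd (fst ?t j)
        + cos (a + b + b) * cd (fst ?t i) = 0"
    proof -
      have two: "sin (a + b + b) = 2 * sin (a + b) * cos b - sin a"
        "cos (a + b + b) = 2 * cos (a + b) * cos b - cos a"
        using sin_diff[of "a + b" b] cos_diff[of "a + b" b] sin_add[of "a + b" b] cos_add[of "a + b" b]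
        by simp_all
      show "sin (a + b) * cd (fst ?t m) + sin b * cd (fst ?t j)
        + sin (a + b + b) * cd (fst ?t i) = - K"
      "cos (a + b) * cd (fst ?t m) + cos b * cd (fst ?t j)
        + cos (a + b + b) * cd (fst ?t i) = 0"
        unfolding v coords_linear two using d(15,16) by (simp_all add: algebra_simps)
    qed
    show "snd ?t $ m $ j = - 2 * cos (a + b + b)"
      unfolding B d using cos_add_eq[of "a + b" b] by (simp add: algebra_simps)
  qed (simp_all only: v B coords_linear d(1-3)[symmetric] d not_False_eq_True ang arg bounds assms(2) ex a_def[symmetric] b_def[symmetric])
qed

lemma mutate_sink_cyclic:
  assumes "state i j m \<eta> p q s" and "p + q \<le> n"
  shows "state i m j \<eta> p (p + q) (mutate pos j s)"
proof -
  let ?t = "mutate pos j s"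
  define a b where "a = real p * \<alpha>" and "b = real q * \<alpha>"
  note d = stateD[OF assms(1), folded a_def b_def] and f = state_forms[OF assms(1), folded a_def b_def]
    and k = skew[OF assms(1)] and w = state_weights(1,2)[OF assms(1)] state_weights(3)[OF assms]
  have v: "fst ?t i = fst s i" "fst ?t j = - fst s j"
    "fst ?t m = fst s m - (- 2 * cos a) *\<^sub>R fst s j"
    using state_pos(3)[OF assms(1)] d(1-3) k w f(1-3) f(5)[of m i] f(5)[of m j] by (simp_all add: mutate_fst)
  have B: "snd ?t $ i $ m = snd s $ i $ m + snd s $ i $ j * snd s $ m $ j"
    "snd ?t $ j $ m = snd s $ m $ j" "snd ?t $ i $ j = - snd s $ i $ j"
    using d(1-3) k w by (simp_all add: mutate_snd mutate_matrix_def)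
  have ang: "real (p + q) * \<alpha> = a + b"
    by (simp add: a_def b_def distrib_right)
  have arg: "a - (a + b) = - b" by simp
  have two: "sin (a + (a + b)) = 2 * sin (a + b) * cos a - sin b"
    "cos (a + (a + b)) = 2 * cos (a + b) * cos a - cos b"
    using sin_diff[of "a + b" a] cos_diff[of "a + b" a] sin_add[of a "a + b"] cos_add[of a "a + b"]
    by simp_all
  have ex: "exchange_matrix (snd ?t)"
    using d(8) by (simp add: mutate_snd exchange_matrix_mutate)
  show ?thesis
  proof (rule stateI[where a = a and b = "a + b"])
    show "cx (fst ?t m) = sin (a + b)"
      "cy (fst ?t m) = \<eta> * cos (a + b)"
      unfolding v coords_linear d by (simp_all add: sin_add cos_add sin_diff cos_diff algebra_simps)
    show "sin a * cd (fst ?t i) + sin (a + b) * cd (fst ?t m)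
        + sin (a + (a + b)) * cd (fst ?t j) = - K"
      "cos a * cd (fst ?t i) + cos (a + b) * cd (fst ?t m)
        + cos (a + (a + b)) * cd (fst ?t j) = 0"
      unfolding v coords_linear two using d(15,16) by (simp_all add: algebra_simps)
    show "snd ?t $ i $ m = - 2 * cos (a + (a + b))"
      unfolding B d two by (simp add: algebra_simps)
  qed (simp_all only: v B coords_linear d(1-3)[symmetric] d not_False_eq_True ang arg assms(2) sin_minus cos_minus mult_minus_left ex a_def[symmetric] b_def[symmetric])
qed

lemma third_angle:
  assumes "p \<le> n" "q \<le> n"
  shows "real (2 * n + 1 - p - q) * \<alpha> = pi - (real p * \<alpha> + real q * \<alpha>)"
proof -
  have "real (2 * n + 1 - p - q) = 2 * real n + 1 - (real p + real q)"
    using assms by linarith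
  then show ?thesis
    using full_angle by (simp add: algebra_simps)
qed

text \<open>The vector of a source is positive, so that the whole triangle is reflected in the side \<open>i\<close>.
  The angles keep their values and are permuted cyclically: the new source is \<open>m\<close>, and \<open>i\<close> becomes the
  sink.\<close>

lemma mutate_source_acyclic:
  assumes "state i j m \<eta> p q s" and "n < p + q"
  shows "state m i j (- \<eta>) (2 * n + 1 - p - q) p (mutate pos i s)"
proof -
  let ?t = "mutate pos i s"
  define a b where "a = real p * \<alpha>" and "b = real q * \<alpha>"
  note d = stateD[OF assms(1), folded a_def b_def] and f = state_forms[OF assms(1), folded a_def b_def]
    and k = skew[OF assms(1)] and w = state_weights(1,2)[OF assms(1)] state_weights(4)[OF assms]
  have v: "fst ?t i = - fst s i"
    "fst ?t m = fst s m - (- 2 * cos b) *\<^sub>R fst s i"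
    "fst ?t j = fst s j - (2 * cos (a + b)) *\<^sub>R fst s i"
    using state_pos(1)[OF assms(1)] d(1-3) k w f(1-3) f(5)[of m i] f(5)[of j i] by (simp_all add: mutate_fst)
  have B: "snd ?t $ m $ j = snd s $ m $ j"
    "snd ?t $ m $ i = snd s $ i $ m" "snd ?t $ j $ i = snd s $ i $ j"
    using d(1-3) k w by (simp_all add: mutate_snd mutate_matrix_def)
  note ang = third_angle[OF d(6,7), folded a_def b_def]
  have arg: "pi - (a + b) + a = pi - b" "pi - (a + b) - a = pi - (a + b + a)" by simp_all
  have two: "sin (a + b + a) = sin b + 2 * cos (a + b) * sin a"
    "cos (a + b + a) = 2 * cos (a + b) * cos a - cos b"
    using sin_add_eq[of "a + b" a] cos_add_eq[of "a + b" a] by simp_all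
  have one: "sin (a + b) * cos b - cos (a + b) * sin b = sin a"
    using sin_diff[of "a + b" b] by simp
  have ex: "exchange_matrix (snd ?t)"
    using d(8) by (simp add: mutate_snd exchange_matrix_mutate)
  have bounds: "1 \<le> 2 * n + 1 - p - q" "2 * n + 1 - p - q \<le> n"
    using d(5-7) assms(2) by linarith+
  have sign: "- \<eta> = 1 \<or> - \<eta> = -1"
    using d(4) by auto
  show ?thesis
  proof (rule stateI[where a = "pi - (a + b)" and b = a])
    show "cx (fst ?t m) = - sin (pi - (a + b))"
      "cy (fst ?t m) = - \<eta> * cos (pi - (a + b))"
      unfolding v coords_linear d sin_pi_minus cos_pi_minus
      by (simp_all add: sin_add cos_add sin_diff cos_diff algebra_simps)
    show "cx (fst ?t j) = sin (pi - (a + b) - a)"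
      "cy (fst ?t j) = - (- \<eta>) * cos (pi - (a + b) - a)"
      unfolding v coords_linear d arg sin_pi_minus cos_pi_minus two by (simp_all add: algebra_simps)
    show "sin (pi - (a + b)) * cd (fst ?t m) + sin a * cd (fst ?t i)
        + sin (pi - (a + b) + a) * cd (fst ?t j) = - K"
    proof -
      have "sin (pi - (a + b)) * cd (fst ?t m) + sin a * cd (fst ?t i)
        + sin (pi - (a + b) + a) * cd (fst ?t j)
        = sin b * cd (fst s j) + sin (a + b) * cd (fst s m)
          + (2 * (sin (a + b) * cos b - cos (a + b) * sin b) - sin a) * cd (fst s i)"
        unfolding v coords_linear arg sin_pi_minus by (simp add: algebra_simps)
      then show ?thesis
        using d(15) by (simp add: one)
    qed
    show "cos (pi - (a + b)) * cd (fst ?t m) + cos a * cd (fst ?t i)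
        + cos (pi - (a + b) + a) * cd (fst ?t j) = 0"
      unfolding v coords_linear arg cos_pi_minus using d(16) by (simp add: algebra_simps)
  qed (simp_all only: v B coords_linear d(1-3)[symmetric] d not_False_eq_True ang arg bounds sign cos_pi_minus mult_minus_left mult_minus_right minus_minus ex a_def[symmetric] b_def[symmetric])
qed

text \<open>Mutation at a sink is also a reflection of the whole triangle; it moves backwards along the
  belt.\<close>

lemma mutate_sink_acyclic:
  assumes "state i j m \<eta> p q s" and "n < p + q"
  shows "state j m i (- \<eta>) q (2 * n + 1 - p - q) (mutate pos j s)"
proof -
  let ?t = "mutate pos j s"
  define a b where "a = real p * \<alpha>" and "b = real q * \<alpha>"
  note d = stateD[OF assms(1), folded a_def b_def] and f = state_forms[OF assms(1), folded a_def b_def]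
    and k = skew[OF assms(1)] and w = state_weights(1,2)[OF assms(1)] state_weights(4)[OF assms]
  have v: "fst ?t j = - fst s j"
    "fst ?t m = fst s m - (- 2 * cos a) *\<^sub>R fst s j"
    "fst ?t i = fst s i - (2 * cos (a + b)) *\<^sub>R fst s j"
    using state_pos(3)[OF assms(1)] d(1-3) k w f(1-3) f(5)[of m i] f(5)[of m j] by (simp_all add: mutate_fst)
  have B: "snd ?t $ i $ m = snd s $ i $ m"
    "snd ?t $ j $ m = snd s $ m $ j" "snd ?t $ j $ i = snd s $ i $ j"
    using d(1-3) k w by (simp_all add: mutate_snd mutate_matrix_def)
  note ang = third_angle[OF d(6,7), folded a_def b_def]
  have arg: "b + (pi - (a + b)) = pi - a" "b - (pi - (a + b)) = - (pi - (a + b + b))" by simp_all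
  have two: "sin (a + b + b) = sin a + 2 * cos (a + b) * sin b"
    "cos (a + b + b) = 2 * cos (a + b) * cos b - cos a"
    using sin_add_eq[of "a + b" b] cos_add_eq[of "a + b" b] by simp_all
  have one: "sin (a + b) * cos a - cos (a + b) * sin a = sin b"
    using sin_diff[of "a + b" a] by simp
  have ex: "exchange_matrix (snd ?t)"
    using d(8) by (simp add: mutate_snd exchange_matrix_mutate)
  have bounds: "1 \<le> q" "2 * n + 1 - p - q \<le> n"
    using d(5-7) assms(2) by linarith+
  have sign: "- \<eta> = 1 \<or> - \<eta> = -1"
    using d(4) by auto
  show ?thesis
  proof (rule stateI[where a = b and b = "pi - (a + b)"])
    show "cx (fst ?t m) = sin (pi - (a + b))"
      "cy (fst ?t m) = - \<eta> * cos (pi - (a + b))"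
      unfolding v coords_linear d sin_pi_minus cos_pi_minus
      by (simp_all add: sin_add cos_add sin_diff cos_diff algebra_simps)
    show "cx (fst ?t i) = sin (b - (pi - (a + b)))"
      "cy (fst ?t i) = - (- \<eta>) * cos (b - (pi - (a + b)))"
      unfolding v coords_linear d arg sin_minus cos_minus sin_pi_minus cos_pi_minus two by (simp_all add: algebra_simps)
    show "sin b * cd (fst ?t j) + sin (pi - (a + b)) * cd (fst ?t m)
        + sin (b + (pi - (a + b))) * cd (fst ?t i) = - K"
    proof -
      have "sin b * cd (fst ?t j) + sin (pi - (a + b)) * cd (fst ?t m)
        + sin (b + (pi - (a + b))) * cd (fst ?t i)
        = sin a * cd (fst s i) + sin (a + b) * cd (fst s m)
          + (2 * (sin (a + b) * cos a - cos (a + b) * sin a) - sin b) * cd (fst s j)"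
        unfolding v coords_linear arg sin_pi_minus by (simp add: algebra_simps)
      then show ?thesis
        using d(15) by (simp add: one)
    qed
    show "cos b * cd (fst ?t j) + cos (pi - (a + b)) * cd (fst ?t m)
        + cos (b + (pi - (a + b))) * cd (fst ?t i) = 0"
      unfolding v coords_linear arg cos_pi_minus using d(16) by (simp add: algebra_simps)
  qed (simp_all only: v B coords_linear d(1-3)[symmetric] d not_False_eq_True ang arg bounds sign cos_pi_minus mult_minus_left mult_minus_right minus_minus ex a_def[symmetric] b_def[symmetric])
qed

section \<open>Glides along the belt line\<close>

text \<open>The isometries that preserve the belt line and its direction: translations along it, composed
  with the reflection across it if \<open>\<epsilon> = -1\<close>.\<close>

definition glide :: "real \<Rightarrow> real \<Rightarrow> real^2 \<Rightarrow> real^2" where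
  "glide \<epsilon> \<tau> x = ori + ((x - ori) \<bullet> e + \<tau>) *\<^sub>R e + (\<epsilon> * ((x - ori) \<bullet> f)) *\<^sub>R f"

definition act :: "real \<Rightarrow> real \<Rightarrow> labelled_seed \<Rightarrow> labelled_seed" where
  "act \<epsilon> \<tau> s = (push (glide \<epsilon> \<tau>) \<circ> fst s, snd s)"

lemma fe: "f \<bullet> e = 0"
  by (simp add: ef inner_commute)

lemma norm_expand: "norm x ^ 2 = (x \<bullet> e)^2 + (x \<bullet> f)^2"
proof -
  have "x \<bullet> x = ((x \<bullet> e) *\<^sub>R e + (x \<bullet> f) *\<^sub>R f) \<bullet> x"
    by (simp only: expand[symmetric])
  then have "x \<bullet> x = (x \<bullet> e) * (e \<bullet> x) + (x \<bullet> f) * (f \<bullet> x)"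
    by (simp only: inner_add_left inner_scaleR_left)
  then show ?thesis
    unfolding power2_norm_eq_inner by (simp add: power2_eq_square inner_commute)
qed

lemma glide_diff: "glide \<epsilon> \<tau> x - glide \<epsilon> \<tau> y = ((x - y) \<bullet> e) *\<^sub>R e + (\<epsilon> * ((x - y) \<bullet> f)) *\<^sub>R f"
  by (simp add: glide_def inner_diff_left algebra_simps)

lemma isometry_glide:
  assumes "\<epsilon> = 1 \<or> \<epsilon> = -1"
  shows "isometry (glide \<epsilon> \<tau>)"
proof -
  have "norm (glide \<epsilon> \<tau> x - glide \<epsilon> \<tau> y) ^ 2 = norm (x - y) ^ 2" for x y
    unfolding glide_diff norm_expand using assms
    by (auto simp: inner_add_left ee ff ef fe)
  then show ?thesis
    by (simp add: isometry_def dist_norm)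
qed

text \<open>An isometry along the belt preserves the first coordinate of a gradient, and with it
  positivity.\<close>

lemma coords_push_glide [simp]:
  assumes "\<epsilon> = 1 \<or> \<epsilon> = -1"
  shows "cx (push (glide \<epsilon> \<tau>) g) = cx g" "cy (push (glide \<epsilon> \<tau>) g) = \<epsilon> * cy g"
    "cd (push (glide \<epsilon> \<tau>) g) = cd g - \<tau> * cx g"
proof -
  define a where "a = fst g"
  have fst: "fst (push (glide \<epsilon> \<tau>) g) = (a \<bullet> e) *\<^sub>R e + (\<epsilon> * (a \<bullet> f)) *\<^sub>R f"
    by (simp add: push_def Let_def glide_diff a_def)
  then show "cx (push (glide \<epsilon> \<tau>) g) = cx g" "cy (push (glide \<epsilon> \<tau>) g) = \<epsilon> * cy g"
    by (simp_all add: cx_def cy_def a_def inner_add_left ee ff ef fe)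
  have "eval (push (glide \<epsilon> \<tau>) g) (glide \<epsilon> \<tau> ori) = eval g ori"
    by (rule eval_push[OF isometry_glide[OF assms]])
  moreover have "glide \<epsilon> \<tau> ori = ori + \<tau> *\<^sub>R e"
    by (simp add: glide_def)
  ultimately have "eval (push (glide \<epsilon> \<tau>) g) ori = eval g ori - \<tau> * (a \<bullet> e)"
    by (simp add: eval_def[of "push _ _"] inner_add_right fst inner_add_left ee fe)
  then show "cd (push (glide \<epsilon> \<tau>) g) = cd g - \<tau> * cx g"
    by (simp add: cd_def cx_def a_def diff_divide_distrib)
qed

lemma act_fst: "fst (act \<epsilon> \<tau> s) x = push (glide \<epsilon> \<tau>) (fst s x)"
  and act_snd: "snd (act \<epsilon> \<tau> s) = snd s"
  by (simp_all add: act_def)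

lemma labelled_seed_eqI: "(\<And>x. fst s x = fst t x) \<Longrightarrow> snd s = snd t \<Longrightarrow> s = (t :: labelled_seed)"
  by (intro prod_eqI) auto

lemma act_act:
  assumes "\<epsilon> = 1 \<or> \<epsilon> = -1" "\<epsilon>' = 1 \<or> \<epsilon>' = -1"
  shows "act \<epsilon> \<tau> (act \<epsilon>' \<tau>' s) = act (\<epsilon> * \<epsilon>') (\<tau> + \<tau>') s"
proof -
  have "\<epsilon> * \<epsilon>' = 1 \<or> \<epsilon> * \<epsilon>' = -1"
    using assms by auto
  then show ?thesis
    using assms by (intro labelled_seed_eqI aff_eqI) (simp_all add: act_fst act_snd algebra_simps)
qed

lemma act_id: "act 1 0 s = s"
  by (intro labelled_seed_eqI aff_eqI) (simp_all add: act_fst act_snd)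

lemma act_relabel: "act \<epsilon> \<tau> (relabel \<sigma> s) = relabel \<sigma> (act \<epsilon> \<tau> s)"
  by (intro labelled_seed_eqI) (simp_all add: act_fst act_snd relabel_fst relabel_def)

text \<open>Mutation is defined in terms of positivity and inner products, and glides preserve both. This
  equivariance is the source of all symmetries of the exchange graph.\<close>

lemma act_mutate:
  assumes "\<epsilon> = 1 \<or> \<epsilon> = -1"
  shows "act \<epsilon> \<tau> (mutate pos k s) = mutate pos k (act \<epsilon> \<tau> s)"
proof (intro labelled_seed_eqI)
  have "pos (push (glide \<epsilon> \<tau>) g) = pos g" for g
    using assms by (auto simp: pos_coords)
  moreover have "form (push (glide \<epsilon> \<tau>) g) (push (glide \<epsilon> \<tau>) h) = form g h" for g h
    using assms by (auto simp: form_coords)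
  ultimately show "fst (act \<epsilon> \<tau> (mutate pos k s)) x = fst (mutate pos k (act \<epsilon> \<tau> s)) x" for x
    using assms by (intro aff_eqI) (auto simp: act_fst act_snd mutate_fst algebra_simps)
qed (simp add: act_snd mutate_snd)

text \<open>Translations preserve the two equations on the constant terms, because by
  \<open>sum_difference_products\<close> the first coordinates of the three gradients solve the homogeneous system.\<close>

lemma state_act:
  assumes "state i j m \<eta> p q s" "\<epsilon> = 1 \<or> \<epsilon> = -1"
  shows "state i j m (\<epsilon> * \<eta>) p q (act \<epsilon> \<tau> s)"
proof -
  note d = stateD[OF assms(1)]
  define a b where "a = real p * \<alpha>" and "b = real q * \<alpha>"
  have c: "cd (fst (act \<epsilon> \<tau> s) i) = cd (fst s i) + \<tau> * sin a"
    "cd (fst (act \<epsilon> \<tau> s) j) = cd (fst s j) - \<tau> * sin b"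
    "cd (fst (act \<epsilon> \<tau> s) m) = cd (fst s m) - \<tau> * sin (a - b)"
    using assms(2) d(9,11,13) by (simp_all add: act_fst a_def b_def)
  show ?thesis
  proof (rule stateI[where a = a and b = b])
    have "sin a * cd (fst (act \<epsilon> \<tau> s) i) + sin b * cd (fst (act \<epsilon> \<tau> s) j) + sin (a + b) * cd (fst (act \<epsilon> \<tau> s) m)
      = (sin a * cd (fst s i) + sin b * cd (fst s j) + sin (a + b) * cd (fst s m))
        + \<tau> * (sin a * sin a - sin b * sin b - sin (a + b) * sin (a - b))"
      unfolding c by (simp add: algebra_simps)
    then show "sin a * cd (fst (act \<epsilon> \<tau> s) i) + sin b * cd (fst (act \<epsilon> \<tau> s) j) + sin (a + b) * cd (fst (act \<epsilon> \<tau> s) m) = - K"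
      using d(15)[folded a_def b_def] by (simp add: sum_difference_products)
    have "cos a * cd (fst (act \<epsilon> \<tau> s) i) + cos b * cd (fst (act \<epsilon> \<tau> s) j) + cos (a + b) * cd (fst (act \<epsilon> \<tau> s) m)
      = (cos a * cd (fst s i) + cos b * cd (fst s j) + cos (a + b) * cd (fst s m))
        + \<tau> * (cos a * sin a - cos b * sin b - cos (a + b) * sin (a - b))"
      unfolding c by (simp add: algebra_simps)
    then show "cos a * cd (fst (act \<epsilon> \<tau> s) i) + cos b * cd (fst (act \<epsilon> \<tau> s) j) + cos (a + b) * cd (fst (act \<epsilon> \<tau> s) m) = 0"
      using d(16)[folded a_def b_def] by (simp add: sum_difference_products)
    show "\<epsilon> * \<eta> = 1 \<or> \<epsilon> * \<eta> = -1"
      using d(4) assms(2) by auto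
  qed (use assms(2) d(5) in \<open>simp_all add: d act_fst act_snd a_def b_def\<close>)
qed

lemma state_relabel:
  assumes "state (\<sigma> i) (\<sigma> j) (\<sigma> m) \<eta> p q s"
  shows "state i j m \<eta> p q (relabel \<sigma> s)"
proof -
  note d = stateD[OF assms]
  have "exchange_matrix (snd (relabel \<sigma> s))"
    unfolding exchange_matrix_iff relabel_snd
    using d(8)[unfolded exchange_matrix_iff] by (intro allI) (elim allE)
  then show ?thesis
    using assms unfolding state_def Let_def relabel_fst relabel_snd by blast
qed

section \<open>Linked seeds\<close>

definition is_state :: "labelled_seed \<Rightarrow> bool" where
  "is_state s \<longleftrightarrow> (\<exists>i j m \<eta> p q. state i j m \<eta> p q s)"

lemma is_state_mutate:
  assumes "is_state s"
  shows "is_state (mutate pos k s)"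
proof -
  obtain i j m \<eta> p q where s: "state i j m \<eta> p q s"
    using assms by (auto simp: is_state_def)
  consider "k = i" | "k = j" | "k = m"
    using index_cases[OF stateD(1-3)[OF s], of k] by blast
  then show ?thesis
    unfolding is_state_def
    using mutate_source_cyclic[OF s] mutate_source_acyclic[OF s] mutate_sink_cyclic[OF s]
      mutate_sink_acyclic[OF s] mutate_middle_le[OF s] mutate_middle_gt[OF s]
    by (metis not_le)
qed

lemma is_state_relabel:
  assumes "is_state s" "bij \<sigma>"
  shows "is_state (relabel \<sigma> s)"
proof -
  obtain i j m \<eta> p q where s: "state i j m \<eta> p q s"
    using assms by (auto simp: is_state_def)
  have "\<sigma> (inv \<sigma> x) = x" for x
    using assms(2) by (simp add: bij_is_surj surj_f_inv_f)
  then have "state (inv \<sigma> i) (inv \<sigma> j) (inv \<sigma> m) \<eta> p q (relabel \<sigma> s)"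
    using s by (intro state_relabel) simp
  then show ?thesis
    unfolding is_state_def by blast
qed

text \<open>Reachability by mutations and relabellings, which is the relation between labelled
  seeds that belong to the same exchange graph.\<close>

definition linked :: "labelled_seed \<Rightarrow> labelled_seed \<Rightarrow> bool" where
  "linked = (\<lambda>s t. (\<exists>k. t = mutate pos k s) \<or> (\<exists>\<sigma>. bij \<sigma> \<and> t = relabel \<sigma> s))\<^sup>*\<^sup>*"

lemma linked_refl: "linked s s"
  by (simp add: linked_def)

lemma linked_trans [trans]: "linked s t \<Longrightarrow> linked t u \<Longrightarrow> linked s u"
  unfolding linked_def by (rule rtranclp_trans)

lemma linked_mutate: "linked s (mutate pos k s)"
  unfolding linked_def by (rule r_into_rtranclp) blast

lemma linked_relabel: "bij \<sigma> \<Longrightarrow> linked s (relabel \<sigma> s)"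
  unfolding linked_def by (rule r_into_rtranclp) blast

lemma linked_induct [consumes 1, case_names refl mutate relabel]:
  assumes "linked s t" "P s"
    "\<And>t k. linked s t \<Longrightarrow> P t \<Longrightarrow> P (mutate pos k t)"
    "\<And>t \<sigma>. linked s t \<Longrightarrow> P t \<Longrightarrow> bij \<sigma> \<Longrightarrow> P (relabel \<sigma> t)"
  shows "P t"
  using assms(1) unfolding linked_def
proof (induction rule: rtranclp_induct)
  case base
  show ?case by (rule assms(2))
next
  case (step y z)
  then show ?case
    using assms(3,4) unfolding linked_def by blast
qed

lemma linked_act:
  assumes "linked s t" "\<epsilon> = 1 \<or> \<epsilon> = -1"
  shows "linked (act \<epsilon> \<tau> s) (act \<epsilon> \<tau> t)"
  using assms(1)
proof (induction rule: linked_induct)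
  case refl
  show ?case by (rule linked_refl)
next
  case (mutate t k)
  then show ?case
    using act_mutate[OF assms(2)] linked_mutate linked_trans by metis
next
  case (relabel t \<sigma>)
  then show ?case
    using act_relabel linked_relabel linked_trans by metis
qed

lemma linked_is_state:
  assumes "linked s t" "is_state s"
  shows "is_state t"
  using assms by (induction rule: linked_induct) (auto intro: is_state_mutate is_state_relabel)

lemma linked_sym:
  assumes "linked s t" "is_state s"
  shows "linked t s"
  using assms(1)
proof (induction rule: linked_induct)
  case refl
  show ?case by (rule linked_refl)
next
  case (mutate t k)
  obtain i j m \<eta> p q where t: "state i j m \<eta> p q t"
    using linked_is_state[OF mutate(1) assms(2)] by (auto simp: is_state_def)
  have "mutate pos k (mutate pos k t) = t"
    by (rule mutate_mutate[OF state_forms(4)[OF t] pos_uminus_state[OF t]])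
  then show ?case
    using linked_mutate[of "mutate pos k t" k] linked_trans mutate(2) by metis
next
  case (relabel t \<sigma>)
  then show ?case
    using relabel_bij_inverse(1)[of \<sigma> t] linked_relabel[of "inv \<sigma>" "relabel \<sigma> t"] bij_imp_bij_inv
      linked_trans by metis
qed

section \<open>Rigidity of the quiver\<close>

lemma angle_eqD:
  assumes "cos (real p * \<alpha>) = cos (real p' * \<alpha>)" "p \<le> 2 * n" "p' \<le> 2 * n"
  shows "p = p'"
proof -
  have "0 \<le> real p * \<alpha>" "real p * \<alpha> \<le> pi" "0 \<le> real p' * \<alpha>" "real p' * \<alpha> \<le> pi"
    using assms(2,3) angle_less_pi[of p] angle_less_pi[of p'] \<alpha>_pos by simp_all
  then have "real p * \<alpha> = real p' * \<alpha>"
    using assms(1) by (rule cos_inj_pi)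
  then show ?thesis
    using \<alpha>_pos by simp
qed

text \<open>The weights are cosines of multiples of \<open>\<alpha>\<close> and determine these multiples, so only the
  isomorphisms of quivers have to be examined. An acyclic quiver is rigid. A rotation of a cyclic quiver
  would exchange the role of the largest of the angles \<open>p\<close>, \<open>q\<close>, \<open>p + q\<close> with another one, which is
  impossible as \<open>p\<close> is at least \<open>1\<close>, unless \<open>q = 0\<close>, when it would make the new \<open>p\<close> zero.\<close>

lemma state_quiver_determines:
  assumes s: "state i j m \<eta> p q s" and t: "state i' j' m' \<eta>' p' q' t" and "snd s = snd t"
  shows "i = i'" "j = j'" "m = m'" "p = p'" "q = q'"
proof -
  note d = stateD[OF s] and d' = stateD[OF t]
  define B where "B = snd t"
  have B: "B $ i $ m = 2 * cos (real q * \<alpha>)" "B $ m $ j = 2 * cos (real p * \<alpha>)"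
    "B $ i $ j = - 2 * cos (real (p + q) * \<alpha>)" "B $ j $ i = 2 * cos (real (p + q) * \<alpha>)"
    "B $ m $ i < 0" "B $ j $ m < 0" "p + q \<le> n \<Longrightarrow> B $ j $ i > 0" "p + q \<le> n \<Longrightarrow> B $ i $ j < 0"
    "n < p + q \<Longrightarrow> B $ i $ j > 0"  "n < p + q \<Longrightarrow> B $ j $ i < 0"
    using d skew[OF s] state_weights[OF s] assms(3) by (simp_all add: B_def distrib_right)
  have B': "B $ i' $ m' = 2 * cos (real q' * \<alpha>)" "B $ m' $ j' = 2 * cos (real p' * \<alpha>)"
    "B $ i' $ j' = - 2 * cos (real (p' + q') * \<alpha>)" "B $ j' $ i' = 2 * cos (real (p' + q') * \<alpha>)"
    "B $ m' $ i' < 0" "B $ j' $ m' < 0" "p' + q' \<le> n \<Longrightarrow> B $ j' $ i' > 0" "p' + q' \<le> n \<Longrightarrow> B $ i' $ j' < 0"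
    "n < p' + q' \<Longrightarrow> B $ i' $ j' > 0" "n < p' + q' \<Longrightarrow> B $ j' $ i' < 0"
    using d' skew[OF t] state_weights[OF t] by (simp_all add: B_def distrib_right)
  have pos: "B $ i $ m > 0" "B $ m $ j > 0" "B $ i' $ m' > 0" "B $ m' $ j' > 0"
    using state_weights[OF s] state_weights[OF t] assms(3) by (simp_all add: B_def)
  have eqs: "x = y" if "cos (real x * \<alpha>) = cos (real y * \<alpha>)" "x \<le> n \<or> x = p + q \<or> x = p' + q'" "y \<le> n \<or> y = p + q \<or> y = p' + q'" for x y
    using that d(6,7) d'(6,7) by (intro angle_eqD) auto
  have ii: "i = i' \<and> j = j' \<and> m = m' \<Longrightarrow> p = p' \<and> q = q'"
    using B(1,2) B'(1,2) d(6,7) d'(6,7) eqs[of p p'] eqs[of q q'] by auto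
  have perm: "(i' = i \<and> j' = j \<and> m' = m) \<or> (i' = i \<and> j' = m \<and> m' = j) \<or> (i' = j \<and> j' = i \<and> m' = m)
     \<or> (i' = j \<and> j' = m \<and> m' = i) \<or> (i' = m \<and> j' = i \<and> m' = j) \<or> (i' = m \<and> j' = j \<and> m' = i)"
    using index_cases[OF d(1-3), of i'] index_cases[OF d(1-3), of j'] index_cases[OF d(1-3), of m'] d'(1-3)
    by (elim disjE) simp_all
  have r1: False if h: "i' = j" "j' = m" "m' = i"
  proof -
    have "p + q = q'" "q = p'"
      using B B' h eqs[of "p + q" q'] eqs[of q p'] d(6,7) d'(6,7) by simp_all
    moreover have "p' + q' \<le> n"
      using B'(9) B(6) h by (intro leI notI) simp
    then have "p = p' + q'" using B B' h eqs[of p "p' + q'"] d(6,7) d'(6,7) skew[OF s] skew[OF t] assms(3) by (simp add: B_def)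
    ultimately show False using d(5) d'(5) by linarith
  qed
  have r2: False if h: "i' = m" "j' = i" "m' = j"
  proof -
    have "p = q'" "p + q = p'"
      using B B' h eqs[of "p + q" p'] eqs[of p q'] d(6,7) d'(6,7) by simp_all
    moreover have "q = p' + q'" using B B' h eqs[of q "p' + q'"] d(6,7) d'(6,7) skew[OF s] skew[OF t] assms(3) by (simp add: B_def)
    ultimately show False using d(5) d'(5) by linarith
  qed
  have r3: "\<not> (i' = i \<and> j' = m \<and> m' = j)" "\<not> (i' = j \<and> j' = i \<and> m' = m)" "\<not> (i' = m \<and> j' = j \<and> m' = i)"
    using B B' pos by auto
  have "i = i' \<and> j = j' \<and> m = m'"
    using perm r1 r2 r3 by blast
  then show "i = i'" "j = j'" "m = m'" "p = p'" "q = q'"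
    using ii by blast+
qed

end

section \<open>Vertices of the exchange graph\<close>

lemma index_bij:
  assumes "i \<noteq> j" "i \<noteq> m" "j \<noteq> (m::3)" "i' \<noteq> j'" "i' \<noteq> m'" "j' \<noteq> (m'::3)"
  obtains \<sigma> where "bij \<sigma>" "\<sigma> i = i'" "\<sigma> j = j'" "\<sigma> m = m'"
proof -
  define \<sigma> where "\<sigma> x = (if x = i then i' else if x = j then j' else m')" for x :: 3
  have s: "\<sigma> i = i'" "\<sigma> j = j'" "\<sigma> m = m'"
    using assms(1-3) by (auto simp: \<sigma>_def)
  have "x \<in> range \<sigma>" for x
    using index_cases[OF assms(4-6), of x] s by (metis rangeI)
  then have "surj \<sigma>"
    by auto
  then have "bij \<sigma>"
    by (simp add: bij_def finite_UNIV_surj_inj)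
  then show ?thesis
    using s by (rule that)
qed

text \<open>The determinant of the system is \<open>sin a\<close> up to sign.\<close>

lemma linear_system_zero:
  fixes y z :: real
  assumes "sin b * y + sin (a + b) * z = 0" "cos b * y + cos (a + b) * z = 0" "sin a \<noteq> 0"
  shows "y = 0" "z = 0"
proof -
  have s: "sin (a + b) * cos b - cos (a + b) * sin b = sin a"
    using sin_diff[of "a + b" b] by simp
  have "(sin (a + b) * cos b - cos (a + b) * sin b) * z
      = cos b * (sin b * y + sin (a + b) * z) - sin b * (cos b * y + cos (a + b) * z)"
    by (simp add: algebra_simps)
  then show "z = 0"
    using assms by (simp add: s)
  have "(sin (a + b) * cos b - cos (a + b) * sin b) * y
      = sin (a + b) * (cos b * y + cos (a + b) * z) - cos (a + b) * (sin b * y + sin (a + b) * z)"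
    by (simp add: algebra_simps)
  then show "y = 0"
    using assms by (simp add: s)
qed

lemma seed_of_mutate_in_graph:
  assumes "seed_of t \<in> fst (exchange_graph pos s0)"
  shows "seed_of (mutate pos k t) \<in> fst (exchange_graph pos s0)"
proof -
  obtain t0 where t0: "mutation_equivalent pos s0 t0" "seed_of t = seed_of t0"
    using assms by (auto simp: exchange_graph_def)
  obtain \<sigma> where \<sigma>: "bij \<sigma>" "t = relabel \<sigma> t0"
    using seed_of_eqD[OF t0(2)[symmetric]] by blast
  have "seed_of (mutate pos k t) = seed_of (mutate pos (\<sigma> k) t0)"
    unfolding \<sigma>(2) mutate_relabel[OF \<sigma>(1)] by (rule seed_of_relabel[OF \<sigma>(1)])
  moreover have "mutation_equivalent pos s0 (mutate pos (\<sigma> k) t0)"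
    using t0(1) unfolding mutation_equivalent_def
    by (rule rtranclp.rtrancl_into_rtrancl) blast
  ultimately show ?thesis
    unfolding exchange_graph_def fst_conv by blast
qed

context belt_frame
begin

lemma seed_of_in_graph_iff:
  "seed_of t \<in> fst (exchange_graph pos s0) \<longleftrightarrow> linked s0 t"
proof
  assume "linked s0 t"
  then show "seed_of t \<in> fst (exchange_graph pos s0)"
  proof (induction rule: linked_induct)
    case refl
    then show ?case
      unfolding exchange_graph_def mutation_equivalent_def fst_conv by blast
  next
    case (mutate t k)
    then show ?case by (intro seed_of_mutate_in_graph)
  next
    case (relabel t \<sigma>)
    then show ?case by (simp add: seed_of_relabel)
  qed
next
  assume "seed_of t \<in> fst (exchange_graph pos s0)"
  then obtain t0 where t0: "mutation_equivalent pos s0 t0" "seed_of t = seed_of t0"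
    by (auto simp: exchange_graph_def)
  have "linked s0 t0"
    using t0(1) unfolding mutation_equivalent_def
  proof (induction rule: rtranclp_induct)
    case base
    show ?case by (rule linked_refl)
  next
    case (step y z)
    then show ?case
      using linked_mutate linked_trans by blast
  qed
  moreover obtain \<sigma> where "bij \<sigma>" "t = relabel \<sigma> t0"
    using seed_of_eqD[OF t0(2)[symmetric]] by blast
  ultimately show "linked s0 t"
    using linked_relabel linked_trans by blast
qed

lemma state_matrix_eq:
  assumes s: "state i j m \<eta> p q s" and t: "state i j m \<eta>' p q t"
  shows "snd s = snd t"
proof -
  note d = stateD[OF s] and d' = stateD[OF t]
  have sk: "snd s $ x $ x = 0" "snd t $ x $ x = 0" for x
    using d(8)[unfolded exchange_matrix_iff, rule_format, of x x]
      d'(8)[unfolded exchange_matrix_iff, rule_format, of x x] by linarith+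
  have "snd s $ x $ y = snd t $ x $ y" for x y
    using index_cases[OF d(1-3), of x] index_cases[OF d(1-3), of y]
    by (elim disjE) (simp_all only: sk skew[OF s] skew[OF t] d(17-19) d'(17-19))
  then show ?thesis
    by (simp add: vec_eq_iff)
qed

text \<open>The two equations on the three constant terms leave one degree of freedom, which is the
  translation along the belt line: since \<open>p \<ge> 1\<close>, the line of the side \<open>i\<close> is not parallel to the belt,
  so a translation moves it to any prescribed parallel position.\<close>

lemma state_glide:
  assumes s: "state i j m \<eta> p q s" and t: "state i j m \<eta>' p q t"
  obtains \<tau> where "t = act (\<eta> * \<eta>') \<tau> s"
proof -
  note d' = stateD[OF t]
  define a b where "a = real p * \<alpha>" and "b = real q * \<alpha>"
  have sa: "sin a \<noteq> 0"
    using sin_pos[of p] stateD(5,6)[OF s] by (simp add: a_def)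
  define \<tau> where "\<tau> = (cd (fst t i) - cd (fst s i)) / sin a"
  define u where "u = act (\<eta> * \<eta>') \<tau> s"
  have eta: "\<eta> * \<eta>' = 1 \<or> \<eta> * \<eta>' = -1" "\<eta> * \<eta>' * \<eta> = \<eta>'"
    using stateD(4)[OF s] d'(4) by auto
  have u: "state i j m \<eta>' p q u"
    using state_act[OF s eta(1), of \<tau>] by (simp add: u_def eta(2))
  note du = stateD[OF u]
  have "cd (fst u i) = cd (fst t i)"
    using eta(1) sa stateD(9)[OF s] by (simp add: u_def act_fst \<tau>_def a_def)
  moreover from this have "sin b * (cd (fst u j) - cd (fst t j)) + sin (a + b) * (cd (fst u m) - cd (fst t m)) = 0"
    "cos b * (cd (fst u j) - cd (fst t j)) + cos (a + b) * (cd (fst u m) - cd (fst t m)) = 0"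
    using du(15,16) d'(15,16) by (simp_all add: a_def b_def right_diff_distrib)
  then have "cd (fst u j) - cd (fst t j) = 0" "cd (fst u m) - cd (fst t m) = 0"
    using linear_system_zero sa by blast+
  ultimately have "fst u x = fst t x" for x
    using index_cases[OF d'(1-3), of x] du d' by (intro aff_eqI) (elim disjE; simp)+
  then have "t = u"
    using state_matrix_eq[OF t u] by (intro labelled_seed_eqI) simp_all
  then show ?thesis
    using that u_def by blast
qed

section \<open>The Euclidean algorithm\<close>

text \<open>The Euclidean algorithm, carried out by mutations at the middle vertex.\<close>

lemma state_reduce:
  assumes "state i j m \<eta> p q s"
  shows "\<exists>t i' j' m'. linked s t \<and> state i' j' m' \<eta> (gcd p q) 0 t"
  using assms
proof (induction "p + q" arbitrary: i j m p q s rule: less_induct)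
  case less
  note s = less.prems
  consider "q = 0" | "0 < q" "p \<le> q" | "q < p" "0 < q"
    by linarith
  then show ?case
  proof cases
    case 1
    then have "state i j m \<eta> (gcd p q) 0 s"
      using s by simp
    then show ?thesis
      using linked_refl by blast
  next
    case 2
    have "\<exists>t i' j' m'. linked (mutate pos m s) t \<and> state i' j' m' \<eta> (gcd p (q - p)) 0 t"
      using 2 stateD(5)[OF s] by (intro less.hyps[OF _ mutate_middle_le[OF s]]) auto
    moreover have "gcd p (q - p) = gcd p q"
      using 2 by (metis gcd.commute gcd_diff1_nat)
    ultimately show ?thesis
      using linked_mutate linked_trans by metis
  next
    case 3
    have "\<exists>t i' j' m'. linked (mutate pos m s) t \<and> state i' j' m' \<eta> (gcd (p - q) q) 0 t"
      using 3 by (intro less.hyps[OF _ mutate_middle_gt[OF s]]) auto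
    moreover have "gcd (p - q) q = gcd p q"
      using 3 by (simp add: gcd_diff1_nat)
    ultimately show ?thesis
      using linked_mutate linked_trans by metis
  qed
qed

text \<open>Mutations at \<open>j\<close> run the Euclidean algorithm backwards as long as the seed remains
  cyclic.\<close>

lemma state_grow:
  assumes "state i j m \<eta> p 0 s" "k * p \<le> n"
  shows "\<exists>t j' m'. linked s t \<and> state i j' m' \<eta> p (k * p) t"
  using assms(2)
proof (induction k)
  case 0
  have "state i j m \<eta> p (0 * p) s"
    using assms(1) by simp
  then show ?case
    using linked_refl by blast
next
  case (Suc k)
  then obtain t j' m' where t: "linked s t" "state i j' m' \<eta> p (k * p) t"
    by auto
  have "state i m' j' \<eta> p (p + k * p) (mutate pos j' t)"
    using Suc.prems by (intro mutate_sink_cyclic[OF t(2)]) simp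
  then show ?case
    using t(1) linked_mutate linked_trans by (metis mult_Suc)
qed

text \<open>Every seed whose three angles have no common factor is connected to a seed with angles
  \<open>\<alpha>\<close>, \<open>n \<alpha>\<close>, \<open>n \<alpha>\<close>. The first run of the Euclidean algorithm only produces \<open>g = gcd p q\<close>, which is
  prime to \<open>2 n + 1\<close> but need not be \<open>1\<close>. Growing from \<open>(g, 0)\<close> up to an acyclic seed and turning its
  triangle brings the third angle into play, which is \<open>2 n + 1\<close> modulo \<open>g\<close>; so the second run ends
  at \<open>1\<close>.\<close>

lemma state_connected:
  assumes s: "state i j m \<eta> p q s" and g: "gcd (gcd p q) (2 * n + 1) = 1"
  shows "\<exists>t i' j' m' \<eta>'. linked s t \<and> state i' j' m' \<eta>' 1 n t"
proof -
  have finish: "\<exists>t i' j' m'. linked s t \<and> state i' j' m' \<eta> 1 n t"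
    if s: "state i j m \<eta> p q s" "gcd p q = 1" for i j m \<eta> p q s
  proof -
    obtain t i' j' m' where t: "linked s t" "state i' j' m' \<eta> 1 0 t"
      using state_reduce[OF s(1)] s(2) by auto
    obtain u j'' m'' where "linked t u" "state i' j'' m'' \<eta> 1 n u"
      using state_grow[OF t(2), of n] by auto
    then show ?thesis
      using linked_trans[OF t(1)] by blast
  qed
  define g where "g = gcd p q"
  obtain t i' j' m' where t: "linked s t" "state i' j' m' \<eta> g 0 t"
    using state_reduce[OF s] g_def by auto
  \<comment> \<open>The largest multiple of \<open>g\<close> for which growing is possible; the seed reached is acyclic.\<close>
  define k where "k = n div g"
  have gn: "1 \<le> g" "g \<le> n"
    using stateD(5,6)[OF t(2)] by simp_all
  have kg: "k * g \<le> n" "n < g + k * g"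
    using gn by (simp_all add: k_def div_times_less_eq_dividend dividend_less_div_times)
  obtain u j'' m'' where u: "linked t u" "state i' j'' m'' \<eta> g (k * g) u"
    using state_grow[OF t(2) kg(1)] by auto
  have v: "state m'' i' j'' (- \<eta>) (2 * n + 1 - g - k * g) g (mutate pos i' u)"
    by (rule mutate_source_acyclic[OF u(2) kg(2)])
  have "2 * n + 1 = (2 * n + 1 - g - k * g) + (1 + k) * g"
    using gn kg by (simp add: algebra_simps)
  then have "gcd (2 * n + 1 - g - k * g) g = gcd (2 * n + 1) g"
    by (metis gcd_add_mult gcd.commute add.commute mult.commute)
  then have "gcd (2 * n + 1 - g - k * g) g = 1"
    using assms(2) by (simp add: g_def gcd.commute)
  from finish[OF v this] obtain w i3 j3 m3 where w: "linked (mutate pos i' u) w" "state i3 j3 m3 (- \<eta>) 1 n w"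
    by (elim exE conjE)
  have "linked s w"
    using t(1) u(1) linked_mutate w(1) linked_trans by metis
  then show ?thesis
    using w(2) by blast
qed

text \<open>Three mutations at sources return to the same side; an odd number of reflections has been
  applied, so the composition is a glide reflection along the belt.\<close>

lemma state_reflected:
  assumes s: "state i j m \<eta> p q s" "n < p + q"
  shows "\<exists>t. linked s t \<and> state i j m (- \<eta>) p q t"
proof -
  note d = stateD[OF s(1)]
  have a: "state m i j (- \<eta>) (2 * n + 1 - p - q) p (mutate pos i s)"
    by (rule mutate_source_acyclic[OF s])
  have b: "state j m i (- (- \<eta>)) (2 * n + 1 - (2 * n + 1 - p - q) - p) (2 * n + 1 - p - q)
      (mutate pos m (mutate pos i s))"
    using d(6,7) by (intro mutate_source_acyclic[OF a]) simp
  have c: "state i j m (- (- (- \<eta>))) (2 * n + 1 - (2 * n + 1 - (2 * n + 1 - p - q) - p) - (2 * n + 1 - p - q))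
     (2 * n + 1 - (2 * n + 1 - p - q) - p)  (mutate pos j (mutate pos m (mutate pos i s)))"
    using d(6,7) by (intro mutate_source_acyclic[OF b]) simp
  have "2 * n + 1 - (2 * n + 1 - (2 * n + 1 - p - q) - p) - (2 * n + 1 - p - q) = p"
    "2 * n + 1 - (2 * n + 1 - p - q) - p = q"
    using d(6,7) by simp_all
  then show ?thesis
    using c linked_mutate linked_trans by (metis minus_minus)
qed

lemma state_relabelled:
  assumes s: "state i j m \<eta> p q s" and "i' \<noteq> j'" "i' \<noteq> m'" "j' \<noteq> m'"
  shows "\<exists>\<sigma>. bij \<sigma> \<and> state i' j' m' \<eta> p q (relabel \<sigma> s)"
proof -
  obtain \<sigma> where "bij \<sigma>" "\<sigma> i' = i" "\<sigma> j' = j" "\<sigma> m' = m"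
    using index_bij[OF assms(2-4) stateD(1-3)[OF s]] by blast
  then show ?thesis
    using s state_relabel by metis
qed

text \<open>Both seeds are connected to copies of the initial one, and two such copies differ by a glide.
  Undoing this glide moves the given seed into the exchange graph.\<close>

lemma state_glides_into_component:
  assumes s0: "state i0 j0 m0 \<eta>0 1 n s0"
    and s: "state i j m \<eta> p q s" and "gcd (gcd p q) (2 * n + 1) = 1"
  obtains \<epsilon> \<tau> where "\<epsilon> = 1 \<or> \<epsilon> = -1" "linked s0 (act \<epsilon> \<tau> s)"
proof -
  obtain t i' j' m' \<eta>' where t: "linked s t" "state i' j' m' \<eta>' 1 n t"
    using state_connected[OF assms(2,3)] by blast
  obtain \<sigma> where \<sigma>: "bij \<sigma>" "state i0 j0 m0 \<eta>' 1 n (relabel \<sigma> t)"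
    using state_relabelled[OF t(2) stateD(1-3)[OF s0]] by blast
  obtain \<tau> where \<tau>: "relabel \<sigma> t = act (\<eta>0 * \<eta>') \<tau> s0"
    using state_glide[OF s0 \<sigma>(2)] by blast
  define \<epsilon> where "\<epsilon> = \<eta>0 * \<eta>'"
  have e: "\<epsilon> = 1 \<or> \<epsilon> = -1" "\<epsilon> * \<epsilon> = 1"
    using stateD(4)[OF s0] stateD(4)[OF t(2)] by (auto simp: \<epsilon>_def)
  have "linked s (act \<epsilon> \<tau> s0)"
    using t(1) linked_relabel[OF \<sigma>(1), of t] linked_trans \<tau> \<epsilon>_def by metis
  then have "linked (act \<epsilon> \<tau> s0) s"
    using s linked_sym is_state_def by blast
  then have "linked (act \<epsilon> (- \<tau>) (act \<epsilon> \<tau> s0)) (act \<epsilon> (- \<tau>) s)"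
    using e(1) by (rule linked_act)
  moreover have "act \<epsilon> (- \<tau>) (act \<epsilon> \<tau> s0) = s0"
    by (simp add: act_act[OF e(1) e(1)] e(2) act_id)
  ultimately show ?thesis
    using that e(1) by metis
qed

lemma component_reflected:
  assumes s0: "state i0 j0 m0 \<eta>0 1 n s0"
  obtains \<tau> where "linked s0 (act (-1) \<tau> s0)"
proof -
  obtain t where t: "linked s0 t" "state i0 j0 m0 (- \<eta>0) 1 n t"
    using state_reflected[OF s0] by auto
  obtain \<tau> where "t = act (\<eta>0 * - \<eta>0) \<tau> s0"
    using state_glide[OF s0 t(2)] by blast
  moreover have "\<eta>0 * - \<eta>0 = -1"
    using stateD(4)[OF s0] by auto
  ultimately show ?thesis
    using that t(1) by metis
qed

end

section \<open>The translation lattice\<close>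

lemma move_seed_of: "move \<phi> (seed_of s) = seed_of (push \<phi> \<circ> fst s, snd s)"
proof -
  have "(\<lambda>(v, B). (push \<phi> \<circ> v, B)) (relabel \<sigma> s) = relabel \<sigma> (push \<phi> \<circ> fst s, snd s)" for \<sigma>
    by (simp add: relabel_def comp_assoc)
  moreover have "seed_of t = (\<lambda>\<sigma>. relabel \<sigma> t) ` {\<sigma>. bij \<sigma>}" for t
    unfolding seed_of_relabel_eq by blast
  ultimately show ?thesis
    by (simp only: move_def image_image)
qed

context belt_frame
begin

lemma translation_eq_glide: "(\<lambda>x. x + \<tau> *\<^sub>R e) = glide 1 \<tau>"
proof
  fix x
  have "(x - ori) = ((x - ori) \<bullet> e) *\<^sub>R e + ((x - ori) \<bullet> f) *\<^sub>R f"
    by (rule expand)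
  moreover have "glide 1 \<tau> x = ori + (((x - ori) \<bullet> e) *\<^sub>R e + ((x - ori) \<bullet> f) *\<^sub>R f) + \<tau> *\<^sub>R e"
    by (simp add: glide_def scaleR_add_left)
  ultimately show "x + \<tau> *\<^sub>R e = glide 1 \<tau> x"
    by simp
qed

lemma translate_seed_of: "translate (\<tau> *\<^sub>R e) (seed_of s) = seed_of (act 1 \<tau> s)"
  unfolding move_seed_of translation_eq_glide act_def ..

lemma coords_push_translation:
  "cx (push (\<lambda>x. x + w) g) = cx g" "cy (push (\<lambda>x. x + w) g) = cy g"
  "cd (push (\<lambda>x. x + w) g) = cd g - (cx g * (w \<bullet> e) + cy g * (w \<bullet> f))"
proof -
  have "fst g \<bullet> w = ((fst g \<bullet> e) *\<^sub>R e + (fst g \<bullet> f) *\<^sub>R f) \<bullet> w"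
    by (simp only: expand[symmetric])
  then have "fst g \<bullet> w = (fst g \<bullet> e) * (w \<bullet> e) + (fst g \<bullet> f) * (w \<bullet> f)"
    unfolding inner_add_left inner_scaleR_left inner_commute[of w] .
  then show "cx (push (\<lambda>x. x + w) g) = cx g" "cy (push (\<lambda>x. x + w) g) = cy g"
    "cd (push (\<lambda>x. x + w) g) = cd g - (cx g * (w \<bullet> e) + cy g * (w \<bullet> f))"
    by (simp_all add: push_def Let_def cx_def cy_def cd_def eval_def diff_divide_distrib add_divide_distrib)
qed

text \<open>The kernel combination of the vectors is the same multiple of the second coordinate for both
  seeds. A translation changes it by the component of \<open>w\<close> orthogonal to the belt line.\<close>

lemma translation_along_belt:
  assumes "is_state s" "is_state (push (\<lambda>x. x + w) \<circ> fst s, snd s)"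
  shows "w = (w \<bullet> e) *\<^sub>R e"
proof -
  obtain i j m \<eta> p q where s: "state i j m \<eta> p q s"
    using assms(1) by (auto simp: is_state_def)
  obtain i' j' m' \<eta>' p' q' where t': "state i' j' m' \<eta>' p' q' (push (\<lambda>x. x + w) \<circ> fst s, snd s)"
    using assms(2) by (auto simp: is_state_def)
  then have t: "state i j m \<eta>' p q (push (\<lambda>x. x + w) \<circ> fst s, snd s)"
    using state_quiver_determines[OF s t'] by simp
  define a b where "a = real p * \<alpha>" and "b = real q * \<alpha>"
  note d = stateD[OF s, folded a_def b_def] and d' = stateD[OF t, folded a_def b_def]
  have c: "cd (push (\<lambda>x. x + w) (fst s i)) = cd (fst s i) + sin a * (w \<bullet> e) - \<eta> * cos a * (w \<bullet> f)"
     "cd (push (\<lambda>x. x + w) (fst s j)) = cd (fst s j) - sin b * (w \<bullet> e) - \<eta> * cos b * (w \<bullet> f)"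
     "cd (push (\<lambda>x. x + w) (fst s m)) = cd (fst s m) - sin (a - b) * (w \<bullet> e) + \<eta> * cos (a - b) * (w \<bullet> f)"
    unfolding coords_push_translation d by simp_all
  have "cos a * cd (push (\<lambda>x. x + w) (fst s i)) + cos b * cd (push (\<lambda>x. x + w) (fst s j))
      + cos (a + b) * cd (push (\<lambda>x. x + w) (fst s m))
    = (cos a * cd (fst s i) + cos b * cd (fst s j) + cos (a + b) * cd (fst s m))
      + (w \<bullet> e) * (cos a * sin a - cos b * sin b - cos (a + b) * sin (a - b))
      - \<eta> * (w \<bullet> f) * (cos a * cos a + cos b * cos b - cos (a + b) * cos (a - b))"
    unfolding c by (simp add: algebra_simps)
  moreover have "cos a * cd (push (\<lambda>x. x + w) (fst s i)) + cos b * cd (push (\<lambda>x. x + w) (fst s j))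
      + cos (a + b) * cd (push (\<lambda>x. x + w) (fst s m)) = 0"
    using d'(16) by simp
  ultimately have "\<eta> * (w \<bullet> f) * (cos a * cos a + cos b * cos b - cos (a + b) * cos (a - b)) = 0"
    unfolding d(16) sum_difference_products(2) by simp
  moreover have "cos a * cos a + cos b * cos b - cos (a + b) * cos (a - b) = 1"
    unfolding sum_difference_products(4) using sin_cos_squared_add3[of b] by simp
  ultimately have "w \<bullet> f = 0"
    using d(4) by auto
  then show ?thesis
    using expand[of w] by simp
qed

lemma is_state_act:
  assumes "is_state s" "\<epsilon> = 1 \<or> \<epsilon> = -1"
  shows "is_state (act \<epsilon> \<tau> s)"
  using assms state_act unfolding is_state_def by metis

text \<open>The translations along the belt line that preserve the exchange graph.\<close>

definition translation_group :: "labelled_seed \<Rightarrow> real set" where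
  "translation_group s0 = {\<tau>. linked s0 (act 1 \<tau> s0)}"

text \<open>As glides are automorphisms of the mutation rule, a translation that maps one seed of the
  graph into the graph preserves the whole graph.\<close>

lemma linked_act_iff_translation_group:
  assumes "is_state s0" "linked s0 s"
  shows "linked s0 (act 1 \<tau> s) \<longleftrightarrow> \<tau> \<in> translation_group s0"
proof -
  have l: "linked (act 1 \<tau> s0) (act 1 \<tau> s)"
    using assms(2) by (rule linked_act) simp
  have "is_state (act 1 \<tau> s0)"
    using assms(1) by (rule is_state_act) simp
  with l have "linked (act 1 \<tau> s) (act 1 \<tau> s0)"
    by (rule linked_sym)
  then show ?thesis
    unfolding translation_group_def mem_Collect_eq
    using l by (intro iffI) (rule linked_trans, assumption, assumption)+
qed

lemma translation_group_zero: "0 \<in> translation_group s0"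
  by (simp add: translation_group_def act_id linked_refl)

lemma translation_group_add:
  assumes "is_state s0" "\<tau> \<in> translation_group s0" "\<tau>' \<in> translation_group s0"
  shows "\<tau> + \<tau>' \<in> translation_group s0"
proof -
  have "linked s0 (act 1 \<tau>' s0)"
    using assms(3) by (simp add: translation_group_def)
  then have "linked s0 (act 1 \<tau> (act 1 \<tau>' s0))"
    using linked_act_iff_translation_group[OF assms(1)] assms(2) by blast
  then show ?thesis
    by (simp add: translation_group_def act_act)
qed

lemma translation_group_uminus:
  assumes "is_state s0" "\<tau> \<in> translation_group s0"
  shows "- \<tau> \<in> translation_group s0"
proof -
  have "linked (act 1 (- \<tau>) s0) (act 1 (- \<tau>) (act 1 \<tau> s0))"
    using assms(2) by (intro linked_act) (simp_all add: translation_group_def)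
  then have "linked (act 1 (- \<tau>) s0) s0"
    by (simp add: act_act act_id)
  then show ?thesis
    using linked_sym is_state_act[OF assms(1)] by (simp add: translation_group_def)
qed

lemma translation_in_graph:
  assumes "is_state s0" "S \<in> fst (exchange_graph pos s0)" "translate w S \<in> fst (exchange_graph pos s0)"
  obtains \<tau> where "\<tau> \<in> translation_group s0" "w = \<tau> *\<^sub>R e"
proof -
  obtain s where s: "S = seed_of s"
    using assms(2) by (auto simp: exchange_graph_def)
  have l: "linked s0 s" "linked s0 (push (\<lambda>x. x + w) \<circ> fst s, snd s)"
    using assms(2,3) unfolding s move_seed_of seed_of_in_graph_iff .
  have "is_state s" "is_state (push (\<lambda>x. x + w) \<circ> fst s, snd s)"
    using l linked_is_state assms(1) by blast+
  then have w: "w = (w \<bullet> e) *\<^sub>R e"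
    by (rule translation_along_belt)
  have "linked s0 (act 1 (w \<bullet> e) s)"
    using assms(3) unfolding s by (subst (asm) w, unfold translate_seed_of seed_of_in_graph_iff)
  then show ?thesis
    using that w linked_act_iff_translation_group[OF assms(1) l(1)] by blast
qed

lemma translate_in_graph_iff:
  assumes "is_state s0" "S \<in> fst (exchange_graph pos s0)"
  shows "translate (\<tau> *\<^sub>R e) S \<in> fst (exchange_graph pos s0) \<longleftrightarrow> \<tau> \<in> translation_group s0"
proof -
  obtain s where s: "S = seed_of s"
    using assms(2) by (auto simp: exchange_graph_def)
  show ?thesis
    using assms(2) unfolding s translate_seed_of seed_of_in_graph_iff
    by (rule linked_act_iff_translation_group[OF assms(1)])
qed

text \<open>The translations between seeds already form a group that is stable under inversion. Hence
  passing to their lengths and to the span of these does not enlarge it.\<close>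

lemma translation_lengths_eq:
  assumes "is_state s0"
  shows "translation_lengths (exchange_graph pos s0) = translation_group s0"
proof -
  let ?G = "exchange_graph pos s0"
  interpret Z: module "\<lambda>k :: int. (*) (of_int k) :: real \<Rightarrow> real"
    by unfold_locales (simp_all add: algebra_simps)
  have ne: "norm (\<tau> *\<^sub>R e) = \<bar>\<tau>\<bar>" for \<tau>
    using ee by (simp add: norm_eq_sqrt_inner)
  define W where "W = {w. \<exists>S\<in>fst ?G. \<exists>S'\<in>fst ?G. S' = translate w S}"
  have W: "W = (\<lambda>\<tau>. \<tau> *\<^sub>R e) ` translation_group s0"
  proof (intro equalityI subsetI)
    fix w
    assume "w \<in> W"
    then obtain S where "S \<in> fst ?G" "translate w S \<in> fst ?G"
      unfolding W_def by blast
    then show "w \<in> (\<lambda>\<tau>. \<tau> *\<^sub>R e) ` translation_group s0"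
      using translation_in_graph[OF assms] by blast
  next
    fix w
    assume "w \<in> (\<lambda>\<tau>. \<tau> *\<^sub>R e) ` translation_group s0"
    then obtain \<tau> where \<tau>: "\<tau> \<in> translation_group s0" "w = \<tau> *\<^sub>R e"
      by blast
    have S: "seed_of s0 \<in> fst ?G"
      unfolding seed_of_in_graph_iff by (rule linked_refl)
    then have "translate w (seed_of s0) \<in> fst ?G"
      using translate_in_graph_iff[OF assms S] \<tau> by blast
    then show "w \<in> W"
      using S unfolding W_def by blast
  qed
  have times: "of_int k * \<tau> \<in> translation_group s0" if \<tau>: "\<tau> \<in> translation_group s0" for k :: int and \<tau>
  proof (induction k rule: int_induct[where k = 0])
    case base
    show ?case by (simp add: translation_group_zero)
  next
    case (step1 k)
    then show ?case
      using translation_group_add[OF assms step1(2) \<tau>] by (simp add: algebra_simps)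
  next
    case (step2 k)
    then show ?case
      using translation_group_add[OF assms step2(2) translation_group_uminus[OF assms \<tau>]] by (simp add: algebra_simps)
  qed
  \<comment> \<open>Over the integers, submodules are subgroups.\<close>
  have "Z.subspace (translation_group s0)"
    unfolding Z.subspace_def
    by (intro conjI ballI allI translation_group_zero translation_group_add[OF assms] times)
  moreover have "norm ` W \<subseteq> translation_group s0"
  proof -
    have "\<bar>\<tau>\<bar> \<in> translation_group s0" if "\<tau> \<in> translation_group s0" for \<tau>
      using that translation_group_uminus[OF assms that] by (cases "0 \<le> \<tau>") simp_all
    then show ?thesis
      unfolding W image_image ne by blast
  qed
  ultimately have "Z.span (norm ` W) \<subseteq> translation_group s0"
    by (intro Z.span_minimal)
  moreover have "\<tau> \<in> Z.span (norm ` W)" if "\<tau> \<in> translation_group s0" for \<tau>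
  proof -
    have "\<bar>\<tau>\<bar> \<in> Z.span (norm ` W)"
      using that unfolding W image_image ne by (intro Z.span_base) blast
    then show ?thesis
      using Z.span_neg[of "\<bar>\<tau>\<bar>" "norm ` W"] by (cases "0 \<le> \<tau>") simp_all
  qed
  ultimately show ?thesis
    unfolding translation_lengths_def W_def by blast
qed

section \<open>The acyclic belt\<close>

lemma state_relabel_iff:
  assumes "bij \<sigma>"
  shows "state i j m \<eta> p q (relabel \<sigma> s) \<longleftrightarrow> state (\<sigma> i) (\<sigma> j) (\<sigma> m) \<eta> p q s"
proof
  have inv: "inv \<sigma> (\<sigma> x) = x" for x
    using assms by (simp add: bij_is_inj)
  assume "state i j m \<eta> p q (relabel \<sigma> s)"
  then have "state (\<sigma> i) (\<sigma> j) (\<sigma> m) \<eta> p q (relabel (inv \<sigma>) (relabel \<sigma> s))"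
    using state_relabel[of "inv \<sigma>" "\<sigma> i" "\<sigma> j" "\<sigma> m" \<eta> p q "relabel \<sigma> s"] by (simp only: inv)
  then show "state (\<sigma> i) (\<sigma> j) (\<sigma> m) \<eta> p q s"
    by (simp only: relabel_bij_inverse(1)[OF assms])
qed (rule state_relabel)

text \<open>The position of an acyclic seed along the belt line: the coordinate of the point where the
  line of the source crosses the belt.\<close>

definition front :: "real \<Rightarrow> seed \<Rightarrow> bool" where
  "front x S \<longleftrightarrow> (\<exists>s i j m \<eta> p q. S = seed_of s \<and> state i j m \<eta> p q s \<and> n < p + q \<and>
     x = cd (fst s i) / sin (real p * \<alpha>))"

text \<open>The position does not depend on the labelling, because the quiver singles out the source.\<close>

lemma front_of_state:
  assumes "front x (seed_of t)" and t: "state i j m \<eta> p q t"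
  shows "n < p + q" "x = cd (fst t i) / sin (real p * \<alpha>)"
proof -
  obtain s i' j' m' \<eta>' p' q' where s: "seed_of t = seed_of s" "state i' j' m' \<eta>' p' q' s" "n < p' + q'"
     "x = cd (fst s i') / sin (real p' * \<alpha>)"
    using assms(1) unfolding front_def by blast
  obtain \<sigma> where \<sigma>: "bij \<sigma>" "s = relabel \<sigma> t"
    using seed_of_eqD[OF s(1)] by blast
  have t': "state (\<sigma> i') (\<sigma> j') (\<sigma> m') \<eta>' p' q' t"
    using s(2) unfolding \<sigma>(2) state_relabel_iff[OF \<sigma>(1)] .
  note u = state_quiver_determines[OF t' t refl]
  show "n < p + q" "x = cd (fst t i) / sin (real p * \<alpha>)"
    using s(3,4) u by (simp_all add: \<sigma>(2) relabel_fst)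
qed

text \<open>In an acyclic triangle, the belt line meets the source before the sink. The determinant
  that compares the two crossing points is \<open>K * cos ((p + q) * \<alpha>)\<close>.\<close>

lemma source_before_sink:
  assumes "state i j m \<eta> p q s" "n < p + q"
  shows "cd (fst s i) / sin (real p * \<alpha>) < - cd (fst s j) / sin (real q * \<alpha>)"
proof -
  define a b where "a = real p * \<alpha>" and "b = real q * \<alpha>"
  note d = stateD[OF assms(1), folded a_def b_def]
  have "1 \<le> q"
    using d(6) assms(2) by linarith
  then have s: "0 < sin a" "0 < sin b"
    using sin_pos d by (simp_all add: a_def b_def)
  have "cos (a + b) < 0"
    using cos_neg[OF assms(2)] d(6,7) by (simp add: a_def b_def distrib_right)
  then have K: "K * cos (a + b) < 0"
    using K by (simp add: mult_pos_neg)
  have "sin (a + b) * cos a - cos (a + b) * sin a = sin b" "sin (a + b) * cos b - cos (a + b) * sin b = sin a"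
    using sin_diff[of "a + b" a] sin_diff[of "a + b" b] by simp_all
  then have "cd (fst s i) * sin b + cd (fst s j) * sin a
    = cd (fst s i) * (sin (a + b) * cos a - cos (a + b) * sin a)
      + cd (fst s j) * (sin (a + b) * cos b - cos (a + b) * sin b)"
    by simp
  also have "\<dots> = sin (a + b) * (cos a * cd (fst s i) + cos b * cd (fst s j) + cos (a + b) * cd (fst s m))
      - cos (a + b) * (sin a * cd (fst s i) + sin b * cd (fst s j) + sin (a + b) * cd (fst s m))"
    by (simp add: algebra_simps)
  also have "\<dots> = K * cos (a + b)"
    unfolding d(15,16) by simp
  finally have "cd (fst s i) * sin b + cd (fst s j) * sin a < 0"
    using K by simp
  then show ?thesis
    using s unfolding a_def[symmetric] b_def[symmetric] by (simp add: field_simps)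
qed

text \<open>Bi-infinite paths of acyclic seeds obtained by mutating at the source. Unlike the definition
  of the belt, this keeps the labelled seeds of the path inside one exchange graph and in normal form.\<close>

definition source_path :: "labelled_seed \<Rightarrow> (int \<Rightarrow> seed) \<Rightarrow> bool" where
  "source_path s0 J \<longleftrightarrow> (\<forall>l. \<exists>s i j m \<eta> p q. linked s0 s \<and> state i j m \<eta> p q s \<and> n < p + q \<and>
     J l = seed_of s \<and> J (l + 1) = seed_of (mutate pos i s))"

text \<open>The source of a seed is the sink of the next one, whose own source lies before its sink. So the
  position decreases strictly along the belt.\<close>

lemma front_mutate_source:
  assumes "state i j m \<eta> p q s" "n < p + q"
  obtains x x' where "front x (seed_of s)" "front x' (seed_of (mutate pos i s))" "x' < x"
proof -
  note d = stateD[OF assms(1)]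
  have t: "state m i j (- \<eta>) (2 * n + 1 - p - q) p (mutate pos i s)"
    by (rule mutate_source_acyclic[OF assms])
  have t': "n < 2 * n + 1 - p - q + p"
    using d(6,7) by simp
  have "front (cd (fst s i) / sin (real p * \<alpha>)) (seed_of s)"
    unfolding front_def using assms by blast
  moreover have "front (cd (fst (mutate pos i s) m) / sin (real (2 * n + 1 - p - q) * \<alpha>)) (seed_of (mutate pos i s))"
    unfolding front_def using t t' by blast
  moreover have "cd (fst (mutate pos i s) m) / sin (real (2 * n + 1 - p - q) * \<alpha>) < cd (fst s i) / sin (real p * \<alpha>)"
    using source_before_sink[OF t t'] by (simp add: mutate_fst)
  ultimately show ?thesis
    using that by blast
qed

lemma source_path_front:
  assumes "source_path s0 J"
  obtains x where "\<And>l. front (x l) (J l)" "\<And>l. x (l + 1) < x l"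
proof -
  have "\<exists>x. front x (J l)" for l
    using assms front_mutate_source unfolding source_path_def by metis
  then obtain x where x: "\<And>l. front (x l) (J l)"
    by metis
  have "x (l + 1) < x l" for l
  proof -
    obtain s i j m \<eta> p q where s: "linked s0 s" "state i j m \<eta> p q s" "n < p + q"
      "J l = seed_of s" "J (l + 1) = seed_of (mutate pos i s)"
      using assms unfolding source_path_def by metis
    obtain y y' where y: "front y (seed_of s)" "front y' (seed_of (mutate pos i s))" "y' < y"
      using front_mutate_source[OF s(2,3)] by blast
    have "y = x l"
      using front_of_state(2)[OF y(1) s(2)] front_of_state(2)[OF x[of l, unfolded s(4)] s(2)] by simp
    moreover have "y' = x (l + 1)"
      using front_of_state(2)[OF y(2) mutate_source_acyclic[OF s(2,3)]]
        front_of_state(2)[OF x[of "l + 1", unfolded s(5)] mutate_source_acyclic[OF s(2,3)]] by simp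
    ultimately show ?thesis
      using y(3) by simp
  qed
  then show ?thesis
    using that x by blast
qed

lemma source_path_inj:
  assumes "source_path s0 J"
  shows "inj J"
proof -
  obtain x where x: "\<And>l. front (x l) (J l)" "\<And>l. x (l + 1) < x l"
    using source_path_front[OF assms] by blast
  have less: "x l < x k" if "k < l" for k l
    using that x(2) by (induction l rule: int_gr_induct) (auto intro: less_trans)
  have "x k = x l" if "J k = J l" for k l
  proof -
    obtain s i j m \<eta> p q where s: "state i j m \<eta> p q s" "J k = seed_of s"
      using assms unfolding source_path_def by metis
    show ?thesis
      using front_of_state(2)[OF x(1)[of k, unfolded s(2)] s(1)]
        front_of_state(2)[OF x(1)[of l, folded that, unfolded s(2)] s(1)] by simp
  qed
  then show ?thesis
    using less by (intro injI) (metis less_irrefl linorder_neqE)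
qed

lemma edge_in_graph:
  assumes "linked s0 t"
  shows "{seed_of t, seed_of (mutate pos k t)} \<in> snd (exchange_graph pos s0)"
proof -
  obtain t0 where t0: "mutation_equivalent pos s0 t0" "seed_of t = seed_of t0"
    using assms unfolding seed_of_in_graph_iff[symmetric] exchange_graph_def fst_conv by blast
  obtain \<sigma> where \<sigma>: "bij \<sigma>" "t = relabel \<sigma> t0"
    using seed_of_eqD[OF t0(2)[symmetric]] by blast
  have "seed_of (mutate pos k t) = seed_of (mutate pos (\<sigma> k) t0)"
    unfolding \<sigma>(2) mutate_relabel[OF \<sigma>(1)] by (rule seed_of_relabel[OF \<sigma>(1)])
  then have "{seed_of t, seed_of (mutate pos k t)} = {seed_of t0, seed_of (mutate pos (\<sigma> k) t0)}"
    by (simp only: t0(2))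
  then show ?thesis
    using t0(1) unfolding exchange_graph_def snd_conv by blast
qed

text \<open>An acyclic seed has three neighbours. Those at the source and the sink are its neighbours on
  the belt; the one at the middle vertex is cyclic and does not lie on the belt.\<close>

lemma source_path_full:
  assumes J: "source_path s0 J" and s0: "is_state s0"
  shows "full_subgraph (path_graph J) (exchange_graph pos s0)"
proof -
  let ?G = "exchange_graph pos s0"
  have V: "range J \<subseteq> fst ?G"
  proof
    fix S assume "S \<in> range J"
    then obtain l where "S = J l" by blast
    then obtain s where "linked s0 s" "S = seed_of s"
      using J unfolding source_path_def by metis
    then show "S \<in> fst ?G"
      by (simp add: seed_of_in_graph_iff)
  qed
  have sub: "{J l, J (l + 1)} \<in> snd ?G" for l
    using J edge_in_graph unfolding source_path_def by metis
  have "\<exists>l. E = {J l, J (l + 1)}" if E: "E \<in> snd ?G" "E \<subseteq> range J" for E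
  proof -
    obtain s k where s: "mutation_equivalent pos s0 s" "E = {seed_of s, seed_of (mutate pos k s)}"
      using E(1) unfolding exchange_graph_def snd_conv by blast
    obtain x where x: "\<And>l. front (x l) (J l)" "\<And>l. x (l + 1) < x l"
      using source_path_front[OF J] by blast
    have "seed_of s \<in> range J" "seed_of (mutate pos k s) \<in> range J"
      using E(2) by (simp_all add: s(2))
    then obtain l l' where l: "seed_of s = J l" "seed_of (mutate pos k s) = J l'"
      by (elim rangeE)
    obtain s1 i1 j1 m1 \<eta>1 p1 q1 where s1: "linked s0 s1" "state i1 j1 m1 \<eta>1 p1 q1 s1" "n < p1 + q1"
      "J l = seed_of s1" "J (l + 1) = seed_of (mutate pos i1 s1)"
      using J unfolding source_path_def by metis
    obtain \<sigma> where \<sigma>: "bij \<sigma>" "s1 = relabel \<sigma> s"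
      using seed_of_eqD[of s s1] l(1) s1(4) by auto
    define i j m where "i = \<sigma> i1" and "j = \<sigma> j1" and "m = \<sigma> m1"
    have st: "state i j m \<eta>1 p1 q1 s"
      using s1(2) unfolding \<sigma>(2) state_relabel_iff[OF \<sigma>(1)] i_def j_def m_def .
    consider "k = i" | "k = j" | "k = m"
      using index_cases[OF stateD(1-3)[OF st], of k] by blast
    then show ?thesis
    proof cases
      case 1
      have "seed_of (mutate pos i1 s1) = seed_of (mutate pos i s)"
        unfolding \<sigma>(2) mutate_relabel[OF \<sigma>(1)] i_def by (rule seed_of_relabel[OF \<sigma>(1)])
      then have "E = {J l, J (l + 1)}"
        using s(2) l(1) s1(5) 1 by simp
      then show ?thesis ..
    next
      case 2
      obtain s2 i2 j2 m2 \<eta>2 p2 q2 where s2: "linked s0 s2" "state i2 j2 m2 \<eta>2 p2 q2 s2" "n < p2 + q2"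
        "J (l - 1) = seed_of s2" "J (l - 1 + 1) = seed_of (mutate pos i2 s2)"
        using J unfolding source_path_def by metis
      have t: "state m2 i2 j2 (- \<eta>2) (2 * n + 1 - p2 - q2) p2 (mutate pos i2 s2)"
        by (rule mutate_source_acyclic[OF s2(2,3)])
      have "seed_of (mutate pos i2 s2) = seed_of s"
        using s2(5) l(1) by simp
      then obtain \<tau> where \<tau>: "bij \<tau>" "s = relabel \<tau> (mutate pos i2 s2)"
        using seed_of_eqD by blast
      have "state (\<tau> i) (\<tau> j) (\<tau> m) \<eta>1 p1 q1 (mutate pos i2 s2)"
        using st unfolding \<tau>(2) state_relabel_iff[OF \<tau>(1)] .
      then have "\<tau> j = i2"
        using state_quiver_determines[OF _ t refl] by blast
      then have "mutate pos j s = relabel \<tau> (mutate pos i2 (mutate pos i2 s2))"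
        unfolding \<tau>(2) mutate_relabel[OF \<tau>(1)] by simp
      also have "mutate pos i2 (mutate pos i2 s2) = s2"
        by (rule mutate_mutate[OF state_forms(4)[OF s2(2)] pos_uminus_state[OF s2(2)]])
      finally have "seed_of (mutate pos j s) = J (l - 1)"
        using s2(4) by (simp add: seed_of_relabel[OF \<tau>(1)])
      then have "E = {J (l - 1), J (l - 1 + 1)}"
        using s(2) l(1) 2 by auto
      then show ?thesis ..
    next
      case 3
      have f: "front (x l') (seed_of (mutate pos m s))"
        using x(1)[of l'] l(2) 3 by simp
      have False
      proof (cases "p1 \<le> q1")
        case True
        then show False
          using front_of_state(1)[OF f mutate_middle_le[OF st True]] stateD(7)[OF st] by simp
      next
        case False
        then show False
          using front_of_state(1)[OF f mutate_middle_gt[OF st]] stateD(6)[OF st] by simp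
      qed
      then show ?thesis ..
    qed
  qed
  then have "snd (path_graph J) = {E \<in> snd ?G. E \<subseteq> fst (path_graph J)}"
    using sub unfolding path_graph_def fst_conv snd_conv by fast
  then show ?thesis
    using V unfolding full_subgraph_def path_graph_def by simp
qed

lemma source_path_translate:
  assumes J: "source_path s0 J" and s0: "is_state s0" and "\<tau> \<in> translation_group s0"
  shows "source_path s0 (\<lambda>l. translate (\<tau> *\<^sub>R e) (J l))"
  unfolding source_path_def
proof
  fix l
  obtain s i j m \<eta> p q where s: "linked s0 s" "state i j m \<eta> p q s" "n < p + q"
      "J l = seed_of s" "J (l + 1) = seed_of (mutate pos i s)"
    using J unfolding source_path_def by metis
  have "linked s0 (act 1 \<tau> s)"
    using linked_act_iff_translation_group[OF s0 s(1)] assms(3) by blast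
  moreover have "state i j m (1 * \<eta>) p q (act 1 \<tau> s)"
    by (rule state_act[OF s(2)]) simp
  moreover have "translate (\<tau> *\<^sub>R e) (J (l + 1)) = seed_of (mutate pos i (act 1 \<tau> s))"
    by (simp add: s(5) translate_seed_of act_mutate)
  ultimately show "\<exists>s i j m \<eta> p q. linked s0 s \<and> state i j m \<eta> p q s \<and> n < p + q \<and>
     translate (\<tau> *\<^sub>R e) (J l) = seed_of s \<and> translate (\<tau> *\<^sub>R e) (J (l + 1)) = seed_of (mutate pos i s)"
    using s(3,4) translate_seed_of by metis
qed

lemma source_unique:
  assumes "state i j m \<eta> p q s" "n < p + q" "is_source (snd s) k"
  shows "k = i"
proof -
  have "\<not> 0 < snd s $ i $ k" "\<not> 0 < snd s $ m $ k"
    using assms(3) by (simp_all add: is_source_def not_less)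
  then show ?thesis
    using state_weights[OF assms(1)] assms(2) index_cases[OF stateD(1-3)[OF assms(1)], of k] by blast
qed

text \<open>Forwards along the belt, the seeds are in normal form because mutations preserve it.
  Backwards, a seed \<open>(v, B)\<close> is known only through its mutation at a source; this vertex is a sink of the
  mutated seed, and mutating there recovers \<open>(v, B)\<close>.\<close>

lemma source_path_acyclic_belt:
  assumes belt: "acyclic_belt pos s0 I" and s0: "state i0 j0 m0 \<eta>0 p0 q0 s0" "n < p0 + q0"
  shows "source_path s0 I"
proof -
  define P where "P l \<longleftrightarrow> (\<exists>s i j m \<eta> p q. I l = seed_of s \<and> linked s0 s \<and> state i j m \<eta> p q s \<and> n < p + q)" for l
  have next_seed: "\<exists>s i j m \<eta> p q. linked s0 s \<and> state i j m \<eta> p q s \<and> n < p + q \<and>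
     I l = seed_of s \<and> I (l + 1) = seed_of (mutate pos i s)" if "P l" for l
  proof -
    obtain s i j m \<eta> p q where s: "I l = seed_of s" "linked s0 s" "state i j m \<eta> p q s" "n < p + q"
      using \<open>P l\<close> unfolding P_def by blast
    obtain v B k where k: "is_source B k" "I l = seed_of (v, B)" "I (l + 1) = seed_of (mutate pos k (v, B))"
      using belt unfolding acyclic_belt_def by metis
    obtain \<sigma> where \<sigma>: "bij \<sigma>" "s = relabel \<sigma> (v, B)"
      using seed_of_eqD[of "(v, B)" s] k(2) s(1) by auto
    have st: "state (\<sigma> i) (\<sigma> j) (\<sigma> m) \<eta> p q (v, B)"
      using s(3) unfolding \<sigma>(2) state_relabel_iff[OF \<sigma>(1)] .
    have "k = \<sigma> i"
      using source_unique[OF st s(4)] k(1) by simp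
    moreover have "linked s0 (v, B)"
      using k(2) s(1,2) seed_of_in_graph_iff by metis
    ultimately show ?thesis
      using st s(4) k(2,3) by blast
  qed
  have up: "P (l + 1)" if "P l" for l
  proof -
    obtain s i j m \<eta> p q where s: "linked s0 s" "state i j m \<eta> p q s" "n < p + q"
     "I l = seed_of s" "I (l + 1) = seed_of (mutate pos i s)"
      using next_seed[OF \<open>P l\<close>] by blast
    have "state m i j (- \<eta>) (2 * n + 1 - p - q) p (mutate pos i s)"
      by (rule mutate_source_acyclic[OF s(2,3)])
    moreover have "n < 2 * n + 1 - p - q + p"
      using stateD(6,7)[OF s(2)] by simp
    moreover have "linked s0 (mutate pos i s)"
      using s(1) linked_mutate linked_trans by blast
    ultimately show ?thesis
      unfolding P_def using s(5) by blast
  qed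
  have down: "P (l - 1)" if "P l" for l
  proof -
    obtain s i j m \<eta> p q where s: "I l = seed_of s" "linked s0 s" "state i j m \<eta> p q s" "n < p + q"
      using \<open>P l\<close> unfolding P_def by blast
    obtain v B k where k: "geometric_realisation v B" "is_source B k" "I (l - 1) = seed_of (v, B)"
      "I (l - 1 + 1) = seed_of (mutate pos k (v, B))"
      using belt unfolding acyclic_belt_def by metis
    define t where "t = mutate pos k (v, B)"
    have "seed_of t = seed_of s"
      using k(4) s(1) by (simp add: t_def)
    then obtain \<sigma> where \<sigma>: "bij \<sigma>" "s = relabel \<sigma> t"
      using seed_of_eqD by blast
    have t: "state (\<sigma> i) (\<sigma> j) (\<sigma> m) \<eta> p q t"
      using s(3) unfolding \<sigma>(2) state_relabel_iff[OF \<sigma>(1)] .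
    have lt: "linked s0 t"
      using s(1,2) \<open>seed_of t = seed_of s\<close> seed_of_in_graph_iff by metis
    have "0 \<le> snd t $ x $ k" for x
      using k(2) by (simp add: t_def mutate_snd mutate_matrix_def is_source_def)
    then have "k = \<sigma> j"
      using index_cases[OF stateD(1-3)[OF t], of k] skew[OF t] state_weights[OF t] s(4)
      by (metis neg_less_0_iff_less not_less)
    have vk: "v k = - fst t k"
      by (simp add: t_def mutate_fst)
    have "mutate pos k t = (v, B)"
      unfolding t_def
    proof (rule mutate_mutate)
      show "form (fst (v, B) k) (fst (v, B) k) = 2"
        using k(1) by (simp add: geometric_realisation_def)
      show "pos (- fst (v, B) k) \<longleftrightarrow> \<not> pos (fst (v, B) k)"
        using state_pos(3,4)[OF t, folded \<open>k = \<sigma> j\<close>] by (simp add: vk)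
    qed
    then have "state (\<sigma> j) (\<sigma> m) (\<sigma> i) (- \<eta>) q (2 * n + 1 - p - q) (v, B)"
      using mutate_sink_acyclic[OF t s(4)] by (simp add: \<open>k = \<sigma> j\<close>)
    moreover have "n < q + (2 * n + 1 - p - q)"
      using stateD(6,7)[OF t] by simp
    moreover have "linked s0 (v, B)"
      using lt linked_mutate[of t k] linked_trans \<open>mutate pos k t = (v, B)\<close> by metis
    ultimately show ?thesis
      unfolding P_def using k(3) by blast
  qed
  have "P 0"
    using belt s0 linked_refl unfolding P_def acyclic_belt_def by blast
  then have "P l" for l
    using up down by (induction l rule: int_induct[where k = 0]) blast+
  then show ?thesis
    unfolding source_path_def using next_seed by blast
qed

end

section \<open>Angles and the invariant \<open>T\<close>\<close>

lemma three_index_simps: "(i::3) + 1 \<noteq> i" "i + 2 \<noteq> i" "i + 1 \<noteq> i + 2" "i + 1 + 1 = i + 2" "i + 1 + 2 = i" "i + 2 + 1 = i" "i + 2 + 2 = i + 1"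
  using exhaust_3[of i] by auto

lemma all_three: "(\<forall>j::3. P j) \<longleftrightarrow> P i \<and> P (i + 1) \<and> P (i + 2)"
  using index_cases[of i "i + 1" "i + 2"] three_index_simps(1-3)[of i] by metis

lemma sum_three: "(\<Sum>j\<in>(UNIV::3 set). g j) = g i + g (i + 1) + (g (i + 2) :: 'a::comm_monoid_add)"
proof -
  have UNIV_eq: "(UNIV::3 set) = {i, i + 1, i + 2}"
    using index_cases[of i "i + 1" "i + 2"] three_index_simps(1-3)[of i] by auto
  show ?thesis
    unfolding UNIV_eq using three_index_simps(1-3)[of i] three_index_simps(1-3)[of i, symmetric]
    by (simp add: add.assoc)
qed

lemma form_interior_angle:
  assumes "form f f = 2" "form g g = 2"
  shows "form f g = - 2 * cos (interior_angle f g)"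
proof -
  have "\<bar>form f g\<bar> \<le> norm (fst f) * norm (fst g)"
    unfolding form_def by (rule Cauchy_Schwarz_ineq2)
  moreover have "norm (fst f) = sqrt 2" "norm (fst g) = sqrt 2"
    using assms by (simp_all add: form_def norm_eq_sqrt_inner)
  ultimately have "\<bar>form f g / 2\<bar> \<le> 1"
    by simp
  then show ?thesis
    using assms by (simp add: interior_angle_def cos_arccos_abs)
qed

text \<open>Rotation by a right angle.\<close>

definition perp :: "real^2 \<Rightarrow> real^2" where
  "perp x = vector [- (x $ 2), x $ 1]"

lemma perp_inner: "perp a \<bullet> b = a $ 1 * b $ 2 - a $ 2 * b $ 1"
  by (simp add: perp_def inner_vec_def sum_2)

lemma perp_orthogonal: "perp a \<bullet> a = 0" "a \<bullet> perp a = 0"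
  by (simp_all add: perp_inner inner_commute[of a])

lemma perp_self: "perp a \<bullet> perp a = a \<bullet> a"
  by (simp add: perp_def inner_vec_def sum_2)

lemma Lagrange_perp: "(a \<bullet> b)^2 + (perp a \<bullet> b)^2 = (a \<bullet> a) * (b \<bullet> b)"
  unfolding perp_inner by (simp add: inner_vec_def sum_2 power2_eq_square algebra_simps)

lemma perp_expand: "(a \<bullet> a) *\<^sub>R x = (x \<bullet> a) *\<^sub>R a + (x \<bullet> perp a) *\<^sub>R perp a"
  by (simp add: vec_eq_iff forall_2 inner_vec_def sum_2 perp_def algebra_simps)

text \<open>The combination is orthogonal to each of the three vectors, by the addition theorem for the
  sine, and therefore to itself.\<close>

lemma gradients_balanced:
  fixes a b c :: "'a::real_inner"
  assumes "a \<bullet> a = 2" "b \<bullet> b = 2" "c \<bullet> c = 2"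
    "b \<bullet> c = - 2 * cos A" "c \<bullet> a = - 2 * cos B" "a \<bullet> b = - 2 * cos C" "A + B + C = pi"
  shows "sin A *\<^sub>R a + sin B *\<^sub>R b + sin C *\<^sub>R c = 0"
proof -
  define s where "s = sin A *\<^sub>R a + sin B *\<^sub>R b + sin C *\<^sub>R c"
  have "A = pi - (B + C)" "B = pi - (A + C)" "C = pi - (A + B)"
    using assms(7) by simp_all
  then have sines: "sin A = sin (B + C)" "sin B = sin (A + C)" "sin C = sin (A + B)"
    by (metis sin_pi_minus)+
  have "s \<bullet> a = 2 * (sin A - sin (B + C))"
    using assms(1-6) by (simp add: s_def inner_add_left inner_commute[of b a] sin_add algebra_simps)
  moreover have "s \<bullet> b = 2 * (sin B - sin (A + C))"
    using assms(1-6) by (simp add: s_def inner_add_left inner_commute[of c b] sin_add algebra_simps)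
  moreover have "s \<bullet> c = 2 * (sin C - sin (A + B))"
    using assms(1-6) by (simp add: s_def inner_add_left inner_commute[of a c] sin_add algebra_simps)
  ultimately have "s \<bullet> a = 0" "s \<bullet> b = 0" "s \<bullet> c = 0"
    using sines by simp_all
  then have "s \<bullet> s = 0"
    by (subst (2) s_def) (simp add: inner_add_right)
  then show ?thesis
    by (simp add: s_def)
qed

lemma direction_along_side:
  fixes a b :: "real^2"
  assumes "a \<bullet> a = 2" "b \<bullet> b = 2" "a \<bullet> b = - 2 * cos C" "0 \<le> sin C"
  obtains u where "u \<bullet> u = 1" "a \<bullet> u = 0" "b \<bullet> u = - sqrt 2 * sin C"
    "\<And>x. a \<bullet> x = 0 \<Longrightarrow> x = (x \<bullet> u) *\<^sub>R u"
proof -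
  have "(perp a \<bullet> b)^2 = 4 - (2 * cos C)^2"
    using Lagrange_perp[of a b] assms by simp
  also have "\<dots> = (2 * sin C)^2"
    by (simp add: power_mult_distrib sin_squared_eq)
  finally have "perp a \<bullet> b = 2 * sin C \<or> perp a \<bullet> b = - (2 * sin C)"
    unfolding power2_eq_iff .
  then obtain \<sigma> :: real where \<sigma>: "\<sigma> = 1 \<or> \<sigma> = -1" "\<sigma> * (perp a \<bullet> b) = - (2 * sin C)"
    by (metis mult_minus_left mult_1 minus_minus)
  have s2: "2 / sqrt 2 = sqrt 2"
    by (simp add: real_div_sqrt)
  define u where "u = (\<sigma> / sqrt 2) *\<^sub>R perp a"
  have "u \<bullet> u = 1"
    using \<sigma>(1) assms(1) by (auto simp: u_def perp_self)
  moreover have "a \<bullet> u = 0"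
    by (simp add: u_def perp_orthogonal)
  moreover have "b \<bullet> u = - sqrt 2 * sin C"
  proof -
    have "b \<bullet> u = (\<sigma> * (perp a \<bullet> b)) / sqrt 2"
      by (simp add: u_def inner_commute)
    also have "\<dots> = - (2 / sqrt 2) * sin C"
      unfolding \<sigma>(2) by simp
    finally show ?thesis
      by (simp only: s2)
  qed
  moreover have "x = (x \<bullet> u) *\<^sub>R u" if "a \<bullet> x = 0" for x
  proof -
    have "2 *\<^sub>R x = (x \<bullet> perp a) *\<^sub>R perp a"
      using perp_expand[of a x] assms(1) that by (simp add: inner_commute)
    moreover have "2 *\<^sub>R ((x \<bullet> u) *\<^sub>R u) = (x \<bullet> perp a) *\<^sub>R perp a"
      using \<sigma>(1) by (auto simp: u_def)
    ultimately show ?thesis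
      by (metis scaleR_cancel_left zero_neq_numeral)
  qed
  ultimately show ?thesis
    by (rule that)
qed

lemma eval_add: "eval f (x + y) = eval f x + fst f \<bullet> y"
  by (simp add: eval_def inner_add_right)

lemma point_on_line:
  assumes "form f f = 2"
  obtains x where "eval f x = 0"
proof
  show "eval f (- (snd f / 2) *\<^sub>R fst f) = 0"
    using assms by (simp add: eval_def form_def)
qed

text \<open>Moving along the side with unit speed, \<open>h\<close> and \<open>k\<close> change with speeds proportional to
  \<open>sin C\<close> and \<open>sin B\<close>. The constant combination \<open>\<kappa>\<close> measures how far apart their zeros are.\<close>

lemma side_is_segment:
  assumes f: "form g g = 2" "form h h = 2" "form g h = - 2 * cos C"
    and pos: "0 < sin B" "0 < sin C"
    and bal: "sin A *\<^sub>R fst g + sin B *\<^sub>R fst h + sin C *\<^sub>R fst k = 0"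
    and \<kappa>: "\<And>x. sin A * eval g x + sin B * eval h x + sin C * eval k x = - \<kappa>" "0 < \<kappa>"
  shows "bounded {x. eval g x = 0 \<and> eval h x \<le> 0 \<and> eval k x \<le> 0}"
    and "diameter {x. eval g x = 0 \<and> eval h x \<le> 0 \<and> eval k x \<le> 0} = \<kappa> / (sqrt 2 * sin B * sin C)"
proof -
  obtain u where u: "u \<bullet> u = 1" "fst g \<bullet> u = 0" "fst h \<bullet> u = - sqrt 2 * sin C"
    "\<And>x. fst g \<bullet> x = 0 \<Longrightarrow> x = (x \<bullet> u) *\<^sub>R u"
    using direction_along_side[of "fst g" "fst h" C] f pos unfolding form_def by (metis less_imp_le)
  have uk: "fst k \<bullet> u = sqrt 2 * sin B"
  proof -
    have "sin C * (fst k \<bullet> u) = (sin A *\<^sub>R fst g + sin B *\<^sub>R fst h + sin C *\<^sub>R fst k) \<bullet> u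
      - sin B * (fst h \<bullet> u)"
      by (simp add: inner_add_left u(2))
    also have "\<dots> = sin C * (sqrt 2 * sin B)"
      unfolding bal u(3) by simp
    finally show ?thesis
      using pos by simp
  qed
  obtain P0 where P0: "eval g P0 = 0"
    using point_on_line[OF f(1)] .
  define P where "P = P0 + (eval h P0 / (sqrt 2 * sin C)) *\<^sub>R u"
  have P: "eval g P = 0" "eval h P = 0"
    using pos by (simp_all add: P_def eval_add P0 u)
  define len where "len = \<kappa> / (sqrt 2 * sin B * sin C)"
  have l: "0 < len"
    using pos \<kappa>(2) by (simp add: len_def)
  have Pk: "eval k P = - (sqrt 2 * sin B) * len"
    using \<kappa>(1)[of P] P pos by (simp add: len_def field_simps)
  have ray: "eval g (P + t *\<^sub>R u) = 0" "eval h (P + t *\<^sub>R u) = - (sqrt 2 * sin C) * t"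
    "eval k (P + t *\<^sub>R u) = sqrt 2 * sin B * (t - len)" for t
    by (simp_all add: eval_add P Pk u uk algebra_simps)
  have S: "{x. eval g x = 0 \<and> eval h x \<le> 0 \<and> eval k x \<le> 0} = (\<lambda>t. P + t *\<^sub>R u) ` {0..len}"
  proof (intro equalityI subsetI)
    fix x assume x: "x \<in> {x. eval g x = 0 \<and> eval h x \<le> 0 \<and> eval k x \<le> 0}"
    have "fst g \<bullet> (x - P) = 0"
      using x P(1) by (simp add: eval_def inner_diff_right)
    then have "x - P = ((x - P) \<bullet> u) *\<^sub>R u"
      by (rule u(4))
    then obtain t where t: "x = P + t *\<^sub>R u"
      by (metis add.commute diff_add_cancel)
    have "0 \<le> t" "t \<le> len"
      using x pos unfolding t mem_Collect_eq ray by (simp_all add: mult_le_0_iff zero_le_mult_iff)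
    then show "x \<in> (\<lambda>t. P + t *\<^sub>R u) ` {0..len}"
      using t by auto
  next
    fix x assume "x \<in> (\<lambda>t. P + t *\<^sub>R u) ` {0..len}"
    then obtain t where "t \<in> {0..len}" and t: "x = P + t *\<^sub>R u"
      by blast
    then have "0 \<le> t" "t \<le> len"
      by simp_all
    then show "x \<in> {x. eval g x = 0 \<and> eval h x \<le> 0 \<and> eval k x \<le> 0}"
      using pos unfolding t mem_Collect_eq ray by (simp add: mult_le_0_iff)
  qed
  have bdd: "bounded ((\<lambda>t. P + t *\<^sub>R u) ` {0..len})"
    by (intro compact_imp_bounded compact_continuous_image continuous_intros compact_Icc)
  then show "bounded {x. eval g x = 0 \<and> eval h x \<le> 0 \<and> eval k x \<le> 0}"
    unfolding S .
  have nu: "norm u = 1"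
    using u(1) by (simp add: norm_eq_sqrt_inner)
  have dist: "norm ((P + s *\<^sub>R u) - (P + t *\<^sub>R u)) = \<bar>s - t\<bar>" for s t
    by (simp add: nu flip: scaleR_diff_left)
  have "diameter ((\<lambda>t. P + t *\<^sub>R u) ` {0..len}) \<le> len"
  proof (rule diameter_le)
    fix x y assume "x \<in> (\<lambda>t. P + t *\<^sub>R u) ` {0..len}" "y \<in> (\<lambda>t. P + t *\<^sub>R u) ` {0..len}"
    then obtain s t where st: "s \<in> {0..len}" "t \<in> {0..len}" "x = P + s *\<^sub>R u" "y = P + t *\<^sub>R u"
      by blast
    have "\<bar>s - t\<bar> \<le> len"
      using st(1,2) by auto
    then show "norm (x - y) \<le> len"
      unfolding st(3,4) dist .
  qed (use l in simp)
  moreover have "len \<le> diameter ((\<lambda>t. P + t *\<^sub>R u) ` {0..len})"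
    using diameter_bounded_bound[OF bdd imageI[of 0] imageI[of len]] l dist[of 0 len] by (simp add: dist_norm)
  ultimately show "diameter {x. eval g x = 0 \<and> eval h x \<le> 0 \<and> eval k x \<le> 0} = \<kappa> / (sqrt 2 * sin B * sin C)"
    unfolding S by (simp add: len_def)
qed

lemma unbounded_if_ray:
  assumes "u \<noteq> 0" "\<And>t. t0 \<le> t \<Longrightarrow> P + t *\<^sub>R u \<in> S"
  shows "\<not> bounded (S :: (real^2) set)"
proof
  assume "bounded S"
  then obtain M where M: "\<And>x. x \<in> S \<Longrightarrow> norm x \<le> M"
    by (auto simp: bounded_iff)
  define t where "t = \<bar>t0\<bar> + (\<bar>M\<bar> + norm P + 1) / norm u"
  have "0 \<le> (\<bar>M\<bar> + norm P + 1) / norm u"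
    by simp
  then have t: "t0 \<le> t" "0 \<le> t"
    unfolding t_def by linarith+
  have "t * norm u = \<bar>t0\<bar> * norm u + (\<bar>M\<bar> + norm P + 1)"
    unfolding t_def by (subst distrib_right) (simp add: assms(1))
  then have large: "\<bar>M\<bar> + norm P + 1 \<le> t * norm u"
    by simp
  have "t * norm u = norm ((P + t *\<^sub>R u) - P)"
    using t(2) by simp
  also have "\<dots> \<le> norm (P + t *\<^sub>R u) + norm P"
    by (rule norm_triangle_ineq4)
  also have "\<dots> \<le> M + norm P"
    using M[OF assms(2)[OF t(1)]] by simp
  finally show False
    using large by linarith
qed

text \<open>Minus the constant function \<open>\<Sum>i. sin A\<^sub>i * v\<^sub>i\<close>. Up to the factor \<open>sqrt 2\<close> it is the
  invariant \<open>T\<close>, for triangles and for infinite regions alike, and it is linear in the vectors.\<close>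

definition balance :: "(3 \<Rightarrow> aff) \<Rightarrow> real" where
  "balance v = - (\<Sum>i\<in>UNIV. sin (ang v i) * snd (v i))"

text \<open>Domains that are triangles or, if one of the angles is \<open>0\<close>, infinite regions between two parallel
  half-lines.\<close>

locale normalised_region =
  fixes v :: "3 \<Rightarrow> aff"
  assumes norm: "\<And>i. form (v i) (v i) = 2" and nonempty: "domain v \<noteq> {}"
    and nonneg: "\<And>i. 0 \<le> ang v i" and less_pi: "\<And>i. ang v i < pi"
    and angle_sum: "ang v 1 + ang v 2 + ang v 3 = pi"
begin

lemma sum_from: "ang v i + ang v (i + 1) + ang v (i + 2) = pi"
proof -
  have "ang v 4 = ang v 1" "ang v 5 = ang v 2"
    by (rule arg_cong[of _ _ "ang v"], simp)+
  then show ?thesis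
    using exhaust_3[of i] angle_sum by auto
qed

lemma forms: "form (v (i + 1)) (v (i + 2)) = - 2 * cos (ang v i)"
  "form (v i) (v (i + 1)) = - 2 * cos (ang v (i + 2))"
  "form (v (i + 2)) (v i) = - 2 * cos (ang v (i + 1))"
  unfolding ang_def three_index_simps by (rule form_interior_angle[OF norm norm])+

lemma balanced: "sin (ang v i) *\<^sub>R fst (v i) + sin (ang v (i + 1)) *\<^sub>R fst (v (i + 1))
    + sin (ang v (i + 2)) *\<^sub>R fst (v (i + 2)) = 0"
  using norm forms sum_from unfolding form_def by (intro gradients_balanced)

lemma balance_eval: "sin (ang v i) * eval (v i) x + sin (ang v (i + 1)) * eval (v (i + 1)) x
    + sin (ang v (i + 2)) * eval (v (i + 2)) x = - balance v"
proof -
  have "sin (ang v i) * eval (v i) x + sin (ang v (i + 1)) * eval (v (i + 1)) x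
    + sin (ang v (i + 2)) * eval (v (i + 2)) x
    = (sin (ang v i) *\<^sub>R fst (v i) + sin (ang v (i + 1)) *\<^sub>R fst (v (i + 1))
    + sin (ang v (i + 2)) *\<^sub>R fst (v (i + 2))) \<bullet> x - balance v"
    unfolding balance_def sum_three[of _ i] by (simp add: eval_def inner_add_left algebra_simps)
  then show ?thesis
    by (simp add: balanced)
qed

lemma sin_nonneg: "0 \<le> sin (ang v i)"
  using nonneg less_pi by (intro sin_ge_zero) (auto intro: less_imp_le)

lemma sin_pos_iff: "0 < sin (ang v i) \<longleftrightarrow> ang v i \<noteq> 0"
  using nonneg[of i] less_pi[of i] sin_gt_zero[of "ang v i"] by (auto simp: less_le)

text \<open>At a point of the domain all three functions are negative.\<close>

lemma balance_pos: "0 < balance v"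
proof -
  obtain x where x: "x \<in> domain v"
    using nonempty by blast
  then have neg: "eval (v i) x < 0" for i
    by (auto simp: domain_def halfplane_def)
  have "\<exists>i. ang v i \<noteq> 0"
    using angle_sum pi_gt_zero by (metis add_0 less_irrefl)
  then obtain i where "0 < sin (ang v i)"
    using sin_pos_iff by blast
  then have "sin (ang v i) * eval (v i) x < 0"
    using neg by (simp add: mult_pos_neg)
  moreover have le: "sin (ang v j) * eval (v j) x \<le> 0" for j
    using neg[of j] sin_nonneg[of j] by (simp add: mult_nonneg_nonpos)
  ultimately show ?thesis
    using le[of "i + 1"] le[of "i + 2"] balance_eval[of i x] by linarith
qed

lemma side_eq: "side v i = {x. eval (v i) x = 0 \<and> eval (v (i + 1)) x \<le> 0 \<and> eval (v (i + 2)) x \<le> 0}"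
  unfolding side_def line_def all_three[of _ i] by auto

lemma side_between_positive_angles:
  assumes "ang v (i + 1) \<noteq> 0" "ang v (i + 2) \<noteq> 0"
  shows "bounded (side v i)"
    "diameter (side v i) = balance v / (sqrt 2 * sin (ang v (i + 1)) * sin (ang v (i + 2)))"
proof -
  have pos: "0 < sin (ang v (i + 1))" "0 < sin (ang v (i + 2))"
    using assms sin_pos_iff by blast+
  note s = side_is_segment[OF norm[of i] norm[of "i + 1"] forms(2)[of i] pos balanced[of i]
      balance_eval[of i] balance_pos]
  show "bounded (side v i)"
    "diameter (side v i) = balance v / (sqrt 2 * sin (ang v (i + 1)) * sin (ang v (i + 2)))"
    unfolding side_eq by (rule s)+
qed

text \<open>Inside the domain each function is negative and, by the constancy of the balanced combination,
  bounded below. Two of them have independent gradients, so the domain is bounded.\<close>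

lemma T_bounded_case:
  assumes "\<And>i. ang v i \<noteq> 0"
  shows "bounded (domain v)" "T v = balance v / sqrt 2"
proof -
  have pos: "0 < sin (ang v i)" for i
    using assms sin_pos_iff by blast
  define L where "L x = (fst (v 1) \<bullet> x, fst (v 2) \<bullet> x)" for x
  have "linear L"
    unfolding L_def by (intro linearI) (simp_all add: inner_add_right)
  moreover have "inj L"
    unfolding linear_injective_0[OF \<open>linear L\<close>]
  proof (intro allI impI)
    fix x assume "L x = 0"
    then have x: "fst (v 1) \<bullet> x = 0" "fst (v 2) \<bullet> x = 0"
      by (simp_all add: L_def zero_prod_def)
    obtain u where u: "fst (v 2) \<bullet> u = - sqrt 2 * sin (ang v 3)"
      "\<And>x. fst (v 1) \<bullet> x = 0 \<Longrightarrow> x = (x \<bullet> u) *\<^sub>R u"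
    proof (rule direction_along_side[of "fst (v 1)" "fst (v 2)" "ang v 3"])
      show "fst (v 1) \<bullet> fst (v 1) = 2" "fst (v 2) \<bullet> fst (v 2) = 2"
        using norm by (simp_all add: form_def)
      show "fst (v 1) \<bullet> fst (v 2) = - 2 * cos (ang v 3)"
        using forms(2)[of 1] by (simp add: form_def)
    qed (use sin_nonneg in \<open>blast+\<close>)
    have "x = (x \<bullet> u) *\<^sub>R u"
      by (rule u(2)[OF x(1)])
    then have "(x \<bullet> u) * (- sqrt 2 * sin (ang v 3)) = 0"
      using x(2) u(1) by (metis inner_scaleR_right)
    then have "x \<bullet> u = 0"
      using pos[of 3] by simp
    then show "x = 0"
      using u(2)[OF x(1)] by simp
  qed
  ultimately obtain C where C: "0 < C" "\<And>x. C * norm x \<le> norm (L x)"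
    using linear_inj_bounded_below_pos by blast
  define M where "M i = balance v / sin (ang v i) + \<bar>snd (v i)\<bar>" for i
  have bound: "\<bar>fst (v i) \<bullet> x\<bar> \<le> M i" if x: "x \<in> domain v" for x i
  proof -
    have neg: "eval (v i) x < 0" for i
      using x by (auto simp: domain_def halfplane_def)
    have "sin (ang v j) * eval (v j) x \<le> 0" for j
      using neg[of j] sin_nonneg[of j] by (simp add: mult_nonneg_nonpos)
    from this[of "i + 1"] this[of "i + 2"] have "- balance v \<le> sin (ang v i) * eval (v i) x"
      using balance_eval[of i x] by linarith
    then have "- (balance v / sin (ang v i)) \<le> eval (v i) x"
      using pos[of i] by (simp add: field_simps)
    then show ?thesis
      using neg[of i] by (simp add: M_def eval_def)
  qed
  have "norm x \<le> (M 1 + M 2) / C" if "x \<in> domain v" for x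
  proof -
    have "norm (L x) \<le> \<bar>fst (v 1) \<bullet> x\<bar> + \<bar>fst (v 2) \<bullet> x\<bar>"
      unfolding L_def norm_Pair by (simp add: sqrt_sum_squares_le_sum_abs)
    also have "\<dots> \<le> M 1 + M 2"
      by (intro add_mono bound that)
    finally have "C * norm x \<le> M 1 + M 2"
      using C(2)[of x] by linarith
    then show ?thesis
      using C(1) by (simp add: field_simps)
  qed
  then show bdd: "bounded (domain v)"
    unfolding bounded_iff by blast
  have "diameter (side v 1) = balance v / (sqrt 2 * sin (ang v 2) * sin (ang v 3))"
    using side_between_positive_angles(2)[of 1] assms by simp
  then show "T v = balance v / sqrt 2"
    using bdd pos[of 2] pos[of 3] by (simp add: T_def)
qed

text \<open>If \<open>ang v i = 0\<close>, the other two gradients are opposite. The direction \<open>u0\<close> along their lines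
  leaves their values unchanged and decreases \<open>v i\<close>; it points into the unbounded part of the region,
  and \<open>i\<close> is the only bounded side.\<close>

lemma T_unbounded_case:
  assumes "ang v i = 0"
  shows "T v = balance v / sqrt 2"
proof -
  have others: "ang v (i + 1) \<noteq> 0" "ang v (i + 2) \<noteq> 0"
    using sum_from[of i] less_pi[of "i + 1"] less_pi[of "i + 2"] assms by auto
  have "ang v (i + 2) = pi - ang v (i + 1)"
    using sum_from[of i] assms by simp
  then have sin_eq: "sin (ang v (i + 2)) = sin (ang v (i + 1))"
    by simp
  have pos: "0 < sin (ang v (i + 1))"
    using others sin_pos_iff by blast
  have "sin (ang v (i + 1)) *\<^sub>R (fst (v (i + 1)) + fst (v (i + 2))) = 0"
    using balanced[of i] assms sin_eq by (simp add: scaleR_add_right)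
  then have opp: "fst (v (i + 2)) = - fst (v (i + 1))"
    using pos by (simp add: eq_neg_iff_add_eq_0 add.commute)
  have gap: "eval (v (i + 1)) x + eval (v (i + 2)) x = - (balance v / sin (ang v (i + 1)))" for x
  proof -
    have "sin (ang v (i + 1)) * (eval (v (i + 1)) x + eval (v (i + 2)) x) = - balance v"
      using balance_eval[of i x] assms sin_eq by (simp add: distrib_left)
    then show ?thesis
      using pos by (simp add: field_simps)
  qed
  have gap_neg: "- (balance v / sin (ang v (i + 1))) < 0"
    using pos balance_pos by simp
  obtain u0 where u0: "u0 \<bullet> u0 = 1" "fst (v (i + 1)) \<bullet> u0 = 0" "fst (v i) \<bullet> u0 = - sqrt 2 * sin (ang v (i + 2))"
    using direction_along_side[of "fst (v (i + 1))" "fst (v i)" "ang v (i + 2)"] norm forms(2)[of i] sin_nonneg[of "i + 2"]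
    unfolding form_def by (metis inner_commute)
  define r where "r = sqrt 2 * sin (ang v (i + 2))"
  have r: "0 < r" "fst (v i) \<bullet> u0 = - r"
    using pos sin_eq u0(3) by (simp_all add: r_def)
  have u0_ne: "u0 \<noteq> 0"
    using u0(1) by auto
  have ray: "eval (v (i + 1)) (P + t *\<^sub>R u0) = eval (v (i + 1)) P"
    "eval (v (i + 2)) (P + t *\<^sub>R u0) = eval (v (i + 2)) P"
    "eval (v i) (P + t *\<^sub>R u0) = eval (v i) P - t * r" for P t
    by (simp_all add: eval_add u0(2) opp r(2))
  have "\<not> bounded (domain v)"
  proof -
    obtain x where x: "x \<in> domain v"
      using nonempty by blast
    have dom: "y \<in> domain v \<longleftrightarrow> eval (v i) y < 0 \<and> eval (v (i + 1)) y < 0 \<and> eval (v (i + 2)) y < 0" for y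
      using all_three[of "\<lambda>j. eval (v j) y < 0" i] by (simp add: domain_def halfplane_def)
    have "x + t *\<^sub>R u0 \<in> domain v" if "0 \<le> t" for t
    proof -
      have "0 \<le> t * r"
        using that r(1) by simp
      then show ?thesis
        using x unfolding dom ray by linarith
    qed
    then show ?thesis
      by (rule unbounded_if_ray[OF u0_ne])
  qed
  moreover have "bounded (side v j) \<longleftrightarrow> j = i" for j
  proof -
    have half_line: "P + t *\<^sub>R u0 \<in> side v k"
      if "eval (v k) P = 0" "k = i + 1 \<or> k = i + 2" "eval (v i) P / r \<le> t" for P k t
    proof -
      have sides: "y \<in> side v k \<longleftrightarrow> eval (v k) y = 0 \<and> eval (v i) y \<le> 0 \<and> eval (v (i + 1)) y \<le> 0 \<and> eval (v (i + 2)) y \<le> 0" for y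
        unfolding side_def line_def all_three[of _ i] by auto
      have "eval (v i) P - t * r \<le> 0"
        using that(3) r(1) by (simp add: field_simps)
      moreover have "eval (v (i + 1)) P \<le> 0" "eval (v (i + 2)) P \<le> 0"
        using that(1,2) gap[of P] gap_neg by auto
      ultimately show ?thesis
        using that(1,2) unfolding sides by (auto simp: ray)
    qed
    have "\<not> bounded (side v k)" if "k = i + 1 \<or> k = i + 2" for k
    proof -
      obtain P where "eval (v k) P = 0"
        using point_on_line[OF norm] .
      then show ?thesis
        using half_line that by (intro unbounded_if_ray[OF u0_ne]) blast
    qed
    moreover have "bounded (side v i)"
      by (rule side_between_positive_angles(1)[OF others])
    moreover have "j = i \<or> j = i + 1 \<or> j = i + 2"
      using index_cases[of i "i + 1" "i + 2" j] three_index_simps(1-3)[of i] by metis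
    ultimately show ?thesis
      using three_index_simps(1,2)[of i] by blast
  qed
  then have "(THE j. bounded (side v j)) = i"
    by simp
  ultimately show ?thesis
    using side_between_positive_angles(2)[OF others] pos
    by (simp add: T_def sin_eq power2_eq_square)
qed

lemma T_eq_balance: "T v = balance v / sqrt 2"
  using T_bounded_case(2) T_unbounded_case by blast

end

section \<open>Placing a region along the belt line\<close>

lemma exchange_skew: "exchange_matrix Q \<Longrightarrow> Q $ y $ x = - Q $ x $ y"
  unfolding exchange_matrix_iff by (erule allE)+

lemma exchange_diagonal: "exchange_matrix Q \<Longrightarrow> Q $ x $ x = 0"
  using exchange_skew[of Q x x] by linarith

lemma acyclic_if_transitive:
  assumes Q: "exchange_matrix Q" and ne: "i \<noteq> j" "i \<noteq> m" "j \<noteq> m"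
    and a: "Q $ i $ m > 0" "Q $ m $ j > 0" "Q $ i $ j > 0"
  shows "acyclic_quiver Q"
  unfolding acyclic_quiver_def
proof (rule acyclicI_order)
  define r where "r x = (if x = i then 2 else if x = m then 1 else 0 :: nat)" for x
  have r: "r i = 2" "r m = 1" "r j = 0"
    using ne by (simp_all add: r_def)
  have b: "Q $ m $ i < 0" "Q $ j $ m < 0" "Q $ j $ i < 0"
    using a exchange_skew[OF Q, of m i] exchange_skew[OF Q, of j m] exchange_skew[OF Q, of j i] by linarith+
  fix x y assume "(x, y) \<in> {(x, y). Q $ x $ y > 0}"
  then have "Q $ x $ y > 0" by simp
  then show "r y < r x"
    using index_cases[OF ne, of x] index_cases[OF ne, of y] a b exchange_diagonal[OF Q]
    by (elim disjE) (simp_all add: r)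
qed

lemma not_acyclic_if_cycle:
  assumes "Q $ i $ m > 0" "Q $ m $ j > 0" "Q $ j $ i > 0"
  shows "\<not> acyclic_quiver Q"
proof -
  have "(i, i) \<in> {(x, y). Q $ x $ y > 0}\<^sup>+"
    using assms by (intro trancl_into_trancl2[of i m] trancl_into_trancl2[of m j] r_into_trancl) auto
  then show ?thesis
    unfolding acyclic_quiver_def acyclic_def by blast
qed

text \<open>Three vertices joined pairwise by arrows form either a transitive or a cyclic triangle.\<close>

lemma orient_triangle:
  assumes Q: "exchange_matrix Q" and nz: "\<And>x y. x \<noteq> y \<Longrightarrow> Q $ x $ y \<noteq> 0"
  shows "acyclic_quiver Q \<Longrightarrow> \<exists>i j m. i \<noteq> j \<and> i \<noteq> m \<and> j \<noteq> m \<and> Q $ i $ m > 0 \<and> Q $ m $ j > 0 \<and> Q $ i $ j > 0"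
    and "\<not> acyclic_quiver Q \<Longrightarrow> \<exists>i j. i \<noteq> j \<and> i \<noteq> m \<and> j \<noteq> m \<and> Q $ i $ m > 0 \<and> Q $ m $ j > 0 \<and> Q $ j $ i > 0"
proof -
  let ?trans = "\<lambda>i m j. i \<noteq> j \<and> i \<noteq> m \<and> j \<noteq> m \<and> Q $ i $ m > 0 \<and> Q $ m $ j > 0 \<and> Q $ i $ j > 0"
  let ?cyc = "\<lambda>i j. i \<noteq> j \<and> i \<noteq> m \<and> j \<noteq> m \<and> Q $ i $ m > 0 \<and> Q $ m $ j > 0 \<and> Q $ j $ i > 0"
  define k l where "k = m + 1" and "l = m + 2"
  have ne: "k \<noteq> m" "l \<noteq> m" "k \<noteq> l" "m \<noteq> k" "m \<noteq> l" "l \<noteq> k"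
    using three_index_simps(1-3)[of m] by (auto simp: k_def l_def)
  have sk: "Q $ k $ m = - Q $ m $ k" "Q $ l $ k = - Q $ k $ l" "Q $ m $ l = - Q $ l $ m"
    by (rule exchange_skew[OF Q])+
  have n0: "Q $ m $ k \<noteq> 0" "Q $ k $ l \<noteq> 0" "Q $ l $ m \<noteq> 0"
    using nz ne by blast+
  have "(\<exists>i j m. ?trans i m j) \<or> (\<exists>i j. ?cyc i j)"
  proof -
    consider "Q $ m $ k > 0" "Q $ k $ l > 0" "Q $ l $ m > 0" | "Q $ m $ k > 0" "Q $ k $ l > 0" "Q $ l $ m < 0"
      | "Q $ m $ k > 0" "Q $ k $ l < 0" "Q $ l $ m > 0" | "Q $ m $ k > 0" "Q $ k $ l < 0" "Q $ l $ m < 0"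
      | "Q $ m $ k < 0" "Q $ k $ l > 0" "Q $ l $ m > 0" | "Q $ m $ k < 0" "Q $ k $ l > 0" "Q $ l $ m < 0"
      | "Q $ m $ k < 0" "Q $ k $ l < 0" "Q $ l $ m > 0" | "Q $ m $ k < 0" "Q $ k $ l < 0" "Q $ l $ m < 0"
      using n0 unfolding neq_iff by blast
    then show ?thesis
    proof cases
      case 1 then have "?cyc l k" using ne by simp then show ?thesis by blast
    next
      case 2 then have "?trans m k l" using ne sk by simp then show ?thesis by blast
    next
      case 3 then have "?trans l m k" using ne sk by simp then show ?thesis by blast
    next
      case 4 then have "?trans m l k" using ne sk by simp then show ?thesis by blast
    next
      case 5 then have "?trans k l m" using ne sk by simp then show ?thesis by blast
    next
      case 6 then have "?trans k m l" using ne sk by simp then show ?thesis by blast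
    next
      case 7 then have "?trans l k m" using ne sk by simp then show ?thesis by blast
    next
      case 8 then have "?cyc k l" using ne sk by simp then show ?thesis by blast
    qed
  qed
  moreover have "acyclic_quiver Q" if "?trans i m j" for i j m
    using that acyclic_if_transitive[OF Q] by blast
  moreover have "\<not> acyclic_quiver Q" if "?cyc i j" for i j
    using that not_acyclic_if_cycle[of Q i m j] by blast
  ultimately show "acyclic_quiver Q \<Longrightarrow> \<exists>i j m. ?trans i m j" "\<not> acyclic_quiver Q \<Longrightarrow> \<exists>i j. ?cyc i j"
    by blast+
qed

lemma isometry_surj:
  assumes "isometry \<phi>"
  shows "surj \<phi>"
proof -
  have "orthogonal_transformation (\<lambda>x. \<phi> x - \<phi> 0)"
    using assms unfolding orthogonal_transformation_isometry isometry_def by (simp add: dist_norm)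
  then have "surj (\<lambda>x. \<phi> x - \<phi> 0)"
    by (rule orthogonal_transformation_surj)
  have "y \<in> range \<phi>" for y
  proof -
    obtain x where "y - \<phi> 0 = \<phi> x - \<phi> 0"
      using surjD[OF \<open>surj (\<lambda>x. \<phi> x - \<phi> 0)\<close>] by blast
    then show ?thesis by simp
  qed
  then show ?thesis by blast
qed

lemma domain_push:
  assumes "isometry \<phi>"
  shows "domain (push \<phi> \<circ> v) = \<phi> ` domain v"
proof -
  have iff: "\<phi> x \<in> domain (push \<phi> \<circ> v) \<longleftrightarrow> x \<in> domain v" for x
    by (simp add: domain_def halfplane_def eval_push[OF assms])
  show ?thesis
  proof (intro equalityI subsetI)
    fix y assume y: "y \<in> domain (push \<phi> \<circ> v)"
    obtain x where "y = \<phi> x"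
      using surjD[OF isometry_surj[OF assms]] by blast
    then show "y \<in> \<phi> ` domain v"
      using y iff by simp
  next
    fix y assume "y \<in> \<phi> ` domain v"
    then show "y \<in> domain (push \<phi> \<circ> v)"
      using iff by (elim imageE) simp
  qed
qed

lemma isometry_comp: "isometry \<phi> \<Longrightarrow> isometry \<psi> \<Longrightarrow> isometry (\<phi> \<circ> \<psi>)"
  by (simp add: isometry_def)

context belt_frame
begin

text \<open>The frame is read off the region: the unit normal \<open>f'\<close> of the belt line has to be the normalised
  gradient of the combination of the vectors that spans the kernel of the quiver. The isometry carrying it
  to \<open>f\<close>, followed by a suitable translation, puts the region into the normal form.\<close>

lemma place_region:
  assumes v: "normalised_region v" and bal: "balance v = sqrt 2 * K"
    and ne: "i \<noteq> j" "i \<noteq> m" "j \<noteq> m"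
    and ang: "ang v i = real p * \<alpha>" "ang v j = real q * \<alpha>" "ang v m = pi - (real p * \<alpha> + real q * \<alpha>)"
    and pq: "1 \<le> p" "p \<le> n" "q \<le> n"
    and B: "exchange_matrix B" "B $ i $ m = 2 * cos (real q * \<alpha>)" "B $ m $ j = 2 * cos (real p * \<alpha>)"
      "B $ i $ j = - 2 * cos (real p * \<alpha> + real q * \<alpha>)"
  obtains \<phi> where "isometry \<phi>" "state i j m 1 p q (push \<phi> \<circ> v, B)"
proof -
  interpret normalised_region v by (rule v)
  define a b where "a = real p * \<alpha>" and "b = real q * \<alpha>"
  note ang = ang[folded a_def b_def] and B = B[folded a_def b_def]
  define ai aj am where "ai = fst (v i)" and "aj = fst (v j)" and "am = fst (v m)"
  have sa: "0 < sin a"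
    using sin_pos[of p] pq by (simp add: a_def)
  have next_index: "(j = i + 1 \<and> m = i + 2) \<or> (m = i + 1 \<and> j = i + 2)"
    using index_cases[of i "i + 1" "i + 2" j] index_cases[of i "i + 1" "i + 2" m] three_index_simps(1-3)[of i] ne
    by metis
  have sq: "ai \<bullet> ai = 2" "aj \<bullet> aj = 2" "am \<bullet> am = 2"
    using norm by (simp_all add: form_def ai_def aj_def am_def)
  have cp: "ai \<bullet> aj = 2 * cos (a + b)" "ai \<bullet> am = - 2 * cos b" "aj \<bullet> am = - 2 * cos a"
    using forms[of i] next_index ang
    by (auto simp: form_def ai_def aj_def am_def inner_commute)
  have balance': "sin a * snd (v i) + sin b * snd (v j) + sin (a + b) * snd (v m) = - (sqrt 2 * K)"
    using bal[unfolded balance_def sum_three[of _ i]] next_index ang by auto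
  \<comment> \<open>The coefficients are half the entries \<open>B $ m $ j\<close>, \<open>B $ i $ m\<close>, \<open>B $ j $ i\<close> of the quiver.\<close>
  define f' where "f' = (1 / sqrt 2) *\<^sub>R (cos a *\<^sub>R ai + cos b *\<^sub>R aj + cos (a + b) *\<^sub>R am)"
  have id: "cos (a + b) * cos (a - b) = cos a * cos a + cos b * cos b - 1"
    unfolding sum_difference_products(4) using sin_cos_squared_add3[of b] by linarith
  have sd: "2 * cos a * cos b - cos (a + b) = cos (a - b)"
    by (simp add: cos_add cos_diff)
  have s2: "2 * y / sqrt 2 = sqrt 2 * y" for y :: real
    by (simp add: field_simps)
  have r2: "sqrt 2 * (sqrt 2 * y) = 2 * y" for y :: real
    by (simp flip: mult.assoc)
  have "ai \<bullet> f' = 2 * cos a / sqrt 2"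
    by (simp add: f'_def inner_add_right sq cp algebra_simps)
  then have fi: "ai \<bullet> f' = sqrt 2 * cos a"
    by (simp only: s2)
  have "aj \<bullet> f' = 2 * cos b / sqrt 2"
    by (simp add: f'_def inner_add_right sq cp inner_commute[of aj ai] algebra_simps)
  then have fj: "aj \<bullet> f' = sqrt 2 * cos b"
    by (simp only: s2)
  have fm: "am \<bullet> f' = - (sqrt 2 * cos (a - b))"
  proof -
    have "am \<bullet> f' = - (2 * (2 * cos a * cos b - cos (a + b)) / sqrt 2)"
      by (simp add: f'_def inner_add_right sq cp inner_commute[of am ai] inner_commute[of am aj] algebra_simps diff_divide_distrib)
    then show ?thesis
      by (simp only: s2 sd)
  qed
  have ff': "f' \<bullet> f' = 1"
  proof -
    have "f' \<bullet> f' = (cos a * (ai \<bullet> f') + cos b * (aj \<bullet> f') + cos (a + b) * (am \<bullet> f')) / sqrt 2"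
      by (subst (1) f'_def) (simp add: inner_add_left)
    also have "\<dots> = cos a * cos a + cos b * cos b - cos (a + b) * cos (a - b)"
      unfolding fi fj fm by (simp add: field_simps)
    finally show ?thesis
      using id by simp
  qed
  have "(perp f' \<bullet> ai)^2 = (sqrt 2 * sin a)^2"
    using Lagrange_perp[of f' ai] ff' sq fi by (simp add: inner_commute power_mult_distrib sin_squared_eq)
  then obtain \<sigma> :: real where \<sigma>: "\<sigma> = 1 \<or> \<sigma> = -1" "\<sigma> * (perp f' \<bullet> ai) = - (sqrt 2 * sin a)"
    unfolding power2_eq_iff by (metis mult_minus_left mult_1 minus_minus)
  \<comment> \<open>The sign is chosen such that \<open>v i\<close> becomes positive.\<close>
  define e' where "e' = \<sigma> *\<^sub>R perp f'"
  have ee': "e' \<bullet> e' = 1" "e' \<bullet> f' = 0"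
    using \<sigma>(1) ff' by (auto simp: e'_def perp_self perp_orthogonal)
  note ex = orthonormal_expand[OF ee'(1) ff' ee'(2)]
  have prod: "x \<bullet> y = (x \<bullet> e') * (y \<bullet> e') + (x \<bullet> f') * (y \<bullet> f')" for x y
  proof -
    have "x \<bullet> y = ((x \<bullet> e') *\<^sub>R e' + (x \<bullet> f') *\<^sub>R f') \<bullet> y"
      by (simp only: ex[symmetric])
    then show ?thesis
      unfolding inner_add_left inner_scaleR_left by (simp only: inner_commute[of y])
  qed
  have ei: "ai \<bullet> e' = - (sqrt 2 * sin a)"
    using \<sigma>(2) by (simp add: e'_def inner_commute)
  have ej: "aj \<bullet> e' = sqrt 2 * sin b"
  proof -
    have "2 * cos (a + b) = - (sqrt 2 * sin a) * (aj \<bullet> e') + (sqrt 2 * cos a) * (sqrt 2 * cos b)"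
      using prod[of ai aj] unfolding cp ei fi fj .
    then have "(sqrt 2 * sin a) * (aj \<bullet> e') = (sqrt 2 * sin a) * (sqrt 2 * sin b)"
      by (simp add: cos_add algebra_simps)
    then show ?thesis
      using sa by simp
  qed
  have em: "am \<bullet> e' = sqrt 2 * sin (a - b)"
  proof -
    have "- 2 * cos b = - (sqrt 2 * sin a) * (am \<bullet> e') + (sqrt 2 * cos a) * (- (sqrt 2 * cos (a - b)))"
      using prod[of ai am] unfolding cp ei fi fm .
    moreover have "cos b = cos a * cos (a - b) + sin a * sin (a - b)"
      using cos_diff[of a "a - b"] by simp
    ultimately have "(sqrt 2 * sin a) * (am \<bullet> e') = (sqrt 2 * sin a) * (sqrt 2 * sin (a - b))"
      by (simp add: r2 algebra_simps)
    then show ?thesis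
      using sa by simp
  qed
  \<comment> \<open>The shift along \<open>f\<close> that makes the kernel combination vanish on the belt line.\<close>
  define z where "z = - ((cos a * snd (v i) + cos b * snd (v j) + cos (a + b) * snd (v m)) / sqrt 2)"
  define \<psi> where "\<psi> x = (x \<bullet> e') *\<^sub>R e + (x \<bullet> f') *\<^sub>R f" for x
  define \<phi> where "\<phi> x = \<psi> x + (ori - z *\<^sub>R f)" for x
  have diff: "\<phi> x - \<phi> y = \<psi> (x - y)" for x y
    by (simp add: \<phi>_def \<psi>_def inner_diff_left algebra_simps)
  have iso: "isometry \<phi>"
  proof -
    have "norm (\<psi> x) ^ 2 = norm x ^ 2" for x
      unfolding power2_norm_eq_inner prod[of x x]
      by (simp add: \<psi>_def inner_add_left inner_add_right ee ff ef fe)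
    then show ?thesis
      unfolding isometry_def dist_norm diff by simp
  qed
  have push: "push \<phi> g = (\<psi> (fst g), snd g - \<psi> (fst g) \<bullet> (ori - z *\<^sub>R f))" for g
  proof -
    have "\<phi> 0 = ori - z *\<^sub>R f"
      by (simp add: \<phi>_def \<psi>_def)
    then show ?thesis
      unfolding push_def diff by (simp add: Let_def)
  qed
  have c: "cx (push \<phi> g) = (fst g \<bullet> e') / sqrt 2" "cy (push \<phi> g) = (fst g \<bullet> f') / sqrt 2"
    "cd (push \<phi> g) = snd g / sqrt 2 + z * ((fst g \<bullet> f') / sqrt 2)" for g
    by (simp_all add: push cx_def cy_def cd_def eval_def \<psi>_def inner_add_left inner_diff_right ee ff ef fe
        add_divide_distrib)
  have ci: "cx (push \<phi> (v i)) = - sin a" "cy (push \<phi> (v i)) = cos a"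
    "cd (push \<phi> (v i)) = snd (v i) / sqrt 2 + z * cos a"
    unfolding c ai_def[symmetric] ei fi by simp_all
  have cj: "cx (push \<phi> (v j)) = sin b" "cy (push \<phi> (v j)) = cos b"
    "cd (push \<phi> (v j)) = snd (v j) / sqrt 2 + z * cos b"
    unfolding c aj_def[symmetric] ej fj by simp_all
  have cm: "cx (push \<phi> (v m)) = sin (a - b)" "cy (push \<phi> (v m)) = - cos (a - b)"
    "cd (push \<phi> (v m)) = snd (v m) / sqrt 2 - z * cos (a - b)"
    unfolding c am_def[symmetric] em fm by simp_all
  have "state i j m 1 p q (push \<phi> \<circ> v, B)"
  proof (rule stateI[where a = a and b = b])
    have sid: "sin a * cos a + sin b * cos b - sin (a + b) * cos (a - b) = 0"
      unfolding sum_difference_products(3) by simp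
    have "sin a * cd (push \<phi> (v i)) + sin b * cd (push \<phi> (v j)) + sin (a + b) * cd (push \<phi> (v m))
      = (sin a * snd (v i) + sin b * snd (v j) + sin (a + b) * snd (v m)) / sqrt 2
        + z * (sin a * cos a + sin b * cos b - sin (a + b) * cos (a - b))"
      unfolding ci cj cm by (simp add: algebra_simps add_divide_distrib)
    also have "\<dots> = - K"
      unfolding sid balance' by simp
    finally show "sin a * cd (fst (push \<phi> \<circ> v, B) i) + sin b * cd (fst (push \<phi> \<circ> v, B) j)
      + sin (a + b) * cd (fst (push \<phi> \<circ> v, B) m) = - K"
      by simp
    have "cos a * cd (push \<phi> (v i)) + cos b * cd (push \<phi> (v j)) + cos (a + b) * cd (push \<phi> (v m))
      = (cos a * snd (v i) + cos b * snd (v j) + cos (a + b) * snd (v m)) / sqrt 2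
        + z * (cos a * cos a + cos b * cos b - cos (a + b) * cos (a - b))"
      unfolding ci cj cm by (simp add: algebra_simps add_divide_distrib)
    also have "\<dots> = 0"
      unfolding id by (simp add: z_def)
    finally show "cos a * cd (fst (push \<phi> \<circ> v, B) i) + cos b * cd (fst (push \<phi> \<circ> v, B) j)
      + cos (a + b) * cd (fst (push \<phi> \<circ> v, B) m) = 0"
      by simp
  qed (use ne pq B in \<open>simp_all add: ci cj cm a_def[symmetric] b_def[symmetric]\<close>)
  then show ?thesis
    using iso that by blast
qed

end

section \<open>Realising prescribed angles and quivers\<close>

lemma interior_angle_commute: "interior_angle f g = interior_angle g f"
  by (simp add: interior_angle_def form_def inner_commute mult.commute)

lemma ang_opposite:
  assumes "x \<noteq> y" "x \<noteq> z" "y \<noteq> z"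
  shows "interior_angle (v x) (v y) = ang v z"
proof -
  have "x = z + 1 \<and> y = z + 2 \<or> x = z + 2 \<and> y = z + 1"
    using index_cases[of z "z + 1" "z + 2" x] index_cases[of z "z + 1" "z + 2" y] three_index_simps(1-3)[of z] assms
    by metis
  then show ?thesis
    by (auto simp: ang_def interior_angle_commute)
qed

lemma ang_123: "ang v 1 = interior_angle (v 2) (v 3)" "ang v 2 = interior_angle (v 3) (v 1)"
  "ang v 3 = interior_angle (v 1) (v 2)"
  by (rule ang_opposite[symmetric]; simp)+

lemma interior_angle_eqI:
  assumes "form f g = - 2 * cos x" "form f f = 2" "form g g = 2" "0 \<le> x" "x < pi"
  shows "interior_angle f g = x"
proof -
  have "arccos (- cos x) = pi - x"
    using assms(4,5) arccos_cos[of "pi - x"] by simp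
  then show ?thesis
    by (simp add: interior_angle_def assms(1-3))
qed

lemma normalised_region_if_region_with_angles:
  assumes "region_with_angles v A1 A2 A3" "A1 + A2 + A3 = pi"
    "0 \<le> A1" "0 \<le> A2" "0 \<le> A3" "A1 < pi" "A2 < pi" "A3 < pi"
  shows "normalised_region v"
proof
  have "ang v 1 = A1" "ang v 2 = A2" "ang v 3 = A3"
    using assms(1) by (simp_all add: region_with_angles_def)
  then show "0 \<le> ang v i" "ang v i < pi" "ang v 1 + ang v 2 + ang v 3 = pi" for i
    using exhaust_3[of i] assms by auto
qed (use assms(1) in \<open>simp_all add: region_with_angles_def\<close>)

lemma is_basisI:
  assumes indep: "\<And>r. (\<Sum>i\<in>UNIV. r i *\<^sub>R v i) = 0 \<Longrightarrow> \<forall>i. r i = 0"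
  shows "is_basis v"
proof -
  have inj: "inj v"
  proof (rule injI)
    fix i j assume eq: "v i = v j"
    show "i = j"
    proof (rule ccontr)
      assume "i \<noteq> j"
      define r where "r k = (if k = i then 1 else if k = j then - 1 else 0 :: real)" for k
      have "(\<Sum>k\<in>UNIV. r k *\<^sub>R v k) = (\<Sum>k\<in>{i, j}. r k *\<^sub>R v k)"
        by (rule sum.mono_neutral_right) (auto simp: r_def)
      also have "\<dots> = 0"
        using \<open>i \<noteq> j\<close> eq by (simp add: r_def)
      finally have "r i = 0"
        using indep by blast
      then show False
        by (simp add: r_def)
    qed
  qed
  have ind: "independent (range v)"
  proof
    assume "dependent (range v)"
    then obtain u where u: "\<exists>w\<in>range v. u w \<noteq> 0" "(\<Sum>w\<in>range v. u w *\<^sub>R w) = 0"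
      using dependent_finite[of "range v"] by auto
    have "(\<Sum>w\<in>range v. u w *\<^sub>R w) = (\<Sum>i\<in>UNIV. u (v i) *\<^sub>R v i)"
      using inj by (simp add: sum.reindex)
    then show False
      using indep[of "\<lambda>i. u (v i)"] u by auto
  qed
  have "card (range v) = 3"
    using inj by (simp add: card_image)
  moreover have "dim (UNIV :: aff set) = 3"
    by (simp add: dim_UNIV)
  ultimately have "UNIV \<subseteq> span (range v)"
    using ind by (intro card_ge_dim_independent) auto
  then show ?thesis
    using inj ind by (simp add: is_basis_def top.extremum_unique)
qed

text \<open>Both right-hand factors \<open>1 + cos B\<close> and \<open>1 + cos C\<close> are positive, and so is one of the two
  sines.\<close>

lemma triangle_coefficients_zero:
  fixes r1 r2 r3 :: real
  assumes "0 \<le> B" "B < pi" "0 \<le> C" "C < pi" "B \<noteq> 0 \<or> C \<noteq> 0"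
    and "r1 - r2 * cos C - r3 * cos B = 0" "r2 * sin C = r3 * sin B" "r1 + r2 + r3 = 0"
  shows "r1 = 0" "r2 = 0" "r3 = 0"
proof -
  have pos: "0 < 1 + cos x" "0 \<le> sin x" if "0 \<le> x" "x < pi" for x
    using cos_monotone_0_pi[of x pi] sin_ge_zero[of x] that by auto
  have s: "r2 * (1 + cos C) + r3 * (1 + cos B) = 0"
    using assms(6,8) by (simp add: algebra_simps)
  have "sin B \<noteq> 0 \<or> sin C \<noteq> 0"
    using assms(1-5) sin_gt_zero[of B] sin_gt_zero[of C] by auto
  then have "0 < sin C * (1 + cos B) + sin B * (1 + cos C)"
    using pos[OF assms(1,2)] pos[OF assms(3,4)]
    by (metis add_nonneg_pos add_pos_nonneg less_le mult_nonneg_nonneg mult_pos_pos)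
  moreover have "r3 * (sin C * (1 + cos B) + sin B * (1 + cos C)) = 0"
    "r2 * (sin C * (1 + cos B) + sin B * (1 + cos C)) = 0"
  proof -
    have "r3 * (sin C * (1 + cos B) + sin B * (1 + cos C))
      = sin C * (r2 * (1 + cos C) + r3 * (1 + cos B)) - (1 + cos C) * (r2 * sin C - r3 * sin B)"
      by (simp add: algebra_simps)
    then show "r3 * (sin C * (1 + cos B) + sin B * (1 + cos C)) = 0"
      using s assms(7) by simp
    have "r2 * (sin C * (1 + cos B) + sin B * (1 + cos C))
      = sin B * (r2 * (1 + cos C) + r3 * (1 + cos B)) + (1 + cos B) * (r2 * sin C - r3 * sin B)"
      by (simp add: algebra_simps)
    then show "r2 * (sin C * (1 + cos B) + sin B * (1 + cos C)) = 0"
      using s assms(7) by simp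
  qed
  ultimately show "r2 = 0" "r3 = 0"
    by auto
  then show "r1 = 0"
    using assms(8) by simp
qed

text \<open>Three unit normals with the prescribed angles and equal negative constant terms: the origin lies
  in the domain, and \<open>T\<close> is proportional to the common constant.\<close>

lemma region_exists:
  assumes sum: "A + B + C = pi" and rng: "0 \<le> A" "0 \<le> B" "0 \<le> C" "A < pi" "B < pi" "C < pi" and \<kappa>: "0 < \<kappa>"
  shows "\<exists>v. region_with_angles v A B C \<and> T v = \<kappa>"
proof -
  define S where "S = sin A + sin B + sin C"
  have "0 \<le> sin A" "0 \<le> sin B" "0 \<le> sin C"
    using rng by (auto intro: sin_ge_zero)
  moreover have "A \<noteq> 0 \<or> B \<noteq> 0"
    using sum rng by auto
  then have "0 < sin A \<or> 0 < sin B"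
    using rng sin_gt_zero by (metis less_le)
  ultimately have S: "0 < S"
    unfolding S_def by linarith
  \<comment> \<open>The common constant term.\<close>
  define d where "d = - (sqrt 2 * \<kappa> / S)"
  have d: "d < 0"
    using \<kappa> S by (simp add: d_def)
  define grad :: "real \<Rightarrow> real \<Rightarrow> real^2" where "grad x y = vector [sqrt 2 * x, sqrt 2 * y]" for x y
  have grad: "grad x y \<bullet> grad x' y' = 2 * (x * x' + y * y')" for x y x' y'
    by (simp add: grad_def inner_vec_def sum_2 algebra_simps)
  define v :: "3 \<Rightarrow> aff" where "v i = (if i = 1 then (grad 1 0, d) else if i = 2 then (grad (- cos C) (sin C), d)
      else (grad (- cos B) (- sin B), d))" for i
  have v: "v 1 = (grad 1 0, d)" "v 2 = (grad (- cos C) (sin C), d)" "v 3 = (grad (- cos B) (- sin B), d)"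
    by (simp_all add: v_def)
  have norm: "form (v i) (v i) = 2" for i
    using exhaust_3[of i] by (elim disjE) (simp_all add: v form_def grad sin_cos_squared_add3)
  have A: "A = pi - (B + C)"
    using sum by simp
  have forms: "form (v 2) (v 3) = - 2 * cos A" "form (v 3) (v 1) = - 2 * cos B" "form (v 1) (v 2) = - 2 * cos C"
    by (simp_all add: v form_def grad A cos_add)
  have ang: "ang v 1 = A" "ang v 2 = B" "ang v 3 = C"
    using forms norm rng by (simp_all add: ang_123 interior_angle_eqI)
  have "0 \<in> domain v"
    using d by (simp add: domain_def halfplane_def eval_def v_def)
  moreover have "is_basis v"
  proof (rule is_basisI)
    fix r assume "(\<Sum>i\<in>UNIV. r i *\<^sub>R v i) = 0"
    then have "r 1 *\<^sub>R v 1 + r 2 *\<^sub>R v 2 + r 3 *\<^sub>R v 3 = 0"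
      by (simp add: sum_3)
    then have "r 1 *\<^sub>R grad 1 0 + r 2 *\<^sub>R grad (- cos C) (sin C) + r 3 *\<^sub>R grad (- cos B) (- sin B) = 0"
      "r 1 * d + r 2 * d + r 3 * d = 0"
      by (simp_all add: v zero_prod_def)
    then have "sqrt 2 * (r 1 - r 2 * cos C - r 3 * cos B) = 0" "sqrt 2 * (r 2 * sin C - r 3 * sin B) = 0"
      "(r 1 + r 2 + r 3) * d = 0"
      by (simp_all add: grad_def vec_eq_iff forall_2 algebra_simps)
    then have eqs: "r 1 - r 2 * cos C - r 3 * cos B = 0" "r 2 * sin C = r 3 * sin B" "r 1 + r 2 + r 3 = 0"
      using d by simp_all
    have "B \<noteq> 0 \<or> C \<noteq> 0"
      using sum rng by auto
    then have "r 1 = 0" "r 2 = 0" "r 3 = 0"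
      using triangle_coefficients_zero[OF rng(2,5,3,6) _ eqs] by blast+
    then show "\<forall>i. r i = 0"
      by (simp add: forall_3)
  qed
  ultimately have reg: "region_with_angles v A B C"
    using norm ang by (auto simp: region_with_angles_def)
  interpret normalised_region v
    by (rule normalised_region_if_region_with_angles[OF reg sum rng])
  have "balance v = - (S * d)"
    by (simp add: balance_def sum_3 ang v S_def algebra_simps)
  also have "\<dots> = sqrt 2 * \<kappa>"
    using S by (simp add: d_def)
  finally have "T v = \<kappa>"
    by (simp add: T_eq_balance)
  then show ?thesis
    using reg by blast
qed

context belt_frame
begin

lemma cos_nonzero: "k \<le> 2 * n \<Longrightarrow> cos (real k * \<alpha>) \<noteq> 0"
  using cos_pos[of k] cos_neg[of k] by (cases "k \<le> n") auto

text \<open>The angles of the region and the orientation of the quiver prescribe \<open>i\<close>, \<open>j\<close>, \<open>m\<close> and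
  \<open>p\<close>, \<open>q\<close>: for an acute-angled region, \<open>i\<close> and \<open>j\<close> are source and sink; for an obtuse-angled one, \<open>m\<close>
  is opposite to the obtuse angle and \<open>j\<close>, \<open>i\<close> are its neighbours in the cyclic order. One case needs
  care: for an infinite region this may give \<open>p = 0\<close>. Then the quiver is also the quiver of the normal form
  with \<open>q = 0\<close>, by the isomorphism that exchanges the two parallel sides.\<close>

lemma realise_region:
  assumes reg: "region_with_angles \<Delta> (real n1 * \<alpha>) (real n2 * \<alpha>) (real n3 * \<alpha>)"
    and sum: "n1 + n2 + n3 = 2 * n + 1" and g: "gcd n1 (gcd n2 n3) = 1"
    and T: "T \<Delta> = K" and Q: "corresponding_quiver \<Delta> Q"
  obtains \<phi> i j m p q B where "isometry \<phi>" "state i j m 1 p q (push \<phi> \<circ> \<Delta>, B)"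
    "gcd (gcd p q) (2 * n + 1) = 1" "has_quiver (seed_of (push \<phi> \<circ> \<Delta>, B)) Q"
proof -
  define N where "N x = (if x = 1 then n1 else if x = 2 then n2 else n3)" for x :: 3
  have N: "N 1 = n1" "N 2 = n2" "N 3 = n3"
    by (simp_all add: N_def)
  have ang: "ang \<Delta> x = real (N x) * \<alpha>" for x
    using exhaust_3[of x] reg by (auto simp: region_with_angles_def N)
  have sumN: "N i + N j + N m = 2 * n + 1" if "i \<noteq> j" "i \<noteq> m" "j \<noteq> m" for i j m
    using exhaust_3[of i] exhaust_3[of j] exhaust_3[of m] that sum by (elim disjE) (simp_all add: N)
  have gcdN: "gcd (gcd (N i) (N j)) (2 * n + 1) = 1" if ne: "i \<noteq> j" "i \<noteq> m" "j \<noteq> m" for i j m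
  proof -
    define d where "d = gcd (gcd (N i) (N j)) (2 * n + 1)"
    have "d dvd N i" "d dvd N j" "d dvd 2 * n + 1"
      unfolding d_def by (meson dvd_trans gcd_dvd1 gcd_dvd2)+
    then have "d dvd N m"
      using sumN[OF ne] by (metis dvd_add dvd_add_right_iff)
    then have "d dvd N x" for x
      using index_cases[OF ne, of x] \<open>d dvd N i\<close> \<open>d dvd N j\<close> by blast
    then have "d dvd gcd n1 (gcd n2 n3)"
      using N by (metis gcd_greatest)
    then show ?thesis
      using g by (simp add: d_def)
  qed
  have N_le: "N x \<le> 2 * n" for x
  proof (rule ccontr)
    assume "\<not> N x \<le> 2 * n"
    then have "N (x + 1) = 0" "N (x + 2) = 0" "N x = 2 * n + 1"
      using sumN[of x "x + 1" "x + 2"] three_index_simps(1-3)[of x] by fastforce+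
    then show False
      using gcdN[of x "x + 1" "x + 2"] three_index_simps(1-3)[of x] n1 by simp
  qed
  have less_pi: "real (N x) * \<alpha> < pi" for x
    by (rule angle_less_pi[OF N_le])
  have full: "real (2 * n + 1) * \<alpha> = pi"
    using full_angle by (simp add: add.commute)
  have "real n1 * \<alpha> + real n2 * \<alpha> + real n3 * \<alpha> = real (n1 + n2 + n3) * \<alpha>"
    by (simp add: algebra_simps)
  then have pi_sum: "real n1 * \<alpha> + real n2 * \<alpha> + real n3 * \<alpha> = pi"
    unfolding sum full .
  have nr: "normalised_region \<Delta>"
    using less_pi[of 1] less_pi[of 2] less_pi[of 3] \<alpha>_pos
    by (intro normalised_region_if_region_with_angles[OF reg pi_sum]) (simp_all add: N)
  interpret normalised_region \<Delta> by (rule nr)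
  have bal: "balance \<Delta> = sqrt 2 * K"
    using T_eq_balance T by (simp add: field_simps)
  have QE: "exchange_matrix Q"
    using Q by (simp add: corresponding_quiver_def)
  have absQ: "\<bar>Q $ x $ y\<bar> = 2 * \<bar>cos (real (N z) * \<alpha>)\<bar>" if "x \<noteq> y" "x \<noteq> z" "y \<noteq> z" for x y z
    using Q that ang_opposite[OF that, of \<Delta>] by (simp add: corresponding_quiver_def ang)
  have nz: "Q $ x $ y \<noteq> 0" if "x \<noteq> y" for x y
  proof -
    obtain z where "x \<noteq> z" "y \<noteq> z"
      using exhaust_3[of x] exhaust_3[of y] that by (metis three_index_simps(1,2,3))
    then show ?thesis
      using absQ[OF that, of z] cos_nonzero[OF N_le[of z]] by auto
  qed
  have half: "real (N x) * \<alpha> < pi / 2 \<longleftrightarrow> N x \<le> n" "real (N x) * \<alpha> > pi / 2 \<longleftrightarrow> n < N x" for x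
    using angle_less_half_pi[of "N x"] angle_greater_half_pi[of "N x"] by linarith+
  have third: "ang \<Delta> m = pi - (real (N i) * \<alpha> + real (N j) * \<alpha>)"
    and cos_third: "cos (real (N m) * \<alpha>) = - cos (real (N i) * \<alpha> + real (N j) * \<alpha>)"
    if "i \<noteq> j" "i \<noteq> m" "j \<noteq> m" for i j m
  proof -
    have "real (N i) * \<alpha> + real (N j) * \<alpha> + real (N m) * \<alpha> = real (N i + N j + N m) * \<alpha>"
      by (simp add: algebra_simps)
    then have "real (N i) * \<alpha> + real (N j) * \<alpha> + real (N m) * \<alpha> = pi"
      unfolding sumN[OF that] full .
    then have "real (N m) * \<alpha> = pi - (real (N i) * \<alpha> + real (N j) * \<alpha>)"
      by simp
    then show "ang \<Delta> m = pi - (real (N i) * \<alpha> + real (N j) * \<alpha>)"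
      "cos (real (N m) * \<alpha>) = - cos (real (N i) * \<alpha> + real (N j) * \<alpha>)"
      by (simp_all add: ang)
  qed
  show thesis
  proof (cases "\<forall>x. N x \<le> n")
    case True
    then have "acute_angled \<Delta>"
      unfolding acute_angled_def ang half .
    then have "acyclic_quiver Q"
      using Q by (simp add: corresponding_quiver_def)
    then obtain i j m where ne: "i \<noteq> j" "i \<noteq> m" "j \<noteq> m" and pos: "Q $ i $ m > 0" "Q $ m $ j > 0" "Q $ i $ j > 0"
      using orient_triangle(1)[OF QE nz] by blast
    have c: "0 < cos (real (N x) * \<alpha>)" for x
      using cos_pos True by blast
    have w: "Q $ i $ m = 2 * cos (real (N j) * \<alpha>)" "Q $ m $ j = 2 * cos (real (N i) * \<alpha>)"
      "Q $ i $ j = - 2 * cos (real (N i) * \<alpha> + real (N j) * \<alpha>)"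
      using absQ[of i m j] absQ[of m j i] absQ[of i j m] ne pos c[of i] c[of j] c[of m] cos_third[OF ne] by simp_all
    have "1 \<le> N i"
      using sumN[OF ne] True[rule_format, of j] True[rule_format, of m] by simp
    then obtain \<phi> where \<phi>: "isometry \<phi>" "state i j m 1 (N i) (N j) (push \<phi> \<circ> \<Delta>, Q)"
      using place_region[OF nr bal ne ang ang third[OF ne] _ _ _ QE w] True by blast
    have "has_quiver (seed_of (push \<phi> \<circ> \<Delta>, Q)) Q"
      unfolding has_quiver_def using self_in_seed_of by (metis snd_conv)
    then show ?thesis
      by (rule that[OF \<phi> gcdN[OF ne]])
  next
    case False
    then obtain m where m: "n < N m"
      by (auto simp: not_le)
    then have "obtuse_angled \<Delta>"
      unfolding obtuse_angled_def ang half by blast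
    then have "\<not> acyclic_quiver Q"
      using Q by (simp add: corresponding_quiver_def)
    then obtain i j where ne: "i \<noteq> j" "i \<noteq> m" "j \<noteq> m" and pos: "Q $ i $ m > 0" "Q $ m $ j > 0" "Q $ j $ i > 0"
      using orient_triangle(2)[OF QE nz] by blast
    have le: "N i \<le> n" "N j \<le> n"
      using sumN[OF ne] m by simp_all
    have w: "Q $ i $ m = 2 * cos (real (N j) * \<alpha>)" "Q $ m $ j = 2 * cos (real (N i) * \<alpha>)"
      "Q $ i $ j = - 2 * cos (real (N i) * \<alpha> + real (N j) * \<alpha>)"
      "Q $ j $ i = 2 * cos (real (N i) * \<alpha> + real (N j) * \<alpha>)"
      using absQ[of i m j] absQ[of m j i] absQ[of j i m] ne pos cos_pos[OF le(1)] cos_pos[OF le(2)]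
        cos_neg[OF m N_le] cos_third[OF ne] exchange_skew[OF QE, of i j] by simp_all
    show ?thesis
    proof (cases "1 \<le> N i")
      case True
      then obtain \<phi> where \<phi>: "isometry \<phi>" "state i j m 1 (N i) (N j) (push \<phi> \<circ> \<Delta>, Q)"
        using place_region[OF nr bal ne ang ang third[OF ne] _ _ _ QE w(1-3)] le by blast
      have "has_quiver (seed_of (push \<phi> \<circ> \<Delta>, Q)) Q"
        unfolding has_quiver_def using self_in_seed_of by (metis snd_conv)
      then show ?thesis
        by (rule that[OF \<phi> gcdN[OF ne]])
    next
      case False
      \<comment> \<open>The finite side of the infinite region is \<open>i\<close>; in the normal form it has to be the side \<open>j\<close>.\<close>
      then have i0: "N i = 0" by simp
      then have j1: "1 \<le> N j"
        using sumN[OF ne] N_le[of m] by simp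
      have ne': "j \<noteq> i" "j \<noteq> m" "i \<noteq> m"
        using ne by auto
      define \<sigma> where "\<sigma> x = (if x = j then m else if x = m then j else x)" for x
      have s: "\<sigma> i = i" "\<sigma> j = m" "\<sigma> m = j" "\<sigma> (\<sigma> x) = x" for x
        using ne by (simp_all add: \<sigma>_def)
      then have "bij \<sigma>"
        by (intro involuntory_imp_bij)
      define B :: "real^3^3" where "B = (\<chi> x y. Q $ \<sigma> x $ \<sigma> y)"
      have BE: "exchange_matrix B"
        unfolding exchange_matrix_iff B_def vec_lambda_beta by (intro allI exchange_skew[OF QE])
      have wB: "B $ j $ m = 2 * cos (real (N i) * \<alpha>)" "B $ m $ i = 2 * cos (real (N j) * \<alpha>)"
        "B $ j $ i = - 2 * cos (real (N j) * \<alpha> + real (N i) * \<alpha>)"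
        using w i0 exchange_skew[OF QE, of m i] by (simp_all add: B_def s)
      obtain \<phi> where \<phi>: "isometry \<phi>" "state j i m 1 (N j) (N i) (push \<phi> \<circ> \<Delta>, B)"
        using place_region[OF nr bal ne' ang ang third[OF ne'] _ _ _ BE wB] le j1 by blast
      have "snd (relabel \<sigma> (push \<phi> \<circ> \<Delta>, B)) = Q"
        by (simp add: relabel_def B_def s vec_eq_iff)
      moreover have "relabel \<sigma> (push \<phi> \<circ> \<Delta>, B) \<in> seed_of (push \<phi> \<circ> \<Delta>, B)"
        unfolding seed_of_relabel_eq using \<open>bij \<sigma>\<close> by blast
      ultimately have "has_quiver (seed_of (push \<phi> \<circ> \<Delta>, B)) Q"
        unfolding has_quiver_def by blast
      then show ?thesis
        by (rule that[OF \<phi> gcdN[OF ne']])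
    qed
  qed
qed

end

section \<open>The initial triangle\<close>

lemma line_affine_hull: "affine hull {P, Q} = {P + t *\<^sub>R (Q - P) | t. True}"
  unfolding affine_hull_2_alt by auto

text \<open>Pythagoras shows that the foot of the perpendicular is the closest point.\<close>

lemma altitude_foot_eqI:
  assumes "F = Q + s *\<^sub>R (R - Q)" "(P - F) \<bullet> (R - Q) = 0"
  shows "altitude_foot P Q R = F"
proof -
  have "dist P F \<le> dist P G" if "G \<in> affine hull {Q, R}" for G
  proof -
    obtain t where t: "G = Q + t *\<^sub>R (R - Q)"
      using \<open>G \<in> affine hull {Q, R}\<close> unfolding line_affine_hull by blast
    have "F - G = (s - t) *\<^sub>R (R - Q)"
      by (simp add: assms(1) t algebra_simps)
    then have "(P - F) \<bullet> (F - G) = 0"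
      using assms(2) by simp
    moreover have "norm (x + y) ^ 2 = norm x ^ 2 + norm y ^ 2" if "x \<bullet> y = 0" for x y :: "real^2"
      using that by (simp add: power2_norm_eq_inner inner_add_left inner_add_right inner_commute[of y x])
    ultimately have "norm ((P - F) + (F - G)) ^ 2 = norm (P - F) ^ 2 + norm (F - G) ^ 2"
      by blast
    then have "norm (P - F) ^ 2 \<le> norm (P - G) ^ 2"
      by simp
    then show ?thesis
      by (simp add: dist_norm power2_le_iff_abs_le abs_le_square_iff[symmetric])
  qed
  moreover have "F \<in> affine hull {Q, R}"
    unfolding line_affine_hull using assms(1) by blast
  ultimately show ?thesis
    unfolding altitude_foot_def
    by (intro closest_point_unique[symmetric] affine_imp_convex closed_affine_hull affine_affine_hull) blast+
qed

lemma closest_point_line: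
  fixes P e x :: "real^2"
  assumes "e \<bullet> e = 1"
  shows "closest_point {P + t *\<^sub>R e | t. True} x = P + ((x - P) \<bullet> e) *\<^sub>R e"
proof -
  have "{P + t *\<^sub>R e | t. True} = affine hull {P, P + e}"
    unfolding line_affine_hull by simp
  then show ?thesis
    using altitude_foot_eqI[of "P + ((x - P) \<bullet> e) *\<^sub>R e" P "(x - P) \<bullet> e" "P + e" x] assms
    by (simp add: altitude_foot_def inner_diff_left inner_add_left)
qed

lemma eventually_negative_iff:
  "(\<forall>\<^sub>F t in at_top. c + t * s < 0) \<longleftrightarrow> s < 0 \<or> s = 0 \<and> c < (0::real)"
proof -
  consider "s < 0" | "s = 0" | "0 < s" by linarith
  then show ?thesis
  proof cases
    case 1
    have "\<forall>\<^sub>F t in at_top. c / - s < t"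
      by (rule eventually_gt_at_top)
    then have "\<forall>\<^sub>F t in at_top. c + t * s < 0"
      by (rule eventually_mono) (use 1 in \<open>simp add: field_simps\<close>)
    then show ?thesis
      using 1 by simp
  next
    case 2
    then show ?thesis by simp
  next
    case 3
    have "\<not> (\<forall>\<^sub>F t in at_top. c + t * s < 0)"
    proof
      assume "\<forall>\<^sub>F t in at_top. c + t * s < 0"
      moreover have "\<forall>\<^sub>F t in at_top. - c / s < t"
        by (rule eventually_gt_at_top)
      ultimately have "\<forall>\<^sub>F t :: real in at_top. False"
        by eventually_elim (use 3 in \<open>simp add: field_simps\<close>)
      then show False
        by simp
    qed
    then show ?thesis
      using 3 by simp
  qed
qed

lemma angle_at_inner:
  assumes "angle_at P Q R = \<theta>"
  shows "(P - Q) \<bullet> (R - Q) = norm (P - Q) * norm (R - Q) * cos \<theta>"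
proof (cases "P = Q \<or> R = Q")
  case True
  then show ?thesis by auto
next
  case False
  define c where "c = ((P - Q) \<bullet> (R - Q)) / (norm (P - Q) * norm (R - Q))"
  have "\<bar>c\<bar> \<le> 1"
    using Cauchy_Schwarz_ineq2[of "P - Q" "R - Q"] False by (simp add: c_def)
  then have "cos \<theta> = c"
    using assms cos_arccos_abs[of c] unfolding angle_at_def c_def by simp
  then show ?thesis
    using False by (simp add: c_def)
qed

text \<open>Equal base angles force equal legs: both legs have the same projection orthogonal to the
  base.\<close>

lemma isosceles_frame:
  fixes X Y Z :: "real^2"
  assumes iso: "isosceles X Y Z \<theta> \<gamma>" and \<theta>: "0 < \<theta>" "\<theta> < pi / 2"
  obtains u w h H where "u \<bullet> u = 1" "w \<bullet> w = 1" "u \<bullet> w = 0" "0 < h" "0 < H" "H * cos \<theta> = h * sin \<theta>"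
    "Y = X + (2 * h) *\<^sub>R u" "Z = X + h *\<^sub>R u + H *\<^sub>R w"
proof -
  have nc: "\<not> collinear {X, Y, Z}" and a: "angle_at Y X Z = \<theta>" "angle_at X Y Z = \<theta>"
    using iso by (simp_all add: isosceles_def)
  have ne: "X \<noteq> Y"
    using nc by auto
  define h where "h = norm (Y - X) / 2"
  define u where "u = (1 / (2 * h)) *\<^sub>R (Y - X)"
  have h: "0 < h"
    using ne by (simp add: h_def)
  have Y: "Y = X + (2 * h) *\<^sub>R u"
    using h by (simp add: u_def)
  have uu: "u \<bullet> u = 1"
  proof -
    have "norm u = 1"
      using ne by (simp add: u_def h_def)
    then show ?thesis by (simp add: norm_eq_1)
  qed
  define d1 d2 where "d1 = norm (Z - X)" and "d2 = norm (Z - Y)"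
  have nu: "norm u = 1"
    using uu by (simp add: norm_eq_1)
  have projection: "u \<bullet> r = norm r * cos \<theta>"
    if "((2 * h) *\<^sub>R u) \<bullet> r = norm ((2 * h) *\<^sub>R u) * norm r * cos \<theta>" for r
  proof -
    have "norm ((2 * h) *\<^sub>R u) = 2 * h"
      using h by (simp add: nu)
    then have "(2 * h) * (u \<bullet> r) = (2 * h) * (norm r * cos \<theta>)"
      using that by (simp only: inner_scaleR_left mult.assoc)
    moreover have "2 * h \<noteq> 0"
      using h by simp
    ultimately show ?thesis
      using mult_left_cancel[of "2 * h" "u \<bullet> r"] by blast
  qed
  have i1: "(Z - X) \<bullet> u = d1 * cos \<theta>"
  proof -
    have YX: "Y - X = (2 * h) *\<^sub>R u"
      by (simp add: Y)
    show ?thesis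
      using projection[OF angle_at_inner[OF a(1), unfolded YX]] by (simp only: d1_def inner_commute)
  qed
  have i2: "(Z - Y) \<bullet> u = - (d2 * cos \<theta>)"
  proof -
    have XY: "X - Y = - ((2 * h) *\<^sub>R u)"
      by (simp add: Y)
    have "((2 * h) *\<^sub>R u) \<bullet> (- (Z - Y)) = norm ((2 * h) *\<^sub>R u) * norm (- (Z - Y)) * cos \<theta>"
      using angle_at_inner[OF a(2), unfolded XY] by (simp only: inner_minus_left inner_minus_right norm_minus_cancel)
    then have "u \<bullet> (- (Z - Y)) = d2 * cos \<theta>"
      using projection by (simp only: norm_minus_cancel d2_def)
    then show ?thesis
      unfolding inner_minus_right inner_commute[of u] by (simp only: minus_equation_iff)
  qed
  have pu: "perp u \<bullet> perp u = 1" "u \<bullet> perp u = 0"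
    using uu by (simp_all add: perp_self perp_orthogonal)
  define y where "y = (Z - X) \<bullet> perp u"
  have y2: "y^2 = (d1 * sin \<theta>)^2"
  proof -
    have "((Z - X) \<bullet> u)^2 + y^2 = d1^2"
      using Lagrange_perp[of u "Z - X"] uu by (simp add: y_def d1_def inner_commute power2_norm_eq_inner)
    then show ?thesis
      unfolding i1 by (simp add: power_mult_distrib sin_squared_eq algebra_simps)
  qed
  have y3: "y^2 = (d2 * sin \<theta>)^2"
  proof -
    have "(Z - Y) \<bullet> perp u = y"
      using pu by (simp add: Y y_def inner_diff_left inner_add_left)
    then have "((Z - Y) \<bullet> u)^2 + y^2 = d2^2"
      using Lagrange_perp[of u "Z - Y"] uu by (simp add: d2_def inner_commute power2_norm_eq_inner)
    then show ?thesis
      unfolding i2 by (simp add: power_mult_distrib sin_squared_eq algebra_simps)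
  qed
  have s: "0 < sin \<theta>" "0 < cos \<theta>"
    using \<theta> by (auto intro: sin_gt_zero cos_gt_zero)
  have "d1 * sin \<theta> = d2 * sin \<theta>"
  proof (rule power2_eq_imp_eq)
    show "(d1 * sin \<theta>)\<^sup>2 = (d2 * sin \<theta>)\<^sup>2"
      using y2 y3 by simp
    show "0 \<le> d1 * sin \<theta>" "0 \<le> d2 * sin \<theta>"
      using s(1) by (simp_all add: d1_def d2_def)
  qed
  then have d: "d1 = d2"
    using s by simp
  have "(Z - X) \<bullet> u - (Z - Y) \<bullet> u = 2 * h"
    using uu by (simp add: Y inner_diff_left inner_add_left)
  then have hd: "h = d1 * cos \<theta>"
    unfolding i1 i2 d by simp
  have d1: "0 < d1"
    using hd h s by (metis d1_def less_irrefl mult_zero_left norm_ge_zero order_le_less)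
  define H where "H = d1 * sin \<theta>"
  have H: "0 < H"
    using d1 s by (simp add: H_def)
  obtain \<sigma> :: real where \<sigma>: "\<sigma> = 1 \<or> \<sigma> = -1" "y = \<sigma> * H"
    using y2 unfolding H_def power2_eq_iff by (metis mult_1 mult_minus_left)
  define w where "w = \<sigma> *\<^sub>R perp u"
  have "Z - X = ((Z - X) \<bullet> u) *\<^sub>R u + y *\<^sub>R perp u"
    unfolding y_def by (rule orthonormal_expand[OF uu pu])
  also have "\<dots> = h *\<^sub>R u + H *\<^sub>R w"
    unfolding i1 hd \<sigma>(2) w_def by (simp add: mult.commute)
  finally have "Z = X + h *\<^sub>R u + H *\<^sub>R w"
    by (simp add: algebra_simps)
  moreover have "w \<bullet> w = 1" "u \<bullet> w = 0"
    using \<sigma>(1) pu by (auto simp: w_def)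
  moreover have "H * cos \<theta> = h * sin \<theta>"
    by (simp add: H_def hd)
  ultimately show ?thesis
    using that uu h H Y by blast
qed

text \<open>A vector of norm \<open>sqrt 2\<close> orthogonal to a side is known up to sign; the third vertex of the
  triangle decides the sign.\<close>

lemma normal_of_side:
  fixes a :: "real^2"
  assumes "w \<bullet> w = 1" "w' \<bullet> w' = 1" "w \<bullet> w' = 0" "a \<bullet> a = 2" "a \<bullet> w = 0" "0 < a \<bullet> w'"
  shows "a = sqrt 2 *\<^sub>R w'"
proof -
  have a: "a = (a \<bullet> w') *\<^sub>R w'"
    using orthonormal_expand[OF assms(1-3), of a] assms(5) by simp
  have "a \<bullet> a = (a \<bullet> w') * (a \<bullet> w')"
    by (subst (2) a) simp
  then have "(a \<bullet> w')^2 = 2"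
    using assms(4) by (simp add: power2_eq_square)
  then have "a \<bullet> w' = sqrt 2"
    using assms(6) by (metis abs_of_pos real_sqrt_abs)
  then show ?thesis
    using a by simp
qed

text \<open>In the orthonormal frame \<open>u\<close>, \<open>w\<close> along the base \<open>XY\<close> and the altitude at \<open>Z\<close>, the foot of the
  altitude on \<open>XY\<close> is the midpoint \<open>M\<close>, and the foot on \<open>YZ\<close> is \<open>M + h e\<close>, where \<open>h\<close> is half the base and
  \<open>e = cos \<alpha> u + sin \<alpha> w\<close>, because \<open>2 n \<alpha> = \<pi> - \<alpha>\<close>. So the base makes the angle \<open>\<alpha>\<close> with the
  belt line, and all sides have the directions required by the normal form with \<open>p = 1\<close>, \<open>q = n\<close>.\<close>

lemma initial_belt_frame:
  assumes n: "n \<ge> 1" and \<alpha>: "\<alpha> = pi / (2 * real n + 1)"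
    and iso: "isosceles X Y Z (real n * \<alpha>) \<alpha>" and init: "initial_seed X Y Z (v0, B0)"
  obtains f where
    "belt_frame n \<alpha> (T v0) (altitude_foot Z X Y) (belt_direction X Y Z) f (is_positive X Y Z)"
    "belt_frame.state n \<alpha> (T v0) (altitude_foot Z X Y) (belt_direction X Y Z) f 1 3 2 1 1 n (v0, B0)"
    "belt_line X Y Z = {altitude_foot Z X Y + t *\<^sub>R belt_direction X Y Z | t. True}"
proof -
  define \<theta> where "\<theta> = real n * \<alpha>"
  have "(2 * real n + 1) * \<alpha> = pi"
    by (simp add: \<alpha>)
  then have two\<theta>: "\<alpha> = pi - 2 * \<theta>"
    by (simp add: \<theta>_def algebra_simps)
  have \<alpha>_pos: "0 < \<alpha>"
    by (simp add: \<alpha>)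
  have \<theta>: "0 < \<theta>" "\<theta> < pi / 2"
    using two\<theta> \<alpha>_pos n by (simp_all add: \<theta>_def)
  have s: "0 < sin \<theta>" "0 < cos \<theta>"
    using \<theta> by (auto intro: sin_gt_zero cos_gt_zero)
  obtain u w h H where uw: "u \<bullet> u = 1" "w \<bullet> w = 1" "u \<bullet> w = 0" and hH: "0 < h" "0 < H" "H * cos \<theta> = h * sin \<theta>"
    and Y: "Y = X + (2 * h) *\<^sub>R u" and Z: "Z = X + h *\<^sub>R u + H *\<^sub>R w"
    using isosceles_frame[OF iso[folded \<theta>_def] \<theta>] by blast
  have wu: "w \<bullet> u = 0"
    using uw by (simp add: inner_commute)
  have sides: "Y - X = (2 * h) *\<^sub>R u" "Z - X = h *\<^sub>R u + H *\<^sub>R w" "Z - Y = H *\<^sub>R w - h *\<^sub>R u"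
    by (simp_all add: Y Z vec_eq_iff algebra_simps)
  note dots = uw wu inner_add_left inner_add_right inner_diff_left inner_diff_right
  have c\<alpha>: "cos \<alpha> = sin \<theta> * sin \<theta> - cos \<theta> * cos \<theta>" "sin \<alpha> = 2 * sin \<theta> * cos \<theta>"
    unfolding two\<theta> cos_pi_minus sin_pi_minus by (simp_all add: cos_double sin_double power2_eq_square)
  have sc: "cos \<theta> * cos \<theta> = 1 - sin \<theta> * sin \<theta>"
    using sin_cos_squared_add3[of \<theta>] by linarith
  define e where "e = cos \<alpha> *\<^sub>R u + sin \<alpha> *\<^sub>R w"
  \<comment> \<open>Of the two unit normals of the belt line, this one gives the initial seed the sign \<open>\<eta> = 1\<close>.\<close>
  define f where "f = sin \<alpha> *\<^sub>R u - cos \<alpha> *\<^sub>R w"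
  have ef: "e \<bullet> e = 1" "f \<bullet> f = 1" "e \<bullet> f = 0"
    using sin_cos_squared_add3[of \<alpha>] by (simp_all add: e_def f_def dots add.commute)
  define M where "M = X + h *\<^sub>R u"
  have foot_Z: "altitude_foot Z X Y = M"
    by (rule altitude_foot_eqI[of _ _ "1 / 2"]) (simp_all add: M_def Y Z dots)
  have foot_X: "altitude_foot X Y Z = M + h *\<^sub>R e"
  proof -
    define r where "r = 2 * (cos \<theta> * cos \<theta>)"
    have "r * H = 2 * cos \<theta> * (H * cos \<theta>)"
      by (simp add: r_def)
    then have rH: "r * H = h * sin \<alpha>"
      unfolding hH(3) c\<alpha> by simp
    have "Y + r *\<^sub>R (Z - Y) = X + (2 * h - r * h) *\<^sub>R u + (r * H) *\<^sub>R w"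
      by (simp add: Y Z vec_eq_iff algebra_simps)
    moreover have "M + h *\<^sub>R e = X + (h + h * cos \<alpha>) *\<^sub>R u + (h * sin \<alpha>) *\<^sub>R w"
      by (simp add: M_def e_def vec_eq_iff algebra_simps)
    moreover have "2 * h - r * h = h + h * cos \<alpha>"
      unfolding c\<alpha> r_def sc by (simp add: algebra_simps)
    ultimately have on: "M + h *\<^sub>R e = Y + r *\<^sub>R (Z - Y)"
      using rH by simp
    have "(X - (M + h *\<^sub>R e)) \<bullet> (Z - Y) = h * (h + h * cos \<alpha>) - h * sin \<alpha> * H"
      by (simp add: M_def e_def Y Z dots algebra_simps)
    also have "\<dots> = 2 * h * h * sin \<theta> * sin \<theta> - 2 * h * sin \<theta> * (H * cos \<theta>)"
      unfolding c\<alpha> sc by (simp add: algebra_simps)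
    also have "\<dots> = 0"
      unfolding hH(3) by simp
    finally show ?thesis
      by (rule altitude_foot_eqI[OF on])
  qed
  have "norm e = 1"
    using ef by (simp add: norm_eq_1)
  then have dir: "belt_direction X Y Z = e"
    using hH(1) by (simp add: belt_direction_def foot_X foot_Z sgn_div_norm)
  have line: "belt_line X Y Z = {M + t *\<^sub>R e | t. True}"
  proof -
    have "belt_line X Y Z = {M + (t * h) *\<^sub>R e | t. True}"
      unfolding belt_line_def foot_X foot_Z line_affine_hull by simp
    also have "\<dots> = {M + t *\<^sub>R e | t. True}"
    proof (intro equalityI subsetI)
      fix x assume "x \<in> {M + t *\<^sub>R e | t. True}"
      then obtain t where "x = M + (t / h * h) *\<^sub>R e"
        using hH(1) by auto
      then show "x \<in> {M + (t * h) *\<^sub>R e | t. True}"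
        by blast
    qed blast
    finally show ?thesis .
  qed
  have geo: "geometric_realisation v0 B0" and dom: "domain v0 = interior (convex hull {X, Y, Z})"
    and on: "{X, Y} \<subseteq> line (v0 1)" "{X, Z} \<subseteq> line (v0 2)" "{Y, Z} \<subseteq> line (v0 3)"
    and B: "B0 $ 1 $ 2 > 0" "B0 $ 1 $ 3 > 0" "B0 $ 2 $ 3 > 0"
    using init by (simp_all add: initial_seed_def)
  have norm: "form (v0 i) (v0 i) = 2" for i
    using geo by (simp add: geometric_realisation_def)
  have nc: "\<not> collinear {X, Y, Z}"
    using iso by (simp add: isosceles_def)
  have zero: "eval (v0 1) X = 0" "eval (v0 1) Y = 0" "eval (v0 2) X = 0" "eval (v0 2) Z = 0"
     "eval (v0 3) Y = 0" "eval (v0 3) Z = 0"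
    using on by (auto simp: line_def)
  \<comment> \<open>Barycentric coordinates of a point of the domain show on which side of each line the third vertex lies.\<close>
  obtain P a b c where P: "P \<in> domain v0" "0 < a" "0 < b" "0 < c" "a + b + c = 1" "P = a *\<^sub>R X + b *\<^sub>R Y + c *\<^sub>R Z"
  proof -
    have "(1/3) *\<^sub>R X + (1/3) *\<^sub>R Y + (1/3) *\<^sub>R Z \<in> domain v0"
      unfolding dom interior_convex_hull_3_minimal[OF nc, simplified]
      by (intro CollectI exI[of _ "1/3"] conjI) simp_all
    then show ?thesis
      by (intro that[of _ "1/3" "1/3" "1/3"]) simp_all
  qed
  have evP: "eval g P = a * eval g X + b * eval g Y + c * eval g Z" for g
  proof -
    have "eval g P = fst g \<bullet> P + (a + b + c) * snd g"
      by (simp add: eval_def P(5))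
    then show ?thesis
      unfolding P(6) eval_def by (simp add: inner_add_right algebra_simps)
  qed
  have negP: "eval (v0 i) P < 0" for i
    using P(1) by (auto simp: domain_def halfplane_def)
  have neg: "eval (v0 1) Z < 0" "eval (v0 2) Y < 0" "eval (v0 3) X < 0"
    using negP[of 1] negP[of 2] negP[of 3] P(2-4) by (simp_all add: evP zero mult_less_0_iff)
  have diff: "eval g x - eval g y = fst g \<bullet> (x - y)" for g x y
    by (simp add: eval_def inner_diff_right)
  have grad1: "fst (v0 1) = sqrt 2 *\<^sub>R (- w)"
  proof (rule normal_of_side[where w = u])
    have "(2 * h) * (fst (v0 1) \<bullet> u) = 0"
      using diff[of "v0 1" Y X] unfolding sides zero by simp
    then show "fst (v0 1) \<bullet> u = 0"
      using hH(1) by simp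
    then show "0 < fst (v0 1) \<bullet> (- w)"
      using diff[of "v0 1" Z X] neg(1) hH(2) unfolding sides zero by (simp add: inner_add_right mult_less_0_iff)
  qed (use uw norm in \<open>simp_all add: form_def\<close>)
  have ort2: "(cos \<theta> *\<^sub>R u + sin \<theta> *\<^sub>R w) \<bullet> (cos \<theta> *\<^sub>R u + sin \<theta> *\<^sub>R w) = 1"
    "(- sin \<theta> *\<^sub>R u + cos \<theta> *\<^sub>R w) \<bullet> (- sin \<theta> *\<^sub>R u + cos \<theta> *\<^sub>R w) = 1"
    "(cos \<theta> *\<^sub>R u + sin \<theta> *\<^sub>R w) \<bullet> (- sin \<theta> *\<^sub>R u + cos \<theta> *\<^sub>R w) = 0"
    "(- cos \<theta> *\<^sub>R u + sin \<theta> *\<^sub>R w) \<bullet> (- cos \<theta> *\<^sub>R u + sin \<theta> *\<^sub>R w) = 1"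
    "(sin \<theta> *\<^sub>R u + cos \<theta> *\<^sub>R w) \<bullet> (sin \<theta> *\<^sub>R u + cos \<theta> *\<^sub>R w) = 1"
    "(- cos \<theta> *\<^sub>R u + sin \<theta> *\<^sub>R w) \<bullet> (sin \<theta> *\<^sub>R u + cos \<theta> *\<^sub>R w) = 0"
    by (simp_all add: dots sc)
  have perp2: "fst (v0 2) \<bullet> (cos \<theta> *\<^sub>R u + sin \<theta> *\<^sub>R w) = 0"
  proof -
    have "h * (fst (v0 2) \<bullet> u) + H * (fst (v0 2) \<bullet> w) = 0"
      using diff[of "v0 2" Z X] unfolding sides zero by (simp add: inner_add_right)
    then have "cos \<theta> * (h * (fst (v0 2) \<bullet> u) + H * (fst (v0 2) \<bullet> w)) = 0"
      by simp
    then have "h * (cos \<theta> * (fst (v0 2) \<bullet> u)) + (H * cos \<theta>) * (fst (v0 2) \<bullet> w) = 0"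
      by (simp add: algebra_simps)
    then have "h * (cos \<theta> * (fst (v0 2) \<bullet> u) + sin \<theta> * (fst (v0 2) \<bullet> w)) = 0"
      unfolding hH(3) by (simp add: algebra_simps)
    then show ?thesis
      using hH(1) by (simp add: inner_add_right)
  qed
  have grad2: "fst (v0 2) = sqrt 2 *\<^sub>R (- sin \<theta> *\<^sub>R u + cos \<theta> *\<^sub>R w)"
  proof (rule normal_of_side[OF ort2(1-3) _ perp2])
    have u2: "fst (v0 2) \<bullet> u < 0"
      using diff[of "v0 2" Y X] neg(2) hH(1) unfolding sides zero by (simp add: mult_less_0_iff)
    have "sin \<theta> * (fst (v0 2) \<bullet> w) = - (cos \<theta> * (fst (v0 2) \<bullet> u))"
      using perp2 by (simp add: inner_add_right)
    moreover have "sin \<theta> * (fst (v0 2) \<bullet> (- sin \<theta> *\<^sub>R u + cos \<theta> *\<^sub>R w))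
      = cos \<theta> * (sin \<theta> * (fst (v0 2) \<bullet> w)) - sin \<theta> * sin \<theta> * (fst (v0 2) \<bullet> u)"
      by (simp add: inner_add_right algebra_simps)
    ultimately have "sin \<theta> * (fst (v0 2) \<bullet> (- sin \<theta> *\<^sub>R u + cos \<theta> *\<^sub>R w))
      = - ((cos \<theta> * cos \<theta> + sin \<theta> * sin \<theta>) * (fst (v0 2) \<bullet> u))"
      by (simp only: distrib_right)
    then have "sin \<theta> * (fst (v0 2) \<bullet> (- sin \<theta> *\<^sub>R u + cos \<theta> *\<^sub>R w)) = - (fst (v0 2) \<bullet> u)"
      by (simp only: sin_cos_squared_add3 mult_1)
    then have "0 < sin \<theta> * (fst (v0 2) \<bullet> (- sin \<theta> *\<^sub>R u + cos \<theta> *\<^sub>R w))"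
      using u2 by simp
    then show "0 < fst (v0 2) \<bullet> (- sin \<theta> *\<^sub>R u + cos \<theta> *\<^sub>R w)"
      using s(1) by (rule zero_less_mult_pos)
  qed (use norm in \<open>simp add: form_def\<close>)
  have perp3: "fst (v0 3) \<bullet> (- cos \<theta> *\<^sub>R u + sin \<theta> *\<^sub>R w) = 0"
  proof -
    have "- h * (fst (v0 3) \<bullet> u) + H * (fst (v0 3) \<bullet> w) = 0"
      using diff[of "v0 3" Z Y] unfolding sides zero by (simp add: inner_diff_right)
    then have "cos \<theta> * (- h * (fst (v0 3) \<bullet> u) + H * (fst (v0 3) \<bullet> w)) = 0"
      by simp
    then have "- h * (cos \<theta> * (fst (v0 3) \<bullet> u)) + (H * cos \<theta>) * (fst (v0 3) \<bullet> w) = 0"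
      by (simp add: algebra_simps)
    then have "h * (- cos \<theta> * (fst (v0 3) \<bullet> u) + sin \<theta> * (fst (v0 3) \<bullet> w)) = 0"
      unfolding hH(3) by (simp add: algebra_simps)
    then show ?thesis
      using hH(1) by (simp add: inner_add_right inner_diff_right)
  qed
  have grad3: "fst (v0 3) = sqrt 2 *\<^sub>R (sin \<theta> *\<^sub>R u + cos \<theta> *\<^sub>R w)"
  proof (rule normal_of_side[OF ort2(4-6) _ perp3])
    have u3: "0 < fst (v0 3) \<bullet> u"
    proof (rule zero_less_mult_pos)
      show "0 < (2 * h) * (fst (v0 3) \<bullet> u)"
        using diff[of "v0 3" Y X] neg(3) unfolding sides zero by simp
    qed (use hH(1) in simp)
    have "sin \<theta> * (fst (v0 3) \<bullet> w) = cos \<theta> * (fst (v0 3) \<bullet> u)"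
      using perp3 by (simp add: inner_add_right inner_diff_right)
    moreover have "sin \<theta> * (fst (v0 3) \<bullet> (sin \<theta> *\<^sub>R u + cos \<theta> *\<^sub>R w))
      = cos \<theta> * (sin \<theta> * (fst (v0 3) \<bullet> w)) + sin \<theta> * sin \<theta> * (fst (v0 3) \<bullet> u)"
      by (simp add: inner_add_right algebra_simps)
    ultimately have "sin \<theta> * (fst (v0 3) \<bullet> (sin \<theta> *\<^sub>R u + cos \<theta> *\<^sub>R w))
      = (cos \<theta> * cos \<theta> + sin \<theta> * sin \<theta>) * (fst (v0 3) \<bullet> u)"
      by (simp only: distrib_right)
    then have "sin \<theta> * (fst (v0 3) \<bullet> (sin \<theta> *\<^sub>R u + cos \<theta> *\<^sub>R w)) = fst (v0 3) \<bullet> u"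
      by (simp only: sin_cos_squared_add3 mult_1)
    then have "0 < sin \<theta> * (fst (v0 3) \<bullet> (sin \<theta> *\<^sub>R u + cos \<theta> *\<^sub>R w))"
      using u3 by simp
    then show "0 < fst (v0 3) \<bullet> (sin \<theta> *\<^sub>R u + cos \<theta> *\<^sub>R w)"
      using s(1) by (rule zero_less_mult_pos)
  qed (use norm in \<open>simp add: form_def\<close>)
  have mid: "M - X = h *\<^sub>R u" "M - Y = - (h *\<^sub>R u)"
    by (simp_all add: M_def Y vec_eq_iff algebra_simps)
  have evM: "eval (v0 1) M = 0" "eval (v0 2) M = - (sqrt 2 * h * sin \<theta>)" "eval (v0 3) M = - (sqrt 2 * h * sin \<theta>)"
    using diff[of "v0 1" M X] diff[of "v0 2" M X] diff[of "v0 3" M Y]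
    unfolding mid zero grad1 grad2 grad3 by (simp_all add: dots)
  have forms: "form (v0 2) (v0 3) = - 2 * cos \<alpha>" "form (v0 3) (v0 1) = - 2 * cos \<theta>" "form (v0 1) (v0 2) = - 2 * cos \<theta>"
    by (simp_all add: form_def grad1 grad2 grad3 dots c\<alpha> algebra_simps)
  have \<alpha>_pi: "\<alpha> < pi" "\<theta> < pi"
    using two\<theta> \<theta> pi_gt_zero by linarith+
  have angs: "ang v0 1 = \<alpha>" "ang v0 2 = \<theta>" "ang v0 3 = \<theta>"
    unfolding ang_123 using forms norm \<alpha>_pos \<theta>(1) \<alpha>_pi
    by (intro interior_angle_eqI; simp)+
  have nr: "normalised_region v0"
  proof
    show "domain v0 \<noteq> {}" using P(1) by (metis empty_iff)
    show "0 \<le> ang v0 i" "ang v0 i < pi" for i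
      using exhaust_3[of i] angs \<alpha>_pos \<theta> \<alpha>_pi by auto
    show "ang v0 1 + ang v0 2 + ang v0 3 = pi"
      using angs two\<theta> by simp
  qed (rule norm)
  interpret R: normalised_region v0 by (rule nr)
  have "balance v0 = 2 * sqrt 2 * h * sin \<theta> * sin \<theta>"
    using R.balance_eval[of 1 M] by (simp add: angs evM ac_simps)
  then have Tv: "T v0 = 2 * h * sin \<theta> * sin \<theta>"
    by (simp add: R.T_eq_balance)
  interpret belt_frame n \<alpha> "T v0" M e f "is_positive X Y Z"
  proof
    show "0 < T v0"
      using Tv hH(1) s by simp
    show "is_positive X Y Z g \<longleftrightarrow> fst g \<bullet> e < 0 \<or> fst g \<bullet> e = 0 \<and> eval g M < 0" for g
      unfolding is_positive_def foot_Z dir halfplane_def mem_Collect_eq eval_add inner_scaleR_right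
      by (rule eventually_negative_iff)
  qed (use ef n \<alpha> in simp_all)
  have add: "cos (\<alpha> + \<theta>) = - cos \<theta>" "sin (\<alpha> + \<theta>) = sin \<theta>"
    using two\<theta> cos_pi_minus[of \<theta>] sin_pi_minus[of \<theta>] by simp_all
  have B0: "\<bar>B0 $ i $ j\<bar> = \<bar>form (v0 i) (v0 j)\<bar>" if "i \<noteq> j" for i j
    using geo that by (simp add: geometric_realisation_def)
  have c\<alpha>_pos: "0 < cos \<alpha>"
    using \<alpha>_pos n two\<theta> \<theta> angle_less_half_pi[OF n] by (intro cos_gt_zero) auto
  have scaled: "cx g = r \<bullet> e" "cy g = r \<bullet> f" if "fst g = sqrt 2 *\<^sub>R r" for g r
    unfolding cx_def cy_def that by simp_all
  have st: "state 1 3 2 1 1 n (v0, B0)"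
  proof (rule stateI[where a = \<alpha> and b = \<theta>])
    show "exchange_matrix (snd (v0, B0))"
      using geo by (simp add: geometric_realisation_def)
    show "snd (v0, B0) $ 1 $ 2 = 2 * cos \<theta>" "snd (v0, B0) $ 2 $ 3 = 2 * cos \<alpha>" "snd (v0, B0) $ 1 $ 3 = - 2 * cos (\<alpha> + \<theta>)"
      using B0[of 1 2] B0[of 2 3] B0[of 3 1] B forms s(2) c\<alpha>_pos add exchange_skew[of B0 3 1] geo
      by (simp_all add: geometric_realisation_def)
    show "sin \<alpha> * cd (fst (v0, B0) 1) + sin \<theta> * cd (fst (v0, B0) 3) + sin (\<alpha> + \<theta>) * cd (fst (v0, B0) 2) = - T v0"
      "cos \<alpha> * cd (fst (v0, B0) 1) + cos \<theta> * cd (fst (v0, B0) 3) + cos (\<alpha> + \<theta>) * cd (fst (v0, B0) 2) = 0"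
      by (simp_all add: cd_def evM add Tv)
    show "cx (fst (v0, B0) 1) = - sin \<alpha>" "cy (fst (v0, B0) 1) = 1 * cos \<alpha>"
      unfolding fst_conv scaled[OF grad1] by (simp_all add: e_def f_def dots)
    have "sin \<theta> * cos \<alpha> + cos \<theta> * sin \<alpha> = sin \<theta>" "cos \<theta> * cos \<alpha> - sin \<theta> * sin \<alpha> = - cos \<theta>"
      using add by (simp_all add: sin_add cos_add algebra_simps)
    then show "cx (fst (v0, B0) 3) = sin \<theta>" "cy (fst (v0, B0) 3) = 1 * cos \<theta>"
      unfolding fst_conv scaled[OF grad3] by (simp_all add: e_def f_def dots algebra_simps)
    show "cx (fst (v0, B0) 2) = sin (\<alpha> - \<theta>)" "cy (fst (v0, B0) 2) = - 1 * cos (\<alpha> - \<theta>)"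
      unfolding fst_conv scaled[OF grad2] by (simp_all add: e_def f_def dots sin_diff cos_diff algebra_simps)
  qed (use n in \<open>simp_all add: \<theta>_def\<close>)
  show ?thesis
    by (rule that[of f, unfolded foot_Z dir, OF belt_frame_axioms st line])
qed

section \<open>Counting congruent seeds\<close>

lemma has_quiver_iff: "has_quiver (seed_of s) Q \<longleftrightarrow> (\<exists>\<sigma>. bij \<sigma> \<and> snd (relabel \<sigma> s) = Q)"
  unfolding has_quiver_def seed_of_relabel_eq by blast

context belt_frame
begin

lemma translate_reflect_seed_of:
  assumes "b = {ori + t *\<^sub>R e | t. True}"
  shows "translate (\<delta> *\<^sub>R e) (move (reflect_across b) (seed_of s)) = seed_of (act (-1) \<delta> s)"
proof -
  have "reflect_across b x = glide (-1) 0 x" for x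
  proof -
    have "x - ori = ((x - ori) \<bullet> e) *\<^sub>R e + ((x - ori) \<bullet> f) *\<^sub>R f"
      by (rule expand)
    then have "x = ori + ((x - ori) \<bullet> e) *\<^sub>R e + ((x - ori) \<bullet> f) *\<^sub>R f"
      by (simp add: algebra_simps)
    moreover have "reflect_across b x = 2 *\<^sub>R (ori + ((x - ori) \<bullet> e) *\<^sub>R e) - x"
      unfolding reflect_across_def assms closest_point_line[OF ee] ..
    moreover have "2 *\<^sub>R (p + q) - x = p + q - r" if "x = p + q + r" for p q r :: "real^2"
      by (simp add: that scaleR_2)
    ultimately have "reflect_across b x = ori + ((x - ori) \<bullet> e) *\<^sub>R e - ((x - ori) \<bullet> f) *\<^sub>R f"
      by metis
    then show ?thesis
      by (simp add: glide_def)
  qed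
  then have "reflect_across b = glide (-1) 0"
    by (rule ext)
  then have "move (reflect_across b) (seed_of s) = seed_of (act (-1) 0 s)"
    by (simp only: move_seed_of act_def)
  then show ?thesis
    by (simp add: translate_seed_of act_act)
qed

text \<open>The quiver determines the two angles of a seed, and these determine it up to a glide.\<close>

lemma same_quiver_glide:
  assumes s: "is_state s" and t: "is_state t" and "has_quiver (seed_of s) Q" "has_quiver (seed_of t) Q"
  obtains \<epsilon> \<tau> where "\<epsilon> = 1 \<or> \<epsilon> = -1" "seed_of t = seed_of (act \<epsilon> \<tau> s)"
proof -
  obtain \<sigma> \<sigma>' where \<sigma>: "bij \<sigma>" "snd (relabel \<sigma> s) = Q" and \<sigma>': "bij \<sigma>'" "snd (relabel \<sigma>' t) = Q"
    using assms(3,4) unfolding has_quiver_iff by blast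
  obtain i j m \<eta> p q where u: "state i j m \<eta> p q (relabel \<sigma> s)"
    using is_state_relabel[OF s \<sigma>(1)] unfolding is_state_def by blast
  obtain i' j' m' \<eta>' p' q' where u': "state i' j' m' \<eta>' p' q' (relabel \<sigma>' t)"
    using is_state_relabel[OF t \<sigma>'(1)] unfolding is_state_def by blast
  have eq: "i = i'" "j = j'" "m = m'" "p = p'" "q = q'"
    using state_quiver_determines[OF u u'] \<sigma>(2) \<sigma>'(2) by auto
  obtain \<tau> where "relabel \<sigma>' t = act (\<eta> * \<eta>') \<tau> (relabel \<sigma> s)"
    using state_glide[OF u u'[folded eq]] by blast
  then have "seed_of t = seed_of (act (\<eta> * \<eta>') \<tau> s)"
    by (metis act_relabel seed_of_relabel \<sigma>(1) \<sigma>'(1))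
  moreover have "\<eta> * \<eta>' = 1 \<or> \<eta> * \<eta>' = -1"
    using stateD(4)[OF u] stateD(4)[OF u'] by auto
  ultimately show ?thesis
    using that by blast
qed

lemma congruent_act:
  assumes "\<epsilon> = 1 \<or> \<epsilon> = -1" "isometry \<phi>"
  shows "has_domain_congruent_to (seed_of (act \<epsilon> \<tau> (push \<phi> \<circ> \<Delta>, B))) \<Delta>"
proof -
  have "domain (push (glide \<epsilon> \<tau>) \<circ> (push \<phi> \<circ> \<Delta>)) = glide \<epsilon> \<tau> ` \<phi> ` domain \<Delta>"
    unfolding domain_push[OF isometry_glide[OF assms(1)]] domain_push[OF assms(2)] ..
  then have "(glide \<epsilon> \<tau> \<circ> \<phi>) ` domain \<Delta> = domain (fst (act \<epsilon> \<tau> (push \<phi> \<circ> \<Delta>, B)))"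
    by (simp add: act_def image_comp)
  moreover have "isometry (glide \<epsilon> \<tau> \<circ> \<phi>)"
    by (intro isometry_comp isometry_glide assms)
  ultimately show ?thesis
    unfolding has_domain_congruent_to_def congruent_sets_def using self_in_seed_of by blast
qed

lemma has_quiver_act: "has_quiver (seed_of (act \<epsilon> \<tau> s)) Q \<longleftrightarrow> has_quiver (seed_of s) Q"
  unfolding has_quiver_iff by (simp add: act_relabel[symmetric] act_snd)

text \<open>The exchange graph is preserved by one glide reflection, whose square is a translation.\<close>

lemma linked_reflection:
  assumes s0: "is_state s0" and \<rho>: "linked s0 (act (-1) \<rho> s0)" and t: "linked s0 t"
  shows "linked s0 (act (-1) \<rho> t)" "2 * \<rho> \<in> translation_group s0"
proof -
  have *: "linked s0 (act (-1) \<rho> t)" if "linked s0 t" for t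
    using linked_trans[OF \<rho> linked_act[OF that, of "-1" \<rho>]] by simp
  show "linked s0 (act (-1) \<rho> t)"
    by (rule *[OF t])
  have "act (-1) \<rho> (act (-1) \<rho> s0) = act 1 (2 * \<rho>) s0"
    by (simp add: act_act)
  then show "2 * \<rho> \<in> translation_group s0"
    using *[OF \<rho>] by (simp add: translation_group_def)
qed

text \<open>Every seed of the graph with quiver \<open>Q\<close> is a glide of the placed region. The glides that stay inside the
  graph are the translations in \<open>L\<close> and their compositions with one glide reflection. The two classes are
  distinct because a reflection changes the sign \<open>\<eta>\<close>, which a translation keeps.\<close>

lemma congruence_classes:
  fixes \<Delta> Q s0
  defines "L \<equiv> (\<lambda>\<tau>. \<tau> *\<^sub>R e) ` translation_group s0"
    and "M \<equiv> {S \<in> fst (exchange_graph pos s0). has_domain_congruent_to S \<Delta> \<and> has_quiver S Q}"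
  assumes s0: "state i0 j0 m0 \<eta>0 1 n s0" and b: "b = {ori + t *\<^sub>R e | t. True}"
    and \<phi>: "isometry \<phi>" and s: "state i j m 1 p q (push \<phi> \<circ> \<Delta>, B)"
    and g: "gcd (gcd p q) (2 * n + 1) = 1" and Q: "has_quiver (seed_of (push \<phi> \<circ> \<Delta>, B)) Q"
  shows "card (M // translation_rel L) = 2"
    and "\<And>S S'. S \<in> M \<Longrightarrow> S' \<in> M \<Longrightarrow> (\<exists>w\<in>L. S' = translate w S) \<or>
      (\<exists>w. 2 *\<^sub>R w \<in> L \<and> S' = translate w (move (reflect_across b) S))"
proof -
  have is0: "is_state s0"
    using s0 unfolding is_state_def by blast
  obtain \<rho> where \<rho>: "linked s0 (act (-1) \<rho> s0)"
    using component_reflected[OF s0] by blast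
  obtain \<epsilon> \<tau> where e: "\<epsilon> = 1 \<or> \<epsilon> = -1" and l1: "linked s0 (act \<epsilon> \<tau> (push \<phi> \<circ> \<Delta>, B))"
    using state_glides_into_component[OF s0 s g] by blast
  define s1 where "s1 = act \<epsilon> \<tau> (push \<phi> \<circ> \<Delta>, B)"
  define s2 where "s2 = act (-1) \<rho> s1"
  have st1: "state i j m \<epsilon> p q s1"
    using state_act[OF s e, of \<tau>] by (simp add: s1_def)
  have st2: "state i j m (- \<epsilon>) p q s2"
    using state_act[OF st1, of "-1" \<rho>] by (simp add: s2_def)
  have l1: "linked s0 s1"
    using l1 by (simp add: s1_def)
  have l2: "linked s0 s2"
    unfolding s2_def by (rule linked_reflection(1)[OF is0 \<rho> l1])
  have M1: "seed_of s1 \<in> M"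
    unfolding M_def using l1 congruent_act[OF e \<phi>] Q has_quiver_act
    by (simp add: seed_of_in_graph_iff s1_def)
  have s2': "s2 = act (- \<epsilon>) (\<rho> + \<tau>) (push \<phi> \<circ> \<Delta>, B)"
    using e by (simp add: s2_def s1_def act_act)
  have M2: "seed_of s2 \<in> M"
    unfolding M_def using l2 congruent_act[of "- \<epsilon>" \<phi> "\<rho> + \<tau>" \<Delta> B] e \<phi> Q has_quiver_act
    by (auto simp: seed_of_in_graph_iff s2')
  have glide_from: "\<exists>\<epsilon> \<tau>. (\<epsilon> = 1 \<or> \<epsilon> = -1) \<and> S' = seed_of (act \<epsilon> \<tau> t)"
    if "S' \<in> M" "seed_of t \<in> M" for S' t
  proof -
    obtain t' where t': "S' = seed_of t'"
      using \<open>S' \<in> M\<close> unfolding M_def exchange_graph_def by auto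
    have "linked s0 t" "linked s0 t'" and hq: "has_quiver (seed_of t) Q" "has_quiver (seed_of t') Q"
      using that unfolding M_def t' seed_of_in_graph_iff[symmetric] by simp_all
    then have "is_state t" "is_state t'"
      using linked_is_state[OF _ is0] by blast+
    then show ?thesis
      using same_quiver_glide[OF _ _ hq] t' by metis
  qed
  have linkedM: "linked s0 t" if "seed_of t \<in> M" for t
    using that unfolding M_def by (simp add: seed_of_in_graph_iff)
  show "(\<exists>w\<in>L. S' = translate w S) \<or>
      (\<exists>w. 2 *\<^sub>R w \<in> L \<and> S' = translate w (move (reflect_across b) S))" if S: "S \<in> M" and S': "S' \<in> M" for S S'
  proof -
    obtain t where t: "S = seed_of t"
      using \<open>S \<in> M\<close> unfolding M_def exchange_graph_def by auto
    obtain \<epsilon>' \<delta> where d: "\<epsilon>' = 1 \<or> \<epsilon>' = -1" "S' = seed_of (act \<epsilon>' \<delta> t)"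
      using glide_from[OF S' S[unfolded t]] by blast
    have lt: "linked s0 t" and lt': "linked s0 (act \<epsilon>' \<delta> t)"
      using linkedM S S' unfolding t d(2) by blast+
    show ?thesis
    proof (cases "\<epsilon>' = 1")
      case True
      then have "\<delta> \<in> translation_group s0"
        using linked_act_iff_translation_group[OF is0 lt] lt' by blast
      then have "\<exists>w\<in>L. S' = translate w S"
        unfolding L_def d(2) t True translate_seed_of[symmetric] by blast
      then show ?thesis ..
    next
      case False
      then have m1: "\<epsilon>' = -1"
        using d(1) by simp
      have "act 1 (\<delta> - \<rho>) (act (-1) \<rho> t) = act (-1) \<delta> t"
        by (simp add: act_act)
      then have "linked s0 (act 1 (\<delta> - \<rho>) (act (-1) \<rho> t))"
        using lt' m1 by simp
      then have "\<delta> - \<rho> \<in> translation_group s0"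
        using linked_act_iff_translation_group[OF is0 linked_reflection(1)[OF is0 \<rho> lt]] by blast
      then have "(\<delta> - \<rho>) + (\<delta> - \<rho>) + 2 * \<rho> \<in> translation_group s0"
        by (intro translation_group_add[OF is0] linked_reflection(2)[OF is0 \<rho> lt])
      then have "2 *\<^sub>R (\<delta> *\<^sub>R e) \<in> L"
        unfolding L_def by (simp add: image_iff) (metis (no_types))
      moreover have "S' = translate (\<delta> *\<^sub>R e) (move (reflect_across b) S)"
        unfolding t translate_reflect_seed_of[OF b] d(2) m1 ..
      ultimately show ?thesis by blast
    qed
  qed
  let ?r = "translation_rel L"
  have class_eq: "?r `` {seed_of (act 1 \<tau> t)} = ?r `` {seed_of t}" if \<tau>: "\<tau> \<in> translation_group s0" for \<tau> t
  proof -
    have cls: "?r `` {seed_of t} = {seed_of (act 1 \<tau> t) | \<tau>. \<tau> \<in> translation_group s0}" for t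
      unfolding translation_rel_def L_def by (auto simp: translate_seed_of[symmetric])
    have "seed_of (act 1 \<tau>' (act 1 \<tau> t)) = seed_of (act 1 (\<tau>' + \<tau>) t)" for \<tau>'
      by (simp add: act_act)
    then have "?r `` {seed_of (act 1 \<tau> t)} \<subseteq> ?r `` {seed_of t}"
      unfolding cls using translation_group_add[OF is0 _ \<tau>] by blast
    moreover have "seed_of (act 1 \<tau>' t) = seed_of (act 1 (\<tau>' + - \<tau>) (act 1 \<tau> t))" for \<tau>'
      by (simp add: act_act)
    then have "?r `` {seed_of t} \<subseteq> ?r `` {seed_of (act 1 \<tau> t)}"
      unfolding cls using translation_group_add[OF is0 _ translation_group_uminus[OF is0 \<tau>]] by blast
    ultimately show ?thesis
      by blast
  qed
  have "?r `` {S} = ?r `` {seed_of s1} \<or> ?r `` {S} = ?r `` {seed_of s2}" if S: "S \<in> M" for S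
  proof -
    obtain \<epsilon>' \<delta> where d: "\<epsilon>' = 1 \<or> \<epsilon>' = -1" "S = seed_of (act \<epsilon>' \<delta> s1)"
      using glide_from[OF S M1] by blast
    have lt': "linked s0 (act \<epsilon>' \<delta> s1)"
      using linkedM S unfolding d(2) by blast
    show ?thesis
    proof (cases "\<epsilon>' = 1")
      case True
      then have "\<delta> \<in> translation_group s0"
        using linked_act_iff_translation_group[OF is0 l1] lt' by blast
      then show ?thesis
        using class_eq unfolding d(2) True by blast
    next
      case False
      then have "act \<epsilon>' \<delta> s1 = act 1 (\<delta> - \<rho>) s2"
        using d(1) by (simp add: act_act s2_def)
      then have "\<delta> - \<rho> \<in> translation_group s0" "S = seed_of (act 1 (\<delta> - \<rho>) s2)"
        using linked_act_iff_translation_group[OF is0 l2] lt' d(2) by simp_all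
      then show ?thesis
        using class_eq by blast
    qed
  qed
  then have "M // ?r = {?r `` {seed_of s1}, ?r `` {seed_of s2}}"
    using M1 M2 unfolding quotient_def by blast
  moreover have "?r `` {seed_of s1} \<noteq> ?r `` {seed_of s2}"
  proof
    assume eq: "?r `` {seed_of s1} = ?r `` {seed_of s2}"
    have "seed_of s2 = translate (0 *\<^sub>R e) (seed_of s2)"
      by (simp only: translate_seed_of act_id)
    then have "seed_of s2 \<in> ?r `` {seed_of s2}"
      unfolding translation_rel_def L_def using translation_group_zero by blast
    then have "seed_of s2 \<in> ?r `` {seed_of s1}"
      unfolding eq .
    then obtain \<tau>' where "seed_of s2 = translate (\<tau>' *\<^sub>R e) (seed_of s1)"
      unfolding translation_rel_def L_def by blast
    then have "seed_of (act 1 \<tau>' s1) = seed_of s2"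
      by (simp add: translate_seed_of)
    then obtain \<sigma> where \<sigma>: "bij \<sigma>" "s2 = relabel \<sigma> (act 1 \<tau>' s1)"
      using seed_of_eqD by blast
    have u: "state i j m \<epsilon> p q (act 1 \<tau>' s1)"
      using state_act[OF st1, of 1 \<tau>'] by simp
    have u': "state (\<sigma> i) (\<sigma> j) (\<sigma> m) (- \<epsilon>) p q (act 1 \<tau>' s1)"
      using st2 unfolding \<sigma>(2) state_relabel_iff[OF \<sigma>(1)] .
    have "\<sigma> i = i"
      using state_quiver_determines(1)[OF u u' refl] by simp
    then have "\<epsilon> * cos (real p * \<alpha>) = - \<epsilon> * cos (real p * \<alpha>)"
      using stateD(10)[OF u] stateD(10)[OF u'] by simp
    then show False
      using e cos_pos[OF stateD(6)[OF s]] by auto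
  qed
  ultimately show "card (M // ?r) = 2"
    by simp
qed

end

theorem theorem6p4:
  fixes n :: nat and \<alpha> :: real and X Y Z :: "real^2"
    and v0 :: "3 \<Rightarrow> aff" and B0 :: "real^3^3"
    and \<Gamma> :: "seed ugraph" and I :: "int \<Rightarrow> seed"
    and b :: "(real^2) set" and L :: "(real^2) set"
  assumes "n \<ge> 1" and "\<alpha> = pi / (2 * real n + 1)"
    and "isosceles X Y Z (real n * \<alpha>) \<alpha>"
    and "initial_seed X Y Z (v0, B0)"
    and "b = belt_line X Y Z"
    and "\<Gamma> = exchange_graph (is_positive X Y Z) (v0, B0)"
    and "acyclic_belt (is_positive X Y Z) (v0, B0) I"
    and "L = translation_lattice (belt_direction X Y Z) \<Gamma>"
  shows "(\<forall>w\<in>L. inj (\<lambda>m. translate w (I m)) \<and>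
             full_subgraph (path_graph (\<lambda>m. translate w (I m))) \<Gamma>) \<and>
         (\<forall>n1 n2 n3 :: nat.
            n1 \<le> 2 * n + 1 \<and> n2 \<le> 2 * n + 1 \<and> n3 \<le> 2 * n + 1 \<and>
            n1 + n2 + n3 = 2 * n + 1 \<and> gcd n1 (gcd n2 n3) = 1 \<longrightarrow>
            (\<exists>\<Delta>. region_with_angles \<Delta> (real n1 * \<alpha>) (real n2 * \<alpha>) (real n3 * \<alpha>) \<and> T \<Delta> = T v0) \<and>
            (\<forall>\<Delta> Q. region_with_angles \<Delta> (real n1 * \<alpha>) (real n2 * \<alpha>) (real n3 * \<alpha>) \<and>
                   T \<Delta> = T v0 \<and> corresponding_quiver \<Delta> Q \<longrightarrow>
               (let M = {S \<in> fst \<Gamma>. has_domain_congruent_to S \<Delta> \<and> has_quiver S Q} in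
                  card (M // translation_rel L) = 2 \<and>
                  (\<forall>S\<in>M. \<forall>S'\<in>M.
                     (\<exists>w\<in>L. S' = translate w S) \<or>
                     (\<exists>w. 2 *\<^sub>R w \<in> L \<and> S' = translate w (move (reflect_across b) S))))))"
proof -
  obtain f where
    frame: "belt_frame n \<alpha> (T v0) (altitude_foot Z X Y) (belt_direction X Y Z) f (is_positive X Y Z)"
    and s0: "belt_frame.state n \<alpha> (T v0) (altitude_foot Z X Y) (belt_direction X Y Z) f 1 3 2 1 1 n (v0, B0)"
    and line: "belt_line X Y Z = {altitude_foot Z X Y + t *\<^sub>R belt_direction X Y Z | t. True}"
    using initial_belt_frame[OF assms(1-4)] by blast
  interpret belt_frame n \<alpha> "T v0" "altitude_foot Z X Y" "belt_direction X Y Z" f "is_positive X Y Z"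
    by (rule frame)
  let ?s0 = "(v0, B0)"
  have is0: "is_state ?s0"
    using s0 unfolding is_state_def by blast
  have L: "L = (\<lambda>\<tau>. \<tau> *\<^sub>R belt_direction X Y Z) ` translation_group ?s0"
    unfolding assms(8,6) translation_lattice_def translation_lengths_eq[OF is0] ..
  have path: "source_path ?s0 I"
    by (rule source_path_acyclic_belt[OF assms(7) s0]) simp
  have belts: "\<forall>w\<in>L. inj (\<lambda>m. translate w (I m)) \<and> full_subgraph (path_graph (\<lambda>m. translate w (I m))) \<Gamma>"
  proof
    fix w assume "w \<in> L"
    then obtain \<tau> where \<tau>: "\<tau> \<in> translation_group ?s0" "w = \<tau> *\<^sub>R belt_direction X Y Z"
      unfolding L by blast
    have "source_path ?s0 (\<lambda>m. translate w (I m))"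
      unfolding \<tau>(2) by (rule source_path_translate[OF path is0 \<tau>(1)])
    then show "inj (\<lambda>m. translate w (I m)) \<and> full_subgraph (path_graph (\<lambda>m. translate w (I m))) \<Gamma>"
      using source_path_inj source_path_full[OF _ is0] unfolding assms(6) by blast
  qed
  have exists: "\<exists>\<Delta>. region_with_angles \<Delta> (real n1 * \<alpha>) (real n2 * \<alpha>) (real n3 * \<alpha>) \<and> T \<Delta> = T v0"
    if sum: "n1 + n2 + n3 = 2 * n + 1" and g: "gcd n1 (gcd n2 n3) = 1" for n1 n2 n3 :: nat
  proof (rule region_exists)
    have "real n1 * \<alpha> + real n2 * \<alpha> + real n3 * \<alpha> = real (n1 + n2 + n3) * \<alpha>"
      by (simp add: algebra_simps)
    also have "\<dots> = (2 * real n + 1) * \<alpha>"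
      unfolding sum by (simp add: add.commute)
    finally show "real n1 * \<alpha> + real n2 * \<alpha> + real n3 * \<alpha> = pi"
      by (simp only: full_angle)
    have le: "n1 \<noteq> 2 * n + 1" "n2 \<noteq> 2 * n + 1" "n3 \<noteq> 2 * n + 1"
      using sum g assms(1) by auto
    show "real n1 * \<alpha> < pi" "real n2 * \<alpha> < pi" "real n3 * \<alpha> < pi"
      using le sum by (auto intro!: angle_less_pi)
  qed (use \<alpha>_pos K in simp_all)
  have classes: "\<forall>\<Delta> Q. region_with_angles \<Delta> (real n1 * \<alpha>) (real n2 * \<alpha>) (real n3 * \<alpha>) \<and>
                   T \<Delta> = T v0 \<and> corresponding_quiver \<Delta> Q \<longrightarrow>
               (let M = {S \<in> fst \<Gamma>. has_domain_congruent_to S \<Delta> \<and> has_quiver S Q} in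
                  card (M // translation_rel L) = 2 \<and>
                  (\<forall>S\<in>M. \<forall>S'\<in>M.
                     (\<exists>w\<in>L. S' = translate w S) \<or>
                     (\<exists>w. 2 *\<^sub>R w \<in> L \<and> S' = translate w (move (reflect_across b) S))))"
    if sum: "n1 + n2 + n3 = 2 * n + 1" and g: "gcd n1 (gcd n2 n3) = 1" for n1 n2 n3 :: nat
  proof (intro allI impI, elim conjE)
    fix \<Delta> Q
    assume \<Delta>: "region_with_angles \<Delta> (real n1 * \<alpha>) (real n2 * \<alpha>) (real n3 * \<alpha>)" "T \<Delta> = T v0"
        "corresponding_quiver \<Delta> Q"
    obtain \<phi> i j m p q B where r: "isometry \<phi>" "state i j m 1 p q (push \<phi> \<circ> \<Delta>, B)"
      "gcd (gcd p q) (2 * n + 1) = 1" "has_quiver (seed_of (push \<phi> \<circ> \<Delta>, B)) Q"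
      using realise_region[OF \<Delta>(1) sum g \<Delta>(2,3)] by blast
    show "let M = {S \<in> fst \<Gamma>. has_domain_congruent_to S \<Delta> \<and> has_quiver S Q} in
                  card (M // translation_rel L) = 2 \<and>
                  (\<forall>S\<in>M. \<forall>S'\<in>M.
                     (\<exists>w\<in>L. S' = translate w S) \<or>
                     (\<exists>w. 2 *\<^sub>R w \<in> L \<and> S' = translate w (move (reflect_across b) S)))"
      unfolding Let_def L assms(5,6)
      by (intro conjI ballI congruence_classes[OF s0 line r])
  qed
  show ?thesis
    by (rule conjI[OF belts], intro allI impI, elim conjE, rule conjI, rule exists, assumption, assumption,
        rule classes)
qed

end
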